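(* Let $m>p\geq 2$ be integers such that $m\not\sim p$, i.e. $\frac{\log p}{\log m}\notin\mathbb{Q}$. Let $\mu\in\mathcal{P}([0,1]^2)$ be a Borel probability measure that is invariant and ergodic under $T_p\times T_p$, and assume there exists a linear projection $\pi:\mathbb{R}^2\to\mathbb{R}$ with $\pi\notin\{P_1,P_2\}$ such that $\dim\pi\mu<\dim\mu$. Then: (1) $\mu$ is pointwise generic for $\lambda\times P_2\mu$ under the map $T_m\times T_p$; (2) if $n$ is another integer with $n\not\sim p$ and $m>n>p$, then $\mu$ is pointwise generic for $\lambda\times\lambda$ under the map $T_m\times T_n$.
   Context: For an integer $q\geq 2$, $T_q(x)=qx \bmod 1$ on $[0,1]$ (identified with $\mathbb{T}=\mathbb{R}/\mathbb{Z}$), and $T_a\times T_b$ acts on $[0,1]^2\cong\mathbb{T}^2$ coordinatewise. $\lambda$ is Lebesgue measure on $[0,1]$. $P_1(x,y)=x$, $P_2(x,y)=y$ are the principal projections; $\pi\mu$ denotes the push-forward of $\mu$ under $\pi$. For a probability measure $\mu$, $\dim\mu=\inf\{\dim_H A:\ \mu(A)>0\}$ (lower Hausdorff dimension). A measure $\mu$ on $[0,1]^2$ is pointwise generic under a map $T$ for a measure $\rho$ if for $\mu$-a.e. $z$, $\frac1N\sum_{k=0}^{N-1}f(T^kz)\to\int f\,d\rho$ for every $f\in C(\mathbb{T}^2)$. *)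

theory Defs
  imports "HOL-Probability.Probability"
begin

definition Tq :: "nat \<Rightarrow> real \<Rightarrow> real" where
  "Tq q x = frac (real q * x)"

definition Tprod :: "nat \<Rightarrow> nat \<Rightarrow> real \<times> real \<Rightarrow> real \<times> real" where
  "Tprod a b z = (Tq a (fst z), Tq b (snd z))"

definition hausdorff_content :: "real \<Rightarrow> real \<Rightarrow> 'a::metric_space set \<Rightarrow> ennreal" where
  "hausdorff_content s \<delta> A =
     (INF U \<in> {U :: nat \<Rightarrow> 'a set. A \<subseteq> (\<Union>i. U i) \<and> (\<forall>i. bounded (U i) \<and> diameter (U i) \<le> \<delta>)}.
        (\<Sum>i. ennreal (diameter (U i) powr s)))"

definition hausdorff_measure :: "real \<Rightarrow> 'a::metric_space set \<Rightarrow> ennreal" where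
  "hausdorff_measure s A = (SUP \<delta> \<in> {0<..}. hausdorff_content s \<delta> A)"

definition hausdorff_dim :: "'a::metric_space set \<Rightarrow> real" where
  "hausdorff_dim A = Inf {s. 0 \<le> s \<and> hausdorff_measure s A = 0}"

definition measure_dim :: "'a::metric_space measure \<Rightarrow> real" where
  "measure_dim \<mu> = Inf {hausdorff_dim A | A. A \<in> sets \<mu> \<and> emeasure \<mu> A > 0}"

definition invariant_meas :: "('a \<Rightarrow> 'a) \<Rightarrow> 'a measure \<Rightarrow> bool" where
  "invariant_meas T \<mu> \<longleftrightarrow> T \<in> \<mu> \<rightarrow>\<^sub>M \<mu> \<and> distr \<mu> \<mu> T = \<mu>"

definition ergodic_meas :: "('a \<Rightarrow> 'a) \<Rightarrow> 'a measure \<Rightarrow> bool" where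
  "ergodic_meas T \<mu> \<longleftrightarrow> invariant_meas T \<mu> \<and>
     (\<forall>A \<in> sets \<mu>. T -` A \<inter> space \<mu> = A \<longrightarrow> emeasure \<mu> A = 0 \<or> emeasure \<mu> A = 1)"

text \<open>continuous functions on the 2-torus = continuous Z^2-periodic functions on R^2\<close>
definition torus_cont :: "(real \<times> real \<Rightarrow> real) \<Rightarrow> bool" where
  "torus_cont f \<longleftrightarrow> continuous_on UNIV f \<and>
     (\<forall>x y. f (x + 1, y) = f (x, y) \<and> f (x, y + 1) = f (x, y))"

definition pointwise_generic ::
  "(real \<times> real) measure \<Rightarrow> (real \<times> real \<Rightarrow> real \<times> real) \<Rightarrow> (real \<times> real) measure \<Rightarrow> bool" where
  "pointwise_generic \<mu> T \<rho> \<longleftrightarrow>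
     (AE z in \<mu>. \<forall>f. torus_cont f \<longrightarrow>
        (\<lambda>N. (\<Sum>k<N. f ((T ^^ k) z)) / real N) \<longlonglongrightarrow> integral\<^sup>L \<rho> f)"

definition leb01 :: "real measure" where
  "leb01 = restrict_space lborel {0..1}"

end

theory Submission
  imports Defs
begin

text \<open>Let \<open>X\<close>, \<open>Y\<close> be the coordinates modulo \<open>1\<close>, and let \<open>Q K q\<close> be the probability that two points drawn
  independently from a common \<open>p\<close>-adic square of level \<open>K\<close> agree in their next \<open>q\<close> digits of \<open>X\<close>.
  By ergodicity either \<open>Q K q\<close> tends to \<open>0\<close> with \<open>q\<close>, uniformly in \<open>K\<close>, or \<open>Q K q\<close> tends to \<open>1\<close> with \<open>K\<close>,
  for every \<open>q\<close>. In the second case a typical block of digits of \<open>X\<close> is determined by the preceding digits of the pair;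
  as a strip over an interval of the projection determines \<open>Y\<close> once \<open>X\<close> is known, it
  meets only subexponentially many squares of its own width, so that the projection
  cannot lower the dimension, against the hypothesis.

  In the first case the conditional law of \<open>T\<^sup>K z\<close> given the first \<open>K\<close> digits spreads out in the direction
  of \<open>X\<close>, hence most of its Fourier coefficients, on a logarithmic scale of frequencies, are small.
  The character of frequency \<open>(u m\<^sup>k, c b\<^sup>k)\<close> with \<open>b < m\<close>, seen from a cell of side about \<open>m\<^sup>-\<^sup>k\<close>, only
  depends on \<open>X\<close>, and its rescaled frequency moves along an irrational rotation of the logarithmic scale,
  because \<open>log m / log p\<close> is irrational. So most characters are almost orthogonal to the past, and a law of
  large numbers for martingale differences makes their averages vanish almost surely. Characters that do not
  involve \<open>X\<close> are treated by the ergodic theorem in part (1) and by exchanging the coordinates in part (2).\<close>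

section \<open>Ergodic theorems\<close>

text \<open>The averages of prediction sizes along one phase cannot be computed by an ergodic
  theorem: the time-\<open>\<beta>\<close> map of the suspension may fail to be ergodic when
  eigenvalues of the dynamics resonate with \<open>\<beta>\<close>. What survives is the maximal
  inequality, which controls most phases, up to a set of small measure depending on the number of
  terms. The phase that occurs is however prescribed by the frequency. Irrationality of
  \<open>\<beta>\<close> enters precisely there: it carries a window of phases next to the
  prescribed one into a region with few bad phases, at the cost of finitely many terms, and
  Lipschitz dependence on the frequency pays for replacing the phase by a nearby one. The past
  consists of digits of both coordinates although only digits of \<open>X\<close> are to be
  predicted. This suits both cases: a cell of the past has small diameter, so characters at earlier
  times are nearly known, and in the deterministic case a strip can be followed from cell to cell.
  As the projection is not principal, both coefficients are nonzero, and the deterministic case can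
  be excluded with the coordinates in either order.\<close>

locale mpt = prob_space M for M :: "'a measure" +
  fixes T :: "'a \<Rightarrow> 'a"
  assumes T_meas [measurable]: "T \<in> M \<rightarrow>\<^sub>M M"
    and T_inv: "distr M M T = M"
begin

lemma Tn_meas [measurable]: "(T ^^ n) \<in> M \<rightarrow>\<^sub>M M"
  by (rule measurable_compose_n) (rule T_meas)

lemma Tn_inv: "distr M M (T ^^ n) = M"
proof (induction n)
  case 0
  show ?case by (simp add: distr_id)
next
  case (Suc n)
  have "distr M M (T ^^ Suc n) = distr (distr M M (T ^^ n)) M T"
    by (subst distr_distr) (auto simp: o_def)
  then show ?case using Suc T_inv by (simp add: comp_def)
qed

lemma T_space: "z \<in> space M \<Longrightarrow> T z \<in> space M"
  using T_meas by (rule measurable_space)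

lemma Tn_space: "z \<in> space M \<Longrightarrow> (T ^^ n) z \<in> space M"
  by (rule measurable_space[OF Tn_meas])

lemma integral_Tn:
  fixes f :: "'a \<Rightarrow> real"
  assumes [measurable]: "f \<in> borel_measurable M"
  shows "(\<integral>z. f ((T ^^ n) z) \<partial>M) = integral\<^sup>L M f"
  using integral_distr[OF Tn_meas assms, of n] by (simp add: Tn_inv)

lemma integrable_Tn:
  fixes f :: "'a \<Rightarrow> real"
  assumes "integrable M f"
  shows "integrable M (\<lambda>z. f ((T ^^ n) z))"
  using integrable_distr[OF Tn_meas, of n f] assms by (simp add: Tn_inv)

lemma nn_integral_Tn:
  assumes [measurable]: "f \<in> borel_measurable M"
  shows "(\<integral>\<^sup>+z. f ((T ^^ n) z) \<partial>M) = integral\<^sup>N M f"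
  using nn_integral_distr[OF Tn_meas, of f n] by (simp add: Tn_inv)

lemma prob_Tn:
  assumes [measurable]: "Measurable.pred M P"
  shows "prob {z \<in> space M. P ((T ^^ n) z)} = prob {z \<in> space M. P z}"
proof -
  have "prob {z \<in> space M. P z} = measure (distr M M (T ^^ n)) {z \<in> space M. P z}"
    by (simp add: Tn_inv)
  also have "\<dots> = prob ((T ^^ n) -` {z \<in> space M. P z} \<inter> space M)"
    by (rule measure_distr) auto
  also have "(T ^^ n) -` {z \<in> space M. P z} \<inter> space M = {z \<in> space M. P ((T ^^ n) z)}"
    using Tn_space by auto
  finally show ?thesis by simp
qed

text \<open>Garsia's argument: with \<open>F = max(0, S\<^sub>1, \<dots>, S\<^sub>N)\<close> one has \<open>f \<ge> F - F \<circ> T\<close> wherever \<open>F > 0\<close>.\<close>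

lemma maximal_ergodic:
  fixes f :: "'a \<Rightarrow> real" and N :: nat
  assumes f: "integrable M f"
  defines "E \<equiv> {z \<in> space M. \<exists>n\<in>{1..N}. (\<Sum>k<n. f ((T ^^ k) z)) > 0}"
  shows "0 \<le> (\<integral>z. indicator E z * f z \<partial>M)"
proof -
  have [measurable]: "f \<in> borel_measurable M" using f by auto
  define S where "S n z = (\<Sum>k<n. f ((T ^^ k) z))" for n z
  define F where "F z = Max ((\<lambda>n. S n z) ` {0..N})" for z
  have Sint: "integrable M (S n)" for n
    unfolding S_def by (intro Bochner_Integration.integrable_sum integrable_Tn f)
  have [measurable]: "S n \<in> borel_measurable M" for n using Sint by auto
  have Fmeas [measurable]: "F \<in> borel_measurable M"
    unfolding F_def by (rule borel_measurable_Max) auto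
  have Sle: "S n z \<le> F z" if "n \<le> N" for n z
    unfolding F_def using that by (intro Max_ge) auto
  have Fnn: "0 \<le> F z" for z using Sle[of 0 z] by (simp add: S_def)
  have Fle: "F z \<le> (\<Sum>n\<le>N. \<bar>S n z\<bar>)" for z
  proof -
    have "F z \<in> (\<lambda>n. S n z) ` {0..N}" unfolding F_def by (intro Max_in) auto
    then obtain n where n: "n \<le> N" "F z = S n z" by auto
    have "\<bar>S n z\<bar> \<le> (\<Sum>n\<le>N. \<bar>S n z\<bar>)" using n(1)
      by (intro member_le_sum) auto
    then show ?thesis using n by linarith
  qed
  have Fint: "integrable M F"
  proof (rule Bochner_Integration.integrable_bound)
    show "integrable M (\<lambda>z. \<Sum>n\<le>N. \<bar>S n z\<bar>)" using Sint by auto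
    show "AE x in M. norm (F x) \<le> norm (\<Sum>n\<le>N. \<bar>S n x\<bar>)"
      using Fle Fnn by (intro AE_I2) (metis abs_ge_self abs_of_nonneg order_trans real_norm_def)
  qed auto
  have FTint: "integrable M (\<lambda>z. F (T z))" using integrable_Tn[OF Fint, of 1] by simp
  have Eeq: "E = {z \<in> space M. F z > 0}"
  proof -
    have "(\<exists>n\<in>{1..N}. S n z > 0) \<longleftrightarrow> F z > 0" for z
    proof
      assume "\<exists>n\<in>{1..N}. S n z > 0"
      then show "F z > 0" using Sle by (meson atLeastAtMost_iff less_le_trans)
    next
      assume pos: "F z > 0"
      have "F z \<in> (\<lambda>n. S n z) ` {0..N}" unfolding F_def by (intro Max_in) auto
      then obtain n where n: "n \<le> N" "F z = S n z" by auto
      moreover have "n \<noteq> 0" using n pos by (intro notI) (auto simp: S_def)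
      ultimately have "n \<in> {1..N}" by simp
      then show "\<exists>n\<in>{1..N}. S n z > 0" using pos n(2) by metis
    qed
    then show ?thesis unfolding E_def S_def by auto
  qed
  have [measurable]: "E \<in> sets M" unfolding Eeq by measurable
  have key: "indicator E z * f z \<ge> F z - F (T z)" if z: "z \<in> space M" for z
  proof (cases "F z > 0")
    case True
    have "F z \<in> (\<lambda>n. S n z) ` {0..N}" unfolding F_def by (intro Max_in) auto
    then obtain n where n: "n \<le> N" "F z = S n z" by auto
    moreover have "n \<noteq> 0" using n True by (intro notI) (auto simp: S_def)
    then obtain k where k: "n = Suc k" by (cases n) auto
    have "S (Suc k) z = f z + S k (T z)"
      unfolding S_def by (subst sum.lessThan_Suc_shift) (simp add: funpow_swap1)
    moreover have "S k (T z) \<le> F (T z)" using k n by (intro Sle) auto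
    ultimately show ?thesis using True z k n unfolding Eeq by auto
  next
    case False
    then have "F z = 0" using Fnn[of z] by simp
    then show ?thesis using False Fnn[of "T z"] unfolding Eeq by (simp add: indicator_def)
  qed
  have "0 = (\<integral>z. F z - F (T z) \<partial>M)"
    using integral_Tn[OF Fmeas, of 1] Fint FTint by simp
  also have "\<dots> \<le> (\<integral>z. indicator E z * f z \<partial>M)"
    by (rule integral_mono_AE)
      (use Fint FTint f key in \<open>auto intro!: integrable_real_mult_indicator simp: mult.commute\<close>)
  finally show ?thesis .
qed

text \<open>Garsia's inequality for \<open>f - l\<close>; since \<open>f \<ge> 0\<close>, its
  integral over the exceptional set is at most the full integral. The bound is uniform in
  \<open>N\<close> and will be applied to the flow and to powers of \<open>T\<close>, maps that may
  fail to be ergodic.\<close>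

lemma maximal_weak_type:
  fixes f :: "'a \<Rightarrow> real"
  assumes f: "integrable M f" and pos: "\<And>z. 0 \<le> f z"
  shows "l * prob {z \<in> space M. \<exists>n\<in>{1..N}. (\<Sum>k<n. f ((T ^^ k) z)) > l * real n} \<le> integral\<^sup>L M f"
proof -
  have [measurable]: "f \<in> borel_measurable M" using f by auto
  define E where "E = {z \<in> space M. \<exists>n\<in>{1..N}. (\<Sum>k<n. f ((T ^^ k) z) - l) > 0}"
  have [measurable]: "E \<in> sets M" unfolding E_def by measurable
  have E2: "E = {z \<in> space M. \<exists>n\<in>{1..N}. (\<Sum>k<n. f ((T ^^ k) z)) > l * real n}"
    unfolding E_def by (auto simp: sum_subtractf mult.commute)
  have 1: "integrable M (\<lambda>z. indicator E z * f z)"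
    using integrable_real_mult_indicator[OF \<open>E \<in> sets M\<close> f] by (simp add: mult.commute)
  have 2: "integrable M (\<lambda>z. indicator E z * l)"
    by (intro integrable_mult_left) (auto simp: integrable_indicator_iff emeasure_eq_measure)
  have "0 \<le> (\<integral>z. indicator E z * (f z - l) \<partial>M)"
    using maximal_ergodic[of "\<lambda>z. f z - l" N] f unfolding E_def by simp
  also have "\<dots> = (\<integral>z. indicator E z * f z \<partial>M) - (\<integral>z. indicator E z * l \<partial>M)"
    using Bochner_Integration.integral_diff[OF 1 2] by (simp add: algebra_simps)
  also have "(\<integral>z. indicator E z * l \<partial>M) = l * prob E" by (simp add: Int_absorb2 sets.sets_into_space)
  also have "(\<integral>z. indicator E z * f z \<partial>M) \<le> integral\<^sup>L M f"
    by (rule integral_mono[OF 1 f]) (use pos in \<open>auto simp: indicator_def\<close>)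
  finally show ?thesis unfolding E2 by simp
qed

end

locale ergodic_mpt = mpt +
  assumes ergodic: "\<And>A. A \<in> sets M \<Longrightarrow> T -` A \<inter> space M = A \<Longrightarrow> prob A = 0 \<or> prob A = 1"
begin

text \<open>If the upper limit of the averages exceeded the mean by a fixed amount on a set of full
  measure, the maximal inequality for \<open>f - b - e / 2\<close> would give a nonnegative
  integral, whereas this function has integral \<open>- e / 2\<close>. The exceptional set is
  invariant, so ergodicity leaves only measure \<open>0\<close>.\<close>

lemma birkhoff_upper:
  fixes f :: "'a \<Rightarrow> real"
  assumes [measurable]: "f \<in> borel_measurable M" and B: "\<And>z. \<bar>f z\<bar> \<le> B"
    and e: "e > 0"
  shows "AE z in M. \<forall>\<^sub>F n in sequentially. (\<Sum>k<n. f ((T ^^ k) z)) / real n \<le> integral\<^sup>L M f + e"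
proof -
  define A where "A n z = (\<Sum>k<n. f ((T ^^ k) z)) / real n" for n z
  have [measurable]: "A n \<in> borel_measurable M" for n unfolding A_def by measurable
  define b where "b = integral\<^sup>L M f"
  \<comment> \<open>The margin \<open>1 / Suc j\<close> expresses a strict excess by countably many
    conditions, and makes \<open>P\<close> invariant at every point: passing from \<open>z\<close>
    to \<open>T z\<close> moves \<open>A n\<close> by at most \<open>2 * B / n\<close>, which a
    smaller margin absorbs.\<close>
  define P where "P z \<longleftrightarrow> (\<exists>j::nat. \<forall>N. \<exists>n\<ge>N. A n z > b + e / 2 + 1 / real (Suc j))" for z
  have [measurable]: "Measurable.pred M P" unfolding P_def by measurable
  have close: "\<bar>A n (T z) - A n z\<bar> \<le> 2 * B / real n" if "n > 0" for n z
  proof -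
    obtain k where n: "n = Suc k" using \<open>n > 0\<close> by (cases n) auto
    have 1: "(\<Sum>k<n. f ((T ^^ k) z)) = f z + (\<Sum>i<k. f ((T ^^ i) (T z)))"
      unfolding n by (subst sum.lessThan_Suc_shift) (simp add: funpow_swap1)
    have 2: "(\<Sum>i<n. f ((T ^^ i) (T z))) = (\<Sum>i<k. f ((T ^^ i) (T z))) + f ((T ^^ k) (T z))"
      unfolding n by simp
    have "A n (T z) - A n z = (f ((T ^^ k) (T z)) - f z) / real n"
      unfolding A_def 1 2 by (simp add: diff_divide_distrib add_divide_distrib)
    moreover have "\<bar>f ((T ^^ k) (T z)) - f z\<bar> \<le> 2 * B" using B[of z] B[of "(T ^^ k) (T z)"] by linarith
    ultimately show ?thesis using that by (simp add: abs_divide divide_right_mono)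
  qed
  have Pmono: "P y" if P: "P x" and c: "\<And>n. n > 0 \<Longrightarrow> \<bar>A n y - A n x\<bar> \<le> 2 * B / real n" for x y
  proof -
    obtain j where j: "\<And>N. \<exists>n\<ge>N. A n x > b + e / 2 + 1 / real (Suc j)" using P unfolding P_def by auto
    obtain N0 :: nat where N0: "real N0 > 2 * B * (2 * real (Suc j))" using reals_Archimedean2 by blast
    \<comment> \<open>Half of the margin is given away:
      \<open>1 / (j + 1) - 1 / (2 * (j + 1)) = 1 / (2 * j + 2)\<close>, hence the index
      \<open>2 * j + 1\<close>.\<close>
    have "\<exists>n\<ge>N. A n y > b + e / 2 + 1 / real (Suc (2 * j + 1))" for N
    proof -
      obtain n where n: "n \<ge> max N (max N0 1)" "A n x > b + e / 2 + 1 / real (Suc j)" using j by blast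
      have n0: "n > 0" "real n \<ge> real N0" using n by auto
      have "2 * B * (2 * real (Suc j)) \<le> real n" using N0 n0 by linarith
      then have "2 * B / real n \<le> 1 / (2 * real (Suc j))" using n0(1)
        by (simp add: divide_simps mult.commute)
      moreover have "1 / real (Suc j) - 1 / (2 * real (Suc j)) = 1 / real (Suc (2 * j + 1))"
        by (simp add: field_simps)
      ultimately have "A n y > b + e / 2 + 1 / real (Suc (2 * j + 1))" using c[OF n0(1)] n(2) by linarith
      then show ?thesis using n by auto
    qed
    then show ?thesis unfolding P_def by blast
  qed
  define E where "E = {z \<in> space M. P z}"
  have [measurable]: "E \<in> sets M" unfolding E_def by measurable
  have "P (T z) \<longleftrightarrow> P z" for z
    using Pmono[of z "T z"] Pmono[of "T z" z] close by (metis abs_minus_commute)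
  then have "T -` E \<inter> space M = E" unfolding E_def using T_space by auto
  then have "prob E = 0 \<or> prob E = 1" by (intro ergodic) auto
  moreover have "prob E \<noteq> 1"
  proof
    assume 1: "prob E = 1"
    define f' where "f' z = f z - b - e / 2" for z
    have [measurable]: "f' \<in> borel_measurable M" unfolding f'_def by measurable
    have fint: "integrable M f" by (rule integrable_const_bound[where B=B]) (use B in auto)
    have f'int: "integrable M f'" unfolding f'_def using fint by auto
    define D where "D N = {z \<in> space M. \<exists>n\<in>{1..N}. (\<Sum>k<n. f' ((T ^^ k) z)) > 0}" for N
    have [measurable]: "D N \<in> sets M" for N unfolding D_def by measurable
    \<comment> \<open>Almost every point lies in \<open>D N\<close> for all large \<open>N\<close>,
      so the truncated integrals converge to the full one.\<close>
    have lim: "(\<lambda>N. \<integral>z. indicator (D N) z * f' z \<partial>M) \<longlonglongrightarrow> (\<integral>z. f' z \<partial>M)"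
    proof (rule integral_dominated_convergence[where w="\<lambda>z. \<bar>f' z\<bar>"])
      show "AE x in M. (\<lambda>N. indicator (D N) x * f' x) \<longlonglongrightarrow> f' x"
      proof -
        have "AE z in M. z \<in> E" using 1 prob_eq_1 by auto
        then show ?thesis
        proof (eventually_elim)
          case (elim z)
          then obtain j n where n: "n \<ge> Suc 0" "A n z > b + e / 2 + 1 / real (Suc j)" "z \<in> space M"
            unfolding E_def P_def by blast
          have "1 / real (Suc j) > 0" by simp
          then have "A n z > b + e / 2" using n(2) by linarith
          then have "(\<Sum>k<n. f ((T ^^ k) z)) > (b + e / 2) * real n" using n(1)
            unfolding A_def by (simp add: pos_less_divide_eq)
          then have *: "(\<Sum>k<n. f' ((T ^^ k) z)) > 0"
            unfolding f'_def by (simp add: sum_subtractf algebra_simps)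
          have "\<forall>\<^sub>F N in sequentially. indicator (D N) z * f' z = f' z"
            using eventually_ge_at_top[of n]
          proof eventually_elim
            case (elim N)
            then have "z \<in> D N" unfolding D_def using * n by auto
            then show ?case by simp
          qed
          then show ?case by (rule tendsto_eventually)
        qed
      qed
      show "AE x in M. norm (indicator (D N) x * f' x) \<le> \<bar>f' x\<bar>" for N
        by (auto simp: indicator_def)
      show "integrable M (\<lambda>z. \<bar>f' z\<bar>)" using f'int by auto
    qed auto
    have "0 \<le> (\<integral>z. indicator (D N) z * f' z \<partial>M)" for N
      using maximal_ergodic[OF f'int, of N] unfolding D_def .
    then have "0 \<le> integral\<^sup>L M f'" using lim by (intro LIMSEQ_le_const[OF lim]) auto
    moreover have "integral\<^sup>L M f' = - e / 2" unfolding f'_def using fint by (simp add: prob_space b_def)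
    ultimately show False using e by simp
  qed
  ultimately have "prob E = 0" by simp
  then have "AE z in M. z \<notin> E" by (simp add: prob_eq_0)
  with AE_space show ?thesis
  proof (eventually_elim)
    case (elim z)
    obtain j :: nat where "1 / real (Suc j) < e / 2" using nat_approx_posE[of "e/2"] e by auto
    moreover have "\<exists>N. \<forall>n\<ge>N. A n z \<le> b + e / 2 + 1 / real (Suc j)"
        using elim unfolding E_def P_def by (simp add: not_less)
    ultimately show ?case unfolding eventually_sequentially A_def b_def
        by (smt (verit) field_sum_of_halves)
  qed
qed

lemma birkhoff:
  fixes f :: "'a \<Rightarrow> real"
  assumes [measurable]: "f \<in> borel_measurable M" and B: "\<And>z. \<bar>f z\<bar> \<le> B"
  shows "AE z in M. (\<lambda>n. (\<Sum>k<n. f ((T ^^ k) z)) / real n) \<longlonglongrightarrow> integral\<^sup>L M f"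
proof -
  have u: "AE z in M. \<forall>j. \<forall>\<^sub>F n in sequentially.
      (\<Sum>k<n. f ((T ^^ k) z)) / real n \<le> integral\<^sup>L M f + 1 / real (Suc j)"
    using birkhoff_upper[OF assms] unfolding AE_all_countable by simp
  have l: "AE z in M. \<forall>j. \<forall>\<^sub>F n in sequentially.
      (\<Sum>k<n. - f ((T ^^ k) z)) / real n \<le> integral\<^sup>L M (\<lambda>z. - f z) + 1 / real (Suc j)"
    using birkhoff_upper[of "\<lambda>z. - f z" B] B unfolding AE_all_countable by simp
  show ?thesis using u l
  proof eventually_elim
    case (elim z)
    show ?case
    proof (rule LIMSEQ_I)
      fix r :: real assume "r > 0"
      then obtain j :: nat where j: "1 / real (Suc j) < r" using nat_approx_posE by blast
      have "\<forall>\<^sub>F n in sequentially. \<bar>(\<Sum>k<n. f ((T ^^ k) z)) / real n - integral\<^sup>L M f\<bar> < r"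
        using elim(1)[rule_format, of j] elim(2)[rule_format, of j]
      proof eventually_elim
        case (elim n)
        then show ?case using j by (simp add: sum_negf)
      qed
      then show "\<exists>no. \<forall>n\<ge>no. norm ((\<Sum>k<n. f ((T ^^ k) z)) / real n - integral\<^sup>L M f) < r"
        by (auto simp: eventually_sequentially)
    qed
  qed
qed

end

section \<open>Conditional expectation on finite partitions\<close>

text \<open>Plays the role of measurability with respect to the partition into fibres of
  \<open>\<xi>\<close>. It is a pointwise condition on the whole type, and refinement of partitions
  is stated by the same predicate with a labelling in place of \<open>h\<close>.\<close>

definition depends_on :: "('a \<Rightarrow> 'l) \<Rightarrow> ('a \<Rightarrow> 'b) \<Rightarrow> bool" where
  "depends_on \<xi> h \<longleftrightarrow> (\<forall>z w. \<xi> z = \<xi> w \<longrightarrow> h z = h w)"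

lemma abs_sq_le:
  fixes x :: real
  shows "\<bar>x\<bar> \<le> B \<Longrightarrow> x\<^sup>2 \<le> B\<^sup>2"
  by (metis abs_ge_zero power2_abs power_mono)

lemma depends_onD: "depends_on \<xi> h \<Longrightarrow> \<xi> z = \<xi> w \<Longrightarrow> h z = h w"
  unfolding depends_on_def by blast

lemma depends_on_comp: "depends_on \<xi> h \<Longrightarrow> depends_on \<xi> (\<lambda>z. F (h z))"
  unfolding depends_on_def by (intro allI impI arg_cong[of _ _ F]) blast

lemma depends_onI:
  assumes "\<And>z w. \<xi> z = \<xi> w \<Longrightarrow> h z = h w"
  shows "depends_on \<xi> h"
  unfolding depends_on_def by (intro allI impI) (rule assms)

lemma depends_on_const: "depends_on \<xi> (\<lambda>_. c)"
  unfolding depends_on_def by (intro allI impI refl)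

text \<open>The division makes the value \<open>0\<close> on null cells.\<close>

definition ce :: "'a measure \<Rightarrow> ('a \<Rightarrow> 'l) \<Rightarrow> ('a \<Rightarrow> real) \<Rightarrow> 'a \<Rightarrow> real" where
  "ce M \<xi> f z = (\<integral>w. of_bool (\<xi> w = \<xi> z) * f w \<partial>M) / measure M {w \<in> space M. \<xi> w = \<xi> z}"

lemma ce_depends: "depends_on \<xi> (ce M \<xi> f)"
  unfolding depends_on_def ce_def by auto

lemma ce_cong:
  assumes "\<And>w. w \<in> space M \<Longrightarrow> \<xi> w = \<xi> z \<Longrightarrow> f w = g w"
  shows "ce M \<xi> f z = ce M \<xi> g z"
proof -
  have "(\<integral>w. of_bool (\<xi> w = \<xi> z) * f w \<partial>M) = (\<integral>w. of_bool (\<xi> w = \<xi> z) * g w \<partial>M)"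
    by (rule Bochner_Integration.integral_cong) (use assms in auto)
  then show ?thesis unfolding ce_def by simp
qed

lemma ce_pull_out:
  assumes "depends_on \<xi> h"
  shows "ce M \<xi> (\<lambda>w. h w * f w) z = h z * ce M \<xi> f z"
proof -
  have "ce M \<xi> (\<lambda>w. h w * f w) z = ce M \<xi> (\<lambda>w. h z * f w) z"
  proof (rule ce_cong)
    fix w assume "\<xi> w = \<xi> z"
    then have "h w = h z" by (rule depends_onD[OF assms])
    then show "h w * f w = h z * f w" by (simp only:)
  qed
  also have "\<dots> = h z * ce M \<xi> f z"
    unfolding ce_def by (simp add: mult.left_commute)
  finally show ?thesis .
qed

context prob_space
begin

definition fpart :: "('a \<Rightarrow> 'l) \<Rightarrow> bool" where
  "fpart \<xi> \<longleftrightarrow> \<xi> \<in> M \<rightarrow>\<^sub>M count_space UNIV \<and> finite (range \<xi>)"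

lemma fpartD [measurable_dest]: "fpart \<xi> \<Longrightarrow> \<xi> \<in> M \<rightarrow>\<^sub>M count_space UNIV"
  by (simp add: fpart_def)

lemma integrable_bdd:
  fixes f :: "'a \<Rightarrow> real"
  assumes "f \<in> borel_measurable M" "\<And>z. \<bar>f z\<bar> \<le> B"
  shows "integrable M f"
  by (rule integrable_const_bound[where B=B]) (use assms in auto)

lemma integral_le_bdd:
  fixes f :: "'a \<Rightarrow> real"
  assumes "\<And>z. \<bar>f z\<bar> \<le> B"
  shows "\<bar>integral\<^sup>L M f\<bar> \<le> B"
proof (cases "integrable M f")
  case True
  have "\<bar>integral\<^sup>L M f\<bar> \<le> (\<integral>z. \<bar>f z\<bar> \<partial>M)" by (rule integral_abs_bound)
  also have "\<dots> \<le> (\<integral>z. B \<partial>M)" by (rule integral_mono) (use True assms in auto)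
  finally show ?thesis by (simp add: prob_space)
next
  case False
  have "0 \<le> B" using order_trans[OF abs_ge_zero assms[of undefined]] .
  then show ?thesis using False by (simp add: not_integrable_integral_eq)
qed

lemma depends_measurable:
  assumes "fpart \<xi>" "depends_on \<xi> h" "\<And>z. h z \<in> space N"
  shows "h \<in> M \<rightarrow>\<^sub>M N"
proof -
  \<comment> \<open>\<open>h\<close> factors through the label by choosing one point in each cell;
    outside the range of \<open>\<xi>\<close> any admissible value will do.\<close>
  have "h = (\<lambda>l. if l \<in> range \<xi> then h (SOME w. \<xi> w = l) else h undefined) \<circ> \<xi>"
  proof
    fix z
    have "\<xi> (SOME w. \<xi> w = \<xi> z) = \<xi> z" by (rule someI[of _ z]) simp
    then have "h (SOME w. \<xi> w = \<xi> z) = h z" using assms(2) by (rule depends_onD[rotated])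
    then show "h z = ((\<lambda>l. if l \<in> range \<xi> then h (SOME w. \<xi> w = l) else h undefined) \<circ> \<xi>) z" by simp
  qed
  also have "\<dots> \<in> M \<rightarrow>\<^sub>M N"
    by (rule measurable_comp[where N="count_space UNIV"])
      (use assms in \<open>auto simp: fpart_def\<close>)
  finally show ?thesis .
qed

lemma depends_borel_measurable:
  fixes h :: "'a \<Rightarrow> real"
  shows "fpart \<xi> \<Longrightarrow> depends_on \<xi> h \<Longrightarrow> h \<in> borel_measurable M"
  by (rule depends_measurable) auto

lemma depends_bounded:
  fixes h :: "'a \<Rightarrow> real"
  assumes "fpart \<xi>" "depends_on \<xi> h"
  obtains B where "\<And>z. \<bar>h z\<bar> \<le> B"
proof -
  have "h ` UNIV \<subseteq> (\<lambda>l. h (SOME w. \<xi> w = l)) ` range \<xi>"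
  proof
    fix y assume "y \<in> h ` UNIV"
    then obtain z where z: "y = h z" by auto
    have "\<xi> (SOME w. \<xi> w = \<xi> z) = \<xi> z" by (rule someI[of _ z]) simp
    then have "h (SOME w. \<xi> w = \<xi> z) = h z" using assms(2) by (rule depends_onD[rotated])
    then show "y \<in> (\<lambda>l. h (SOME w. \<xi> w = l)) ` range \<xi>" using z by (metis image_eqI rangeI)
  qed
  then have "finite (range h)" using assms(1) unfolding fpart_def by (meson finite_imageI finite_subset)
  then have "finite ((\<lambda>z. \<bar>h z\<bar>) ` UNIV)" using finite_imageI[of "range h" abs] by (simp add: image_image)
  then have "\<And>z. \<bar>h z\<bar> \<le> Max ((\<lambda>z. \<bar>h z\<bar>) ` UNIV)" by (intro Max_ge) auto
  then show ?thesis using that by blast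
qed

lemma ce_measurable [measurable]: "fpart \<xi> \<Longrightarrow> ce M \<xi> f \<in> borel_measurable M"
  by (rule depends_borel_measurable[OF _ ce_depends])

lemma integrable_of_bool:
  fixes f :: "'a \<Rightarrow> real"
  assumes "integrable M f" and [measurable]: "Measurable.pred M P"
  shows "integrable M (\<lambda>z. of_bool (P z) * f z)"
proof (rule Bochner_Integration.integrable_bound[OF assms(1)])
  have [measurable]: "f \<in> borel_measurable M" using assms by auto
  show "(\<lambda>z. of_bool (P z) * f z) \<in> borel_measurable M" by measurable
qed (auto simp: of_bool_def)

lemma integral_of_bool:
  assumes [measurable]: "Measurable.pred M P"
  shows "(\<integral>z. of_bool (P z) \<partial>M) = prob {z \<in> space M. P z}"
proof -
  have "(\<integral>z. of_bool (P z) \<partial>M) = (\<integral>z. indicator {z \<in> space M. P z} z \<partial>M)"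
    by (rule Bochner_Integration.integral_cong) (auto simp: indicator_def)
  also have "\<dots> = prob {z \<in> space M. P z}" by simp
  finally show ?thesis .
qed

lemma ce_bound:
  assumes f: "f \<in> borel_measurable M" "\<And>z. \<bar>f z\<bar> \<le> B" and \<xi> [measurable]: "fpart \<xi>"
  shows "\<bar>ce M \<xi> f z\<bar> \<le> B"
proof -
  have [measurable]: "f \<in> borel_measurable M" by fact
  have B: "0 \<le> B" using f(2)[of z] abs_ge_zero order_trans by blast
  have "\<bar>\<integral>w. of_bool (\<xi> w = \<xi> z) * f w \<partial>M\<bar> \<le> (\<integral>w. \<bar>of_bool (\<xi> w = \<xi> z) * f w\<bar> \<partial>M)"
    by (rule integral_abs_bound)
  also have "\<dots> \<le> (\<integral>w. of_bool (\<xi> w = \<xi> z) * B \<partial>M)"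
    by (intro integral_mono integrable_abs integrable_of_bool integrable_bdd[OF f])
      (use f in \<open>auto simp: of_bool_def\<close>)
  also have "\<dots> = prob {w \<in> space M. \<xi> w = \<xi> z} * B"
    using integral_of_bool[of "\<lambda>w. \<xi> w = \<xi> z"] by simp
  finally show ?thesis unfolding ce_def using B
    by (cases "prob {w \<in> space M. \<xi> w = \<xi> z} = 0") (auto simp: abs_divide divide_simps mult.commute zero_less_measure_iff)
qed

lemma ce_nonneg: "(\<And>z. 0 \<le> f z) \<Longrightarrow> 0 \<le> ce M \<xi> f z"
  unfolding ce_def by (intro divide_nonneg_nonneg integral_nonneg) auto

lemma ce_sum:
  assumes "\<And>i. i \<in> I \<Longrightarrow> integrable M (f i)" and [measurable]: "fpart \<xi>"
  shows "ce M \<xi> (\<lambda>w. \<Sum>i\<in>I. f i w) z = (\<Sum>i\<in>I. ce M \<xi> (f i) z)"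
  unfolding ce_def sum_distrib_left
  by (subst Bochner_Integration.integral_sum)
    (auto intro!: integrable_of_bool assms(1) simp: sum_divide_distrib)

lemma ce_diff:
  assumes "integrable M f" "integrable M g" and [measurable]: "fpart \<xi>"
  shows "ce M \<xi> (\<lambda>w. f w - g w) z = ce M \<xi> f z - ce M \<xi> g z"
  unfolding ce_def right_diff_distrib
  by (subst Bochner_Integration.integral_diff)
    (auto intro!: integrable_of_bool assms(1,2) simp: diff_divide_distrib)

lemma ce_diff_bound:
  assumes "integrable M f" "integrable M g" and \<xi> [measurable]: "fpart \<xi>" and "0 \<le> e"
    and fg: "\<And>w. w \<in> space M \<Longrightarrow> \<xi> w = \<xi> z \<Longrightarrow> \<bar>f w - g w\<bar> \<le> e"
  shows "\<bar>ce M \<xi> f z - ce M \<xi> g z\<bar> \<le> e"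
proof -
  have [measurable]: "f \<in> borel_measurable M" "g \<in> borel_measurable M" using assms by auto
  \<comment> \<open>Cut off outside the cell of \<open>z\<close>, so that the bound assumed on this
    cell becomes the global bound required by \<open>ce_bound\<close>.\<close>
  define h where "h w = of_bool (w \<in> space M \<and> \<xi> w = \<xi> z) * (f w - g w)" for w
  have hm: "h \<in> borel_measurable M" unfolding h_def by measurable
  have "ce M \<xi> f z - ce M \<xi> g z = ce M \<xi> (\<lambda>w. f w - g w) z" by (simp add: ce_diff assms)
  also have "\<dots> = ce M \<xi> h z" by (rule ce_cong) (auto simp: h_def)
  finally show ?thesis using ce_bound[of h e \<xi> z] fg \<open>0 \<le> e\<close> hm \<xi> by (auto simp: h_def)
qed

lemma integral_partition:
  fixes f :: "'a \<Rightarrow> real"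
  assumes f: "integrable M f" and [measurable]: "fpart \<xi>"
  shows "integral\<^sup>L M f = (\<Sum>l\<in>range \<xi>. \<integral>z. of_bool (\<xi> z = l) * f z \<partial>M)"
proof -
  have fin: "finite (range \<xi>)" using assms(2) by (simp add: fpart_def)
  have "f z = (\<Sum>l\<in>range \<xi>. of_bool (\<xi> z = l) * f z)" for z
  proof -
    have "(\<Sum>l\<in>range \<xi>. of_bool (\<xi> z = l) * f z) = (\<Sum>l\<in>range \<xi>. if \<xi> z = l then f z else 0)"
      by (rule sum.cong) auto
    then show ?thesis using fin by simp
  qed
  then have "integral\<^sup>L M f = (\<integral>z. (\<Sum>l\<in>range \<xi>. of_bool (\<xi> z = l) * f z) \<partial>M)" by simp
  also have "\<dots> = (\<Sum>l\<in>range \<xi>. \<integral>z. of_bool (\<xi> z = l) * f z \<partial>M)"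
    by (rule Bochner_Integration.integral_sum) (intro integrable_of_bool f, measurable)
  finally show ?thesis .
qed

text \<open>The defining property of a conditional expectation, checked cell by cell. On a null cell
  the quotient in \<open>ce\<close> is \<open>0\<close>, but both integrals vanish there.\<close>

lemma ce_integral:
  fixes h :: "'a \<Rightarrow> real"
  assumes f: "f \<in> borel_measurable M" "\<And>z. \<bar>f z\<bar> \<le> B" and \<xi>: "fpart \<xi>"
    and h: "depends_on \<xi> h"
  shows "(\<integral>z. h z * ce M \<xi> f z \<partial>M) = (\<integral>z. h z * f z \<partial>M)"
proof -
  note [measurable] = f(1) \<xi> depends_borel_measurable[OF \<xi> h]
  obtain C where C: "\<And>z. \<bar>h z\<bar> \<le> C" using depends_bounded[OF \<xi> h] by blast
  have C0: "0 \<le> C" using C[of undefined] abs_ge_zero order_trans by blast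
  have i1: "integrable M (\<lambda>z. h z * ce M \<xi> f z)"
    by (rule integrable_bdd[where B="C * B"])
      (use ce_bound[OF f \<xi>] C C0 in \<open>auto simp: abs_mult intro!: mult_mono\<close>)
  have i2: "integrable M (\<lambda>z. h z * f z)"
    by (rule integrable_bdd[where B="C * B"])
      (use f C C0 in \<open>auto simp: abs_mult intro!: mult_mono\<close>)
  have "(\<integral>z. of_bool (\<xi> z = l) * (h z * ce M \<xi> f z) \<partial>M) = (\<integral>z. of_bool (\<xi> z = l) * (h z * f z) \<partial>M)"
    if l: "l \<in> range \<xi>" for l
  proof -
    obtain y where y: "l = \<xi> y" using l by auto
    let ?c = "{w \<in> space M. \<xi> w = l}"
    have "(\<integral>z. of_bool (\<xi> z = l) * (h z * ce M \<xi> f z) \<partial>M) = (\<integral>z. of_bool (\<xi> z = l) * (h y * ce M \<xi> f y) \<partial>M)"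
    proof (rule Bochner_Integration.integral_cong)
      fix z
      show "of_bool (\<xi> z = l) * (h z * ce M \<xi> f z) = of_bool (\<xi> z = l) * (h y * ce M \<xi> f y)"
        using depends_onD[OF h, of z y] depends_onD[OF ce_depends, of \<xi> z y M f] by (simp add: y)
    qed simp
    also have "\<dots> = prob ?c * (h y * ce M \<xi> f y)"
      using integral_of_bool[of "\<lambda>w. \<xi> w = l"] by simp
    also have "\<dots> = h y * (\<integral>z. of_bool (\<xi> z = l) * f z \<partial>M)"
    proof (cases "prob ?c = 0")
      case True
      then have "AE z in M. \<not> \<xi> z = l" by (subst (asm) prob_eq_0) auto
      then have "AE z in M. of_bool (\<xi> z = l) * f z = 0" by eventually_elim simp
      then have "(\<integral>z. of_bool (\<xi> z = l) * f z \<partial>M) = 0" by (simp add: integral_eq_zero_AE)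
      then show ?thesis using True by simp
    next
      case False
      then show ?thesis unfolding ce_def y by simp
    qed
    also have "\<dots> = (\<integral>z. h y * (of_bool (\<xi> z = l) * f z) \<partial>M)" by simp
    also have "\<dots> = (\<integral>z. of_bool (\<xi> z = l) * (h z * f z) \<partial>M)"
    proof (rule Bochner_Integration.integral_cong)
      fix z
      show "h y * (of_bool (\<xi> z = l) * f z) = of_bool (\<xi> z = l) * (h z * f z)"
        using depends_onD[OF h, of z y] by (simp add: y)
    qed simp
    finally show ?thesis .
  qed
  then show ?thesis
    using integral_partition[OF i1 \<xi>] integral_partition[OF i2 \<xi>] by simp
qed

text \<open>The coarse expectation is constant on fine cells, so integrating it against the fine one
  gives the coarse square, and the cross term cancels. The weight \<open>h\<close> allows
  localisation to an event of the coarse partition, as in Doob's inequality.\<close>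

lemma ce_pythagoras:
  fixes h :: "'a \<Rightarrow> real"
  assumes f: "f \<in> borel_measurable M" "\<And>z. \<bar>f z\<bar> \<le> B" and \<xi>: "fpart \<xi>" and \<zeta>: "fpart \<zeta>"
    and fine: "depends_on \<zeta> \<xi>" and h: "depends_on \<xi> h"
  shows "(\<integral>z. h z * (ce M \<zeta> f z - ce M \<xi> f z)\<^sup>2 \<partial>M)
    = (\<integral>z. h z * (ce M \<zeta> f z)\<^sup>2 \<partial>M) - (\<integral>z. h z * (ce M \<xi> f z)\<^sup>2 \<partial>M)"
proof -
  note [measurable] = f(1) \<xi> \<zeta> depends_borel_measurable[OF \<xi> h]
  obtain C where C: "\<And>z. \<bar>h z\<bar> \<le> C" using depends_bounded[OF \<xi> h] by blast
  have C0: "0 \<le> C" using C[of undefined] abs_ge_zero order_trans by blast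
  have B0: "0 \<le> B" using f(2)[of undefined] abs_ge_zero order_trans by blast
  note b = ce_bound[OF f \<xi>] ce_bound[OF f \<zeta>]
  have int: "integrable M (\<lambda>z. h z * (u z * v z))" if [measurable]: "u \<in> borel_measurable M" "v \<in> borel_measurable M"
      and "\<And>z. \<bar>u z\<bar> \<le> B" "\<And>z. \<bar>v z\<bar> \<le> B" for u v
    by (rule integrable_bdd[where B="C * (B * B)"])
      (use that C C0 B0 in \<open>auto simp: abs_mult intro!: mult_mono\<close>)
  let ?Z = "ce M \<zeta> f" and ?X = "ce M \<xi> f"
  have i: "integrable M (\<lambda>z. h z * (?Z z)\<^sup>2)" "integrable M (\<lambda>z. h z * (?X z)\<^sup>2)"
    "integrable M (\<lambda>z. h z * (?X z * ?Z z))"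
    unfolding power2_eq_square by (rule int; use b in \<open>auto\<close>)+
  have dX: "depends_on \<zeta> (\<lambda>z. h z * ?X z)"
    using fine h ce_depends[of \<xi> M f] unfolding depends_on_def by metis
  have dX': "depends_on \<xi> (\<lambda>z. h z * ?X z)"
    using h ce_depends[of \<xi> M f] unfolding depends_on_def by metis
  have "(\<integral>z. h z * (?X z * ?Z z) \<partial>M) = (\<integral>z. (h z * ?X z) * f z \<partial>M)"
    using ce_integral[OF f \<zeta> dX] by (simp add: mult.assoc)
  also have "\<dots> = (\<integral>z. h z * (?X z)\<^sup>2 \<partial>M)"
    using ce_integral[OF f \<xi> dX'] by (simp add: mult.assoc power2_eq_square)
  finally have cross: "(\<integral>z. h z * (?X z * ?Z z) \<partial>M) = (\<integral>z. h z * (?X z)\<^sup>2 \<partial>M)" .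
  have "(\<integral>z. h z * (?Z z - ?X z)\<^sup>2 \<partial>M)
    = (\<integral>z. h z * (?Z z)\<^sup>2 + h z * (?X z)\<^sup>2 - 2 * (h z * (?X z * ?Z z)) \<partial>M)"
    by (rule Bochner_Integration.integral_cong) (auto simp: power2_eq_square algebra_simps)
  also have "\<dots> = (\<integral>z. h z * (?Z z)\<^sup>2 \<partial>M) + (\<integral>z. h z * (?X z)\<^sup>2 \<partial>M) - 2 * (\<integral>z. h z * (?X z * ?Z z) \<partial>M)"
    using i by simp
  finally show ?thesis using cross by simp
qed

lemma AE_cell_pos:
  assumes \<xi> [measurable]: "fpart \<xi>"
  shows "AE z in M. prob {w \<in> space M. \<xi> w = \<xi> z} > 0"
proof -
  have "AE z in M. \<forall>l\<in>range \<xi>. prob {w \<in> space M. \<xi> w = l} = 0 \<longrightarrow> \<xi> z \<noteq> l"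
  proof (rule AE_finite_allI)
    show "finite (range \<xi>)" using \<xi> by (simp add: fpart_def)
    fix l
    show "AE z in M. prob {w \<in> space M. \<xi> w = l} = 0 \<longrightarrow> \<xi> z \<noteq> l"
    proof (cases "prob {w \<in> space M. \<xi> w = l} = 0")
      case True
      then show ?thesis by (subst (asm) prob_eq_0) auto
    qed auto
  qed
  then show ?thesis by eventually_elim (auto simp: zero_less_measure_iff)
qed

lemma ce_near:
  assumes "integrable M f" and \<xi> [measurable]: "fpart \<xi>" and "0 \<le> e"
    and f: "\<And>z w. z \<in> space M \<Longrightarrow> w \<in> space M \<Longrightarrow> \<xi> w = \<xi> z \<Longrightarrow> \<bar>f w - f z\<bar> \<le> e"
  shows "AE z in M. \<bar>f z - ce M \<xi> f z\<bar> \<le> e"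
  using AE_cell_pos[OF \<xi>] AE_space
proof eventually_elim
  case (elim z)
  have "ce M \<xi> (\<lambda>_. f z) z = f z"
    unfolding ce_def using elim(1) integral_of_bool[of "\<lambda>w. \<xi> w = \<xi> z"] by simp
  then show ?case using ce_diff_bound[of f "\<lambda>_. f z" \<xi> e z] assms elim
    by (simp add: abs_minus_commute)
qed

section \<open>Maximal inequality for martingales and a strong law of large numbers\<close>

lemma chebyshev:
  fixes g :: "'a \<Rightarrow> real"
  assumes g [measurable]: "g \<in> borel_measurable M" and "integrable M (\<lambda>z. (g z)\<^sup>2)" and "0 \<le> t"
  shows "t\<^sup>2 * prob {z \<in> space M. \<bar>g z\<bar> > t} \<le> (\<integral>z. (g z)\<^sup>2 \<partial>M)"
proof -
  have "t\<^sup>2 * prob {z \<in> space M. \<bar>g z\<bar> > t} = (\<integral>z. t\<^sup>2 * of_bool (\<bar>g z\<bar> > t) \<partial>M)"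
    using integral_of_bool[of "\<lambda>z. \<bar>g z\<bar> > t"] by simp
  also have "\<dots> \<le> (\<integral>z. (g z)\<^sup>2 \<partial>M)"
  proof (rule integral_mono)
    show "integrable M (\<lambda>z. t\<^sup>2 * of_bool (\<bar>g z\<bar> > t))"
      by (rule integrable_bdd[where B="t\<^sup>2"]) auto
    fix z show "t\<^sup>2 * of_bool (\<bar>g z\<bar> > t) \<le> (g z)\<^sup>2"
      using \<open>0 \<le> t\<close> power_mono[of t "\<bar>g z\<bar>" 2] by (auto simp: of_bool_def)
  qed fact
  finally show ?thesis .
qed

text \<open>Induction on the number of levels. \<open>U k\<close>, that the threshold was passed by
  level \<open>k\<close>, is determined by that level, so by \<open>ce_pythagoras\<close> the second
  moment on it can only grow under refinement; first passages \<open>V\<close> at the new level add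
  at least \<open>t\<^sup>2\<close> times their probability.\<close>

lemma doob_weak:
  assumes f: "f \<in> borel_measurable M" "\<And>z. \<bar>f z\<bar> \<le> B" and \<zeta>: "\<And>L. fpart (\<zeta> L)"
    and fine: "\<And>L. L < K \<Longrightarrow> depends_on (\<zeta> (Suc L)) (\<zeta> L)" and "0 \<le> t"
  shows "t\<^sup>2 * prob {z \<in> space M. \<exists>L\<le>K. \<bar>ce M (\<zeta> L) f z\<bar> > t} \<le> (\<integral>z. (ce M (\<zeta> K) f z)\<^sup>2 \<partial>M)"
proof -
  note [measurable] = f(1) \<zeta>
  note b = ce_bound[OF f \<zeta>]
  have bsq: "integrable M (\<lambda>z. (ce M (\<zeta> L) f z)\<^sup>2)" for L
    by (rule integrable_bdd[where B="B\<^sup>2"]) (use abs_sq_le[OF b] in auto)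
  define U where "U k z \<longleftrightarrow> (\<exists>L\<le>k. \<bar>ce M (\<zeta> L) f z\<bar> > t)" for k z
  have Um [measurable]: "Measurable.pred M (U k)" for k unfolding U_def by measurable
  have Udep: "depends_on (\<zeta> k) (U k)" if "k \<le> K" for k
    using that
  proof (induction k)
    case 0
    have "U 0 z = U 0 w" if "\<zeta> 0 z = \<zeta> 0 w" for z w
      unfolding U_def using depends_onD[OF ce_depends[of "\<zeta> 0" M f] that] by simp
    then show ?case unfolding depends_on_def by blast
  next
    case (Suc k)
    have "U (Suc k) z \<longleftrightarrow> U k z \<or> \<bar>ce M (\<zeta> (Suc k)) f z\<bar> > t" for z unfolding U_def by (auto simp: le_Suc_eq)
    moreover have "depends_on (\<zeta> (Suc k)) (U k)"
    proof -
      have "depends_on (\<zeta> k) (U k)" "depends_on (\<zeta> (Suc k)) (\<zeta> k)" using Suc fine[of k] by auto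
      then show ?thesis unfolding depends_on_def by blast
    qed
    then have "U k z = U k w" if "\<zeta> (Suc k) z = \<zeta> (Suc k) w" for z w
      using that by (rule depends_onD)
    ultimately have "U (Suc k) z = U (Suc k) w" if "\<zeta> (Suc k) z = \<zeta> (Suc k) w" for z w
      using depends_onD[OF ce_depends[of "\<zeta> (Suc k)" M f] that] that by metis
    then show ?case unfolding depends_on_def by blast
  qed
  have "t\<^sup>2 * prob {z \<in> space M. U k z} \<le> (\<integral>z. of_bool (U k z) * (ce M (\<zeta> k) f z)\<^sup>2 \<partial>M)" if "k \<le> K" for k
    using that
  proof (induction k)
    case 0
    have "t\<^sup>2 * prob {z \<in> space M. U 0 z} = (\<integral>z. t\<^sup>2 * of_bool (U 0 z) \<partial>M)"
      unfolding integral_mult_right_zero integral_of_bool[OF Um] ..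
    also have "\<dots> \<le> (\<integral>z. of_bool (U 0 z) * (ce M (\<zeta> 0) f z)\<^sup>2 \<partial>M)"
    proof (rule integral_mono)
      show "integrable M (\<lambda>z. t\<^sup>2 * of_bool (U 0 z))" by (rule integrable_bdd[where B="t\<^sup>2"]) auto
      fix z show "t\<^sup>2 * of_bool (U 0 z) \<le> of_bool (U 0 z) * (ce M (\<zeta> 0) f z)\<^sup>2"
        using \<open>0 \<le> t\<close> power_mono[of t "\<bar>ce M (\<zeta> 0) f z\<bar>" 2] by (auto simp: U_def of_bool_def)
    qed (intro integrable_of_bool bsq, measurable)
    finally show ?case .
  next
    case (Suc k)
    define V where "V z \<longleftrightarrow> \<not> U k z \<and> \<bar>ce M (\<zeta> (Suc k)) f z\<bar> > t" for z
    have [measurable]: "Measurable.pred M V" unfolding V_def by measurable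
    have UV: "of_bool (U (Suc k) z) = (of_bool (U k z) + of_bool (V z) :: real)" for z
    proof -
      have "U (Suc k) z \<longleftrightarrow> U k z \<or> V z" unfolding U_def V_def le_Suc_eq by blast
      moreover have "\<not> (U k z \<and> V z)" unfolding V_def by blast
      ultimately show ?thesis by auto
    qed
    have dU: "depends_on (\<zeta> k) (\<lambda>z. of_bool (U k z) :: real)" using depends_on_comp[OF Udep[of k], of of_bool] Suc.prems by simp
    have "0 \<le> (\<integral>z. of_bool (U k z) * (ce M (\<zeta> (Suc k)) f z - ce M (\<zeta> k) f z)\<^sup>2 \<partial>M)"
      by (intro Bochner_Integration.integral_nonneg mult_nonneg_nonneg) simp_all
    then have mono: "(\<integral>z. of_bool (U k z) * (ce M (\<zeta> k) f z)\<^sup>2 \<partial>M) \<le> (\<integral>z. of_bool (U k z) * (ce M (\<zeta> (Suc k)) f z)\<^sup>2 \<partial>M)"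
      using ce_pythagoras[OF f \<zeta> \<zeta> fine[OF Suc_le_lessD[OF Suc.prems]] dU] by linarith
    have V: "t\<^sup>2 * (\<integral>z. of_bool (V z) \<partial>M) \<le> (\<integral>z. of_bool (V z) * (ce M (\<zeta> (Suc k)) f z)\<^sup>2 \<partial>M)"
    proof -
      have "t\<^sup>2 * (\<integral>z. of_bool (V z) \<partial>M) = (\<integral>z. t\<^sup>2 * of_bool (V z) \<partial>M)"
        unfolding integral_mult_right_zero ..
      also have "\<dots> \<le> (\<integral>z. of_bool (V z) * (ce M (\<zeta> (Suc k)) f z)\<^sup>2 \<partial>M)"
      proof (rule integral_mono)
        show "integrable M (\<lambda>z. t\<^sup>2 * of_bool (V z))" by (rule integrable_bdd[where B="t\<^sup>2"]) auto
        fix z show "t\<^sup>2 * of_bool (V z) \<le> of_bool (V z) * (ce M (\<zeta> (Suc k)) f z)\<^sup>2"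
          using \<open>0 \<le> t\<close> power_mono[of t "\<bar>ce M (\<zeta> (Suc k)) f z\<bar>" 2] by (auto simp: V_def of_bool_def)
      qed (intro integrable_of_bool bsq, measurable)
      finally show ?thesis .
    qed
    have "t\<^sup>2 * prob {z \<in> space M. U (Suc k) z} = t\<^sup>2 * (\<integral>z. of_bool (U (Suc k) z) \<partial>M)"
      unfolding integral_of_bool[OF Um] ..
    also have "\<dots> = t\<^sup>2 * (\<integral>z. of_bool (U k z) \<partial>M) + t\<^sup>2 * (\<integral>z. of_bool (V z) \<partial>M)"
    proof -
      have "integrable M (\<lambda>z. of_bool (U k z) :: real)" "integrable M (\<lambda>z. of_bool (V z) :: real)"
        by (rule integrable_bdd[where B=1]; simp)+
      then show ?thesis unfolding UV by (subst Bochner_Integration.integral_add) (simp_all add: distrib_left)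
    qed
    also have "\<dots> \<le> (\<integral>z. of_bool (U k z) * (ce M (\<zeta> (Suc k)) f z)\<^sup>2 \<partial>M)
        + (\<integral>z. of_bool (V z) * (ce M (\<zeta> (Suc k)) f z)\<^sup>2 \<partial>M)"
      using Suc.IH[OF Suc_leD[OF Suc.prems]] mono V unfolding integral_of_bool[OF Um] by linarith
    also have "\<dots> = (\<integral>z. of_bool (U (Suc k) z) * (ce M (\<zeta> (Suc k)) f z)\<^sup>2 \<partial>M)"
      unfolding UV distrib_right
      by (rule Bochner_Integration.integral_add[symmetric]; intro integrable_of_bool bsq; measurable)
    finally show ?case .
  qed
  from this[of K] have "t\<^sup>2 * prob {z \<in> space M. U K z} \<le> (\<integral>z. of_bool (U K z) * (ce M (\<zeta> K) f z)\<^sup>2 \<partial>M)" by simp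
  also have "\<dots> \<le> (\<integral>z. (ce M (\<zeta> K) f z)\<^sup>2 \<partial>M)"
  proof (rule integral_mono)
    show "integrable M (\<lambda>z. of_bool (U K z) * (ce M (\<zeta> K) f z)\<^sup>2)"
      by (intro integrable_of_bool bsq) measurable
  qed (simp_all add: bsq of_bool_def)
  finally show ?thesis unfolding U_def .
qed

text \<open>Chebyshev gives summable bounds along the squares, so Borel-Cantelli applies there;
  between consecutive squares the bounded terms move the sum by at most \<open>2 * q * B\<close>,
  negligible against \<open>q\<^sup>2\<close>.\<close>

lemma lln_bounded:
  fixes Y :: "nat \<Rightarrow> 'a \<Rightarrow> real"
  assumes [measurable]: "\<And>k. Y k \<in> borel_measurable M" and B: "\<And>k z. \<bar>Y k z\<bar> \<le> B"
    and C: "\<And>N. (\<integral>z. (\<Sum>k<N. Y k z)\<^sup>2 \<partial>M) \<le> C * real N"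
  shows "AE z in M. (\<lambda>N. (\<Sum>k<N. Y k z) / real N) \<longlonglongrightarrow> 0"
proof -
  define S where "S N z = (\<Sum>k<N. Y k z)" for N z
  have [measurable]: "S N \<in> borel_measurable M" for N unfolding S_def by measurable
  have B0: "0 \<le> B" using B[of 0 undefined] abs_ge_zero order_trans by blast
  have SB: "\<bar>S N z\<bar> \<le> real N * B" for N z
    unfolding S_def using sum_norm_bound[of "{..<N}" "\<lambda>k. Y k z" B] B by auto
  have Ssq: "integrable M (\<lambda>z. (S N z)\<^sup>2)" for N
    by (rule integrable_bdd[where B="(real N * B)\<^sup>2"])
      (use abs_sq_le[OF SB] in auto)
  have ev: "AE z in M. \<forall>\<^sub>F q in sequentially. \<bar>S (q\<^sup>2) z\<bar> \<le> e * real (q\<^sup>2)" if e: "e > 0" for e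
  proof -
    define D where "D q = {z \<in> space M. \<bar>S (q\<^sup>2) z\<bar> > e * real (q\<^sup>2)}" for q
    have [measurable]: "D q \<in> sets M" for q unfolding D_def by measurable
    have "prob (D q) \<le> (C / e\<^sup>2) * (1 / real q ^ 2)" if "q > 0" for q
    proof -
      have "(e * real (q\<^sup>2))\<^sup>2 * prob (D q) \<le> C * real (q\<^sup>2)"
        unfolding D_def using chebyshev[OF _ Ssq, of "q\<^sup>2" "e * real (q\<^sup>2)"] C[of "q\<^sup>2"] e
        unfolding S_def by simp
      then show ?thesis using that e by (simp add: field_simps power2_eq_square)
    qed
    then have "summable (\<lambda>q. prob (D q))"
    proof (rule_tac summable_comparison_test_ev[where g="\<lambda>q. (C / e\<^sup>2) * (1 / real q ^ 2)"])
      assume *: "\<And>q. q > 0 \<Longrightarrow> prob (D q) \<le> (C / e\<^sup>2) * (1 / real q ^ 2)"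
      show "\<forall>\<^sub>F n in sequentially. norm (prob (D n)) \<le> C / e\<^sup>2 * (1 / (real n)\<^sup>2)"
        using eventually_gt_at_top[of 0] by eventually_elim (use * in auto)
      have "summable (\<lambda>n. inverse (real n ^ 2))" using inverse_power_summable[of 2] by auto
      then show "summable (\<lambda>q. C / e\<^sup>2 * (1 / real q ^ 2))"
        by (intro summable_mult) (simp add: inverse_eq_divide)
    qed
    then have "AE z in M. \<forall>\<^sub>F q in sequentially. z \<in> space M - D q"
      by (intro borel_cantelli_AE1) (auto simp: emeasure_eq_measure)
    then show ?thesis
      by eventually_elim (auto elim!: eventually_mono simp: D_def not_less)
  qed
  have "AE z in M. \<forall>j. \<forall>\<^sub>F q in sequentially. \<bar>S (q\<^sup>2) z\<bar> \<le> (1 / real (Suc j)) * real (q\<^sup>2)"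
    unfolding AE_all_countable by (intro allI ev) simp
  then show ?thesis
  proof eventually_elim
    case (elim z)
    show ?case
    proof (rule LIMSEQ_I)
      fix r :: real assume r: "r > 0"
      then obtain j :: nat where j: "1 / real (Suc j) < r / 2" using nat_approx_posE[of "r/2"] by force
      from elim[rule_format, of j] obtain q0 where
        q0: "\<And>q. q \<ge> q0 \<Longrightarrow> \<bar>S (q\<^sup>2) z\<bar> \<le> (1 / real (Suc j)) * real (q\<^sup>2)"
        unfolding eventually_sequentially by blast
      \<comment> \<open>Beyond \<open>q1\<close> the gap term \<open>2 * q * B\<close> is below half
        of \<open>r * q\<^sup>2\<close>; the other half is left for the estimate along
        squares.\<close>
      obtain q1 :: nat where q1: "real q1 > 4 * B / r" using reals_Archimedean2 by blast
      define Q where "Q = Suc (max q0 q1)"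
      have "norm ((\<Sum>k<N. Y k z) / real N - 0) < r" if N: "N \<ge> Q\<^sup>2" for N
      proof -
        define q where "q = nat \<lfloor>sqrt (real N)\<rfloor>"
        have qs: "real q \<le> sqrt (real N)" "sqrt (real N) < real q + 1"
          unfolding q_def by (auto simp: of_nat_nat)
        have "real Q \<le> sqrt (real N)" proof (rule real_le_rsqrt)
          have "real (Q\<^sup>2) \<le> real N" using N by (simp only: of_nat_le_iff)
          then show "(real Q)\<^sup>2 \<le> real N" by simp
        qed
        then have qQ: "q \<ge> Q" unfolding q_def by (rule le_nat_floor)
        have q2: "q\<^sup>2 \<le> N" using qs(1) proof -
          have "(real q)\<^sup>2 \<le> (sqrt (real N))\<^sup>2" using qs(1) by (intro power_mono) auto
          then have "real (q\<^sup>2) \<le> real N" by simp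
          then show ?thesis by (simp only: of_nat_le_iff)
        qed
        have "real N < (real q + 1)\<^sup>2"
          using qs(2) real_sqrt_less_iff[of "real N" "(real q + 1)\<^sup>2"] by simp
        then have N2: "real N - real (q\<^sup>2) \<le> 2 * real q + 1" by (simp add: power2_eq_square algebra_simps)
        have q2': "real N - real (q\<^sup>2) \<le> 2 * real q"
        proof -
          have "real N < real ((q + 1)\<^sup>2)" using \<open>real N < (real q + 1)\<^sup>2\<close> by (simp add: add.commute)
          then have "N < (q+1)\<^sup>2" by (simp only: of_nat_less_iff)
          then have "N \<le> q\<^sup>2 + 2 * q" by (simp add: power2_eq_square)
          then have "real N \<le> real (q\<^sup>2 + 2 * q)" by (simp only: of_nat_le_iff)
          then show ?thesis by simp
        qed
        have qp: "q > 0" "q \<ge> q0" "q > q1" using qQ unfolding Q_def by auto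
        have "S N z = S (q\<^sup>2) z + (\<Sum>k\<in>{q\<^sup>2..<N}. Y k z)"
          unfolding S_def using q2 sum.atLeastLessThan_concat[of 0 "q\<^sup>2" N "\<lambda>k. Y k z"]
          by (simp add: atLeast0LessThan)
        moreover have "\<bar>\<Sum>k\<in>{q\<^sup>2..<N}. Y k z\<bar> \<le> real (N - q\<^sup>2) * B"
          using sum_norm_bound[of "{q\<^sup>2..<N}" "\<lambda>k. Y k z" B] B by auto
        moreover have "real (N - q\<^sup>2) * B \<le> 2 * real q * B"
          using q2' q2 B0 by (intro mult_right_mono) (auto simp: of_nat_diff)
        ultimately have "\<bar>S N z\<bar> \<le> (1 / real (Suc j)) * real (q\<^sup>2) + 2 * real q * B"
          using q0[OF qp(2)] by linarith
        also have "\<dots> < (r / 2) * real (q\<^sup>2) + (r / 2) * real (q\<^sup>2)"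
        proof (rule add_strict_mono)
          show "1 / real (Suc j) * real (q\<^sup>2) < r / 2 * real (q\<^sup>2)"
            using j qp by (intro mult_strict_right_mono) auto
          have "4 * B < r * real q" proof -
            have "4 * B / r < real q" using q1 qp by linarith
            then show ?thesis using r by (simp add: pos_divide_less_eq mult.commute)
          qed
          then have "(4 * B) * real q < (r * real q) * real q" using qp by (intro mult_strict_right_mono) auto
          then show "2 * real q * B < r / 2 * real (q\<^sup>2)" by (simp add: power2_eq_square algebra_simps)
        qed
        also have "\<dots> = r * real (q\<^sup>2)" by (simp add: field_simps)
        also have "\<dots> \<le> r * real N" using r q2 by (intro mult_left_mono) (auto simp only: of_nat_le_iff)
        finally have "\<bar>S N z\<bar> < r * real N" .
        moreover have "N > 0" using q2 qp by (cases N) auto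
        ultimately show ?thesis unfolding S_def by (simp add: abs_divide pos_divide_less_eq)
      qed
      then show "\<exists>no. \<forall>N\<ge>no. norm ((\<Sum>k<N. Y k z) / real N - 0) < r" by blast
    qed
  qed
qed

end

lemma (in mpt) fpart_Tn:
  assumes "fpart \<xi>"
  shows "fpart (\<lambda>w. \<xi> ((T ^^ n) w))"
proof -
  have "range (\<lambda>w. \<xi> ((T ^^ n) w)) \<subseteq> range \<xi>" by blast
  then have "finite (range (\<lambda>w. \<xi> ((T ^^ n) w)))" using assms finite_subset unfolding fpart_def by blast
  moreover have "(\<lambda>w. \<xi> ((T ^^ n) w)) \<in> M \<rightarrow>\<^sub>M count_space UNIV"
    using measurable_compose[OF Tn_meas] assms unfolding fpart_def by blast
  ultimately show ?thesis unfolding fpart_def by blast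
qed

text \<open>Invariance is applied to the integral and to the mass of the cell separately, so no
  inverse of \<open>T\<close> is involved.\<close>

lemma (in mpt) ce_Tn:
  assumes \<xi> [measurable]: "fpart \<xi>" and f [measurable]: "f \<in> borel_measurable M"
  shows "ce M (\<lambda>w. \<xi> ((T ^^ n) w)) (\<lambda>w. f ((T ^^ n) w)) z = ce M \<xi> f ((T ^^ n) z)"
proof -
  let ?l = "\<xi> ((T ^^ n) z)"
  have "prob {w \<in> space M. \<xi> ((T ^^ n) w) = ?l} = prob {w \<in> space M. \<xi> w = ?l}"
    by (rule prob_Tn) measurable
  moreover have "(\<integral>w. of_bool (\<xi> ((T ^^ n) w) = ?l) * f ((T ^^ n) w) \<partial>M) = (\<integral>w. of_bool (\<xi> w = ?l) * f w \<partial>M)"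
    by (rule integral_Tn) measurable
  ultimately show ?thesis unfolding ce_def by (simp only:)
qed

section \<open>Digits\<close>

lemma frac_of_nat_mult_frac: "frac (real n * frac a) = frac (real n * a)"
proof -
  have "real n * a = real n * frac a + of_int (int n * \<lfloor>a\<rfloor>)"
    by (simp add: frac_def algebra_simps)
  then have "frac (real n * a) = frac (real n * frac a + of_int (int n * \<lfloor>a\<rfloor>))" by simp
  also have "\<dots> = frac (real n * frac a)" unfolding frac_def floor_add_int[symmetric] by simp
  finally show ?thesis by simp
qed

lemma floor_pow_frac:
  fixes p :: nat
  shows "\<lfloor>real p ^ L * frac (real p ^ n * x)\<rfloor> = \<lfloor>real p ^ (L + n) * x\<rfloor> - int p ^ L * \<lfloor>real p ^ n * x\<rfloor>"
proof -
  have "real p ^ L * frac (real p ^ n * x) = real p ^ (L + n) * x - of_int (int p ^ L * \<lfloor>real p ^ n * x\<rfloor>)"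
    by (simp add: frac_def algebra_simps power_add)
  then show ?thesis by (simp only: floor_diff_of_int)
qed

lemma floor_pow_div:
  fixes p :: nat
  assumes "p > 0"
  shows "\<lfloor>real p ^ L * x\<rfloor> = \<lfloor>real p ^ (L + j) * x\<rfloor> div int p ^ j"
proof -
  have "real p ^ L * x = real p ^ (L + j) * x / real_of_int (int p ^ j)"
    using assms by (simp add: power_add)
  then show ?thesis by (simp only: floor_divide_real_eq_div zero_le_power of_nat_0_le_iff)
qed

text \<open>The coordinates are arbitrary functions rather than \<open>fst\<close> and
  \<open>snd\<close>, so that every result can be reused after exchanging them. Values in
  \<open>[0, 1)\<close> are required at all points; fractional parts will provide this.\<close>

locale digits = mpt M T for M :: "'a measure" and T :: "'a \<Rightarrow> 'a" +
  fixes p :: nat and X Y :: "'a \<Rightarrow> real"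
  assumes p2: "2 \<le> p"
    and X_meas [measurable]: "X \<in> borel_measurable M" and Y_meas [measurable]: "Y \<in> borel_measurable M"
    and X_range: "0 \<le> X z" "X z < 1" and Y_range: "0 \<le> Y z" "Y z < 1"
    and X_T: "X (T z) = frac (real p * X z)" and Y_T: "Y (T z) = frac (real p * Y z)"
begin

lemma X_Tn: "X ((T ^^ n) z) = frac (real p ^ n * X z)"
proof (induction n)
  case 0
  show ?case using X_range[of z] by (simp add: frac_eq)
next
  case (Suc n)
  then show ?case by (simp add: X_T frac_of_nat_mult_frac mult.assoc)
qed

lemma Y_Tn: "Y ((T ^^ n) z) = frac (real p ^ n * Y z)"
proof (induction n)
  case 0
  show ?case using Y_range[of z] by (simp add: frac_eq)
next
  case (Suc n)
  then show ?case by (simp add: Y_T frac_of_nat_mult_frac mult.assoc)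
qed

definition col :: "nat \<Rightarrow> 'a \<Rightarrow> int" where "col q z = \<lfloor>real p ^ q * X z\<rfloor>"

definition xi :: "nat \<Rightarrow> 'a \<Rightarrow> int \<times> int" where
  "xi L z = (\<lfloor>real p ^ L * X z\<rfloor>, \<lfloor>real p ^ L * Y z\<rfloor>)"

lemma col_meas [measurable]: "col q \<in> M \<rightarrow>\<^sub>M count_space UNIV"
  unfolding col_def by measurable

lemma floor_pow_range:
  assumes "0 \<le> x" "x < 1"
  shows "\<lfloor>real p ^ q * x\<rfloor> \<in> {0..<int p ^ q}"
proof -
  have "real p ^ q * x < real p ^ q * 1" using assms p2 by (intro mult_strict_left_mono) auto
  then have "\<lfloor>real p ^ q * x\<rfloor> < int p ^ q" by (simp add: floor_less_iff)
  then show ?thesis using assms by auto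
qed

lemma col_range: "col q z \<in> {0..<int p ^ q}"
  unfolding col_def using floor_pow_range X_range by blast

lemma xi_fpart: "fpart (xi L)"
proof -
  have "range (xi L) \<subseteq> {0..<int p ^ L} \<times> {0..<int p ^ L}"
    unfolding xi_def using floor_pow_range X_range Y_range by blast
  then have "finite (range (xi L))" by (rule finite_subset) simp
  moreover have "xi L \<in> M \<rightarrow>\<^sub>M count_space UNIV"
  proof -
    have [measurable]: "(\<lambda>z. \<lfloor>real p ^ L * X z\<rfloor>) \<in> M \<rightarrow>\<^sub>M count_space UNIV"
      "(\<lambda>z. \<lfloor>real p ^ L * Y z\<rfloor>) \<in> M \<rightarrow>\<^sub>M count_space UNIV" by measurable
    have "xi L \<in> M \<rightarrow>\<^sub>M count_space UNIV \<Otimes>\<^sub>M count_space UNIV"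
      unfolding xi_def by measurable
    then show ?thesis by (simp add: pair_measure_countable)
  qed
  ultimately show ?thesis unfolding fpart_def by blast
qed

lemma xi_mono:
  assumes "L \<le> K"
  shows "depends_on (xi K) (xi L)"
proof (rule depends_onI)
  fix z w assume e: "xi K z = xi K w"
  have LK: "L + (K - L) = K" "p > 0" using assms p2 by auto
  have "\<lfloor>real p ^ K * X z\<rfloor> = \<lfloor>real p ^ K * X w\<rfloor>" "\<lfloor>real p ^ K * Y z\<rfloor> = \<lfloor>real p ^ K * Y w\<rfloor>"
    using e unfolding xi_def by simp_all
  then show "xi L z = xi L w"
    unfolding xi_def floor_pow_div[OF LK(2), of L _ "K - L", unfolded LK(1)] by (simp only:)
qed

lemma xi_shift:
  assumes "L + n \<le> K"
  shows "depends_on (xi K) (\<lambda>z. xi L ((T ^^ n) z))"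
proof (rule depends_onI)
  fix z w assume e: "xi K z = xi K w"
  have "L + n \<le> K" "n \<le> K" using assms by auto
  then have "xi (L + n) z = xi (L + n) w" "xi n z = xi n w"
    using depends_onD[OF xi_mono e] by blast+
  then show "xi L ((T ^^ n) z) = xi L ((T ^^ n) w)"
    unfolding xi_def X_Tn Y_Tn floor_pow_frac by simp
qed

text \<open>Points of one cell of level \<open>J \<ge> K\<close> share their first \<open>K\<close>
  digits, so agreement in the \<open>q\<close> digits after time \<open>K\<close> amounts to
  agreement in all of the first \<open>K + q\<close> digits of \<open>X\<close>.\<close>

lemma col_event:
  assumes "K \<le> J" "xi J w = xi J z"
  shows "col q ((T ^^ K) w) = col q ((T ^^ K) z) \<longleftrightarrow> col (K + q) w = col (K + q) z"
proof -
  have "xi K w = xi K z" using xi_mono[OF assms(1)] assms(2) by (rule depends_onD)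
  then show ?thesis unfolding xi_def col_def X_Tn floor_pow_frac by (simp add: add.commute)
qed

lemma col_div: "k \<le> q \<Longrightarrow> col k z = col q z div int p ^ (q - k)"
  unfolding col_def using floor_pow_div[of p k "X z" "q - k"] p2 by (simp only: le_add_diff_inverse)

section \<open>Conditional probabilities of columns and their collision probability\<close>

definition colprob :: "nat \<Rightarrow> nat \<Rightarrow> int \<Rightarrow> 'a \<Rightarrow> real" where
  "colprob K q c z = ce M (xi K) (\<lambda>w. of_bool (col q ((T ^^ K) w) = c)) z"

text \<open>The conditional probability of the column that actually occurs. Values near
  \<open>1\<close> mean that the past predicts the block; the mean is the collision probability of
  two conditionally independent blocks, by \<open>sum_colprob_sq\<close>.\<close>

definition g :: "nat \<Rightarrow> nat \<Rightarrow> 'a \<Rightarrow> real" where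
  "g K q z = colprob K q (col q ((T ^^ K) z)) z"

definition Q :: "nat \<Rightarrow> nat \<Rightarrow> real" where
  "Q K q = (\<integral>z. g K q z \<partial>M)"

lemma ce_event_bounds:
  assumes [measurable]: "Measurable.pred M P"
  shows "0 \<le> ce M (xi J) (\<lambda>w. of_bool (P w)) z" "ce M (xi J) (\<lambda>w. of_bool (P w)) z \<le> 1"
proof -
  have "\<bar>ce M (xi J) (\<lambda>w. of_bool (P w)) z\<bar> \<le> 1"
    by (rule ce_bound[OF _ _ xi_fpart]) auto
  then show "ce M (xi J) (\<lambda>w. of_bool (P w)) z \<le> 1" by simp
  show "0 \<le> ce M (xi J) (\<lambda>w. of_bool (P w)) z" by (rule ce_nonneg) simp
qed

lemma colprob_meas [measurable]: "colprob K q c \<in> borel_measurable M"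
  unfolding colprob_def using ce_measurable[OF xi_fpart] by simp

lemma colprob_depends: "depends_on (xi K) (colprob K q c)"
proof -
  have "colprob K q c = ce M (xi K) (\<lambda>w. of_bool (col q ((T ^^ K) w) = c))"
    unfolding colprob_def by (rule refl)
  then show ?thesis using ce_depends by metis
qed

lemma colprob_bounds: "0 \<le> colprob K q c z" "colprob K q c z \<le> 1"
  unfolding colprob_def by (rule ce_event_bounds; measurable)+

lemma g_bounds: "0 \<le> g K q z" "g K q z \<le> 1"
  unfolding g_def by (rule colprob_bounds)+

lemma sum_col:
  fixes F :: "int \<Rightarrow> real"
  shows "(\<Sum>c\<in>{0..<int p ^ q}. of_bool (col q z = c) * F c) = F (col q z)"
proof -
  have "(\<Sum>c\<in>{0..<int p ^ q}. of_bool (col q z = c) * F c) = (\<Sum>c\<in>{0..<int p ^ q}. if col q z = c then F c else 0)"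
    by (rule sum.cong) auto
  then show ?thesis using col_range[of q z] by simp
qed

lemma sum_col_integral:
  fixes H :: "int \<Rightarrow> 'a \<Rightarrow> real"
  assumes "\<And>c. integrable M (H c)"
  shows "(\<integral>z. H (col q ((T ^^ K) z)) z \<partial>M)
    = (\<Sum>c\<in>{0..<int p ^ q}. \<integral>z. of_bool (col q ((T ^^ K) z) = c) * H c z \<partial>M)"
proof -
  have "(\<integral>z. H (col q ((T ^^ K) z)) z \<partial>M)
      = (\<integral>z. (\<Sum>c\<in>{0..<int p ^ q}. of_bool (col q ((T ^^ K) z) = c) * H c z) \<partial>M)"
    by (simp only: sum_col)
  also have "\<dots> = (\<Sum>c\<in>{0..<int p ^ q}. \<integral>z. of_bool (col q ((T ^^ K) z) = c) * H c z \<partial>M)"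
    by (rule Bochner_Integration.integral_sum) (intro integrable_of_bool assms, measurable)
  finally show ?thesis .
qed

lemma g_meas [measurable]: "g K q \<in> borel_measurable M"
proof -
  have "g K q = (\<lambda>z. \<Sum>c\<in>{0..<int p ^ q}. of_bool (col q ((T ^^ K) z) = c) * colprob K q c z)"
    unfolding g_def sum_col by (rule refl)
  also have "\<dots> \<in> borel_measurable M" by measurable
  finally show ?thesis .
qed

lemma g_integrable: "integrable M (g K q)"
  by (rule integrable_bdd[where B=1]) (auto simp: g_bounds abs_le_iff intro: order_trans[OF _ g_bounds(1)])

lemma ce_event_shift:
  assumes "K \<le> J"
  shows "ce M (xi J) (\<lambda>w. of_bool (col q ((T ^^ K) w) = col q ((T ^^ K) z))) z
    = ce M (xi J) (\<lambda>w. of_bool (col (K + q) w = col (K + q) z)) z"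
  by (rule ce_cong) (simp only: col_event[OF assms])

text \<open>In terms of absolute digits the predicted event shrinks as \<open>q\<close> grows, and
  moving digits from the block to the past leaves it unchanged.\<close>

lemma g_alt: "g K q z = ce M (xi K) (\<lambda>w. of_bool (col (K + q) w = col (K + q) z)) z"
  unfolding g_def colprob_def by (rule ce_event_shift) simp

lemma g_antimono:
  assumes "k \<le> q"
  shows "g K q z \<le> g K k z"
proof -
  let ?A = "\<lambda>q w. of_bool (col (K + q) w = col (K + q) z) :: real"
  have [simp]: "integrable M (?A q)" for q by (rule integrable_bdd[where B=1]) auto
  have "?A q w \<le> ?A k w" for w
    using assms col_div[of "K + k" "K + q" w] col_div[of "K + k" "K + q" z] by auto
  then have "0 \<le> ce M (xi K) (\<lambda>w. ?A k w - ?A q w) z" by (intro ce_nonneg) (simp only: diff_ge_0_iff_ge)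
  also have "\<dots> = ce M (xi K) (?A k) z - ce M (xi K) (?A q) z" by (rule ce_diff) (simp_all add: xi_fpart)
  finally show ?thesis unfolding g_alt by simp
qed

lemma Q_antimono: "k \<le> q \<Longrightarrow> Q K q \<le> Q K k"
  unfolding Q_def by (intro integral_mono g_integrable g_antimono)

lemma Q_bounds: "0 \<le> Q K q" "Q K q \<le> 1"
proof -
  show "0 \<le> Q K q" unfolding Q_def by (rule Bochner_Integration.integral_nonneg) (rule g_bounds)
  have "Q K q \<le> (\<integral>z. 1 \<partial>M)" unfolding Q_def by (intro integral_mono g_integrable g_bounds) simp
  then show "Q K q \<le> 1" by (simp add: prob_space)
qed

text \<open>Averaging the square of a conditional probability is averaging it over the event, so the
  sum is the mean conditional probability of the column that occurs. With \<open>k\<close> of the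
  \<open>q\<close> digits already revealed, only \<open>q - k\<close> remain to be
  predicted.\<close>

lemma sum_ce_event_sq:
  assumes "k \<le> q"
  shows "(\<Sum>c\<in>{0..<int p ^ q}. \<integral>z. (ce M (xi (K + k)) (\<lambda>w. of_bool (col q ((T ^^ K) w) = c)) z)\<^sup>2 \<partial>M)
    = Q (K + k) (q - k)"
proof -
  let ?f = "\<lambda>c w. of_bool (col q ((T ^^ K) w) = c) :: real"
  let ?R = "\<lambda>c. ce M (xi (K + k)) (?f c)"
  have Rm [measurable]: "?R c \<in> borel_measurable M" for c by (rule ce_measurable[OF xi_fpart])
  have Rb: "\<bar>?R c z\<bar> \<le> 1" for c z by (rule ce_bound[OF _ _ xi_fpart]) auto
  have "(\<Sum>c\<in>{0..<int p ^ q}. \<integral>z. (?R c z)\<^sup>2 \<partial>M) = (\<Sum>c\<in>{0..<int p ^ q}. \<integral>z. ?f c z * ?R c z \<partial>M)"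
  proof (rule sum.cong)
    fix c
    have "(\<integral>z. ?R c z * ?R c z \<partial>M) = (\<integral>z. ?R c z * ?f c z \<partial>M)"
      by (rule ce_integral[OF _ _ xi_fpart ce_depends, where B=1]) auto
    then show "(\<integral>z. (?R c z)\<^sup>2 \<partial>M) = (\<integral>z. ?f c z * ?R c z \<partial>M)"
      by (simp add: power2_eq_square mult.commute)
  qed simp
  also have "\<dots> = (\<integral>z. ?R (col q ((T ^^ K) z)) z \<partial>M)"
    by (rule sum_col_integral[symmetric]) (rule integrable_bdd[OF Rm Rb])
  also have "\<dots> = Q (K + k) (q - k)"
  proof -
    have "?R (col q ((T ^^ K) z)) z = g (K + k) (q - k) z" for z
      unfolding g_alt using ce_event_shift[of K "K + k" q z] assms by simp
    then show ?thesis unfolding Q_def by simp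
  qed
  finally show ?thesis .
qed

lemma sum_colprob_sq: "(\<Sum>c\<in>{0..<int p ^ q}. \<integral>z. (colprob K q c z)\<^sup>2 \<partial>M) = Q K q"
  using sum_ce_event_sq[of 0 q K] unfolding colprob_def by simp

text \<open>Pythagoras column by column: the effect of revealing \<open>k\<close> digits of the
  block is a difference of values of \<open>Q\<close>, hence small once \<open>Q\<close> is nearly
  constant.\<close>

lemma sum_zoom:
  assumes "k \<le> q"
  shows "(\<Sum>c\<in>{0..<int p ^ q}.
      \<integral>z. (ce M (xi (K + k)) (\<lambda>w. of_bool (col q ((T ^^ K) w) = c)) z - colprob K q c z)\<^sup>2 \<partial>M)
    = Q (K + k) (q - k) - Q K q"
proof -
  let ?f = "\<lambda>c w. of_bool (col q ((T ^^ K) w) = c) :: real"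
  have "(\<integral>z. (ce M (xi (K + k)) (?f c) z - colprob K q c z)\<^sup>2 \<partial>M)
      = (\<integral>z. (ce M (xi (K + k)) (?f c) z)\<^sup>2 \<partial>M) - (\<integral>z. (colprob K q c z)\<^sup>2 \<partial>M)" for c
    unfolding colprob_def
    using ce_pythagoras[of "?f c" 1 "xi K" "xi (K + k)" "\<lambda>_. 1"]
    by (simp add: xi_fpart xi_mono depends_on_const)
  then show ?thesis
    using sum_ce_event_sq[OF assms, of K] sum_colprob_sq[of K q] by (simp add: sum_subtractf)
qed

text \<open>The cells of \<open>xi K\<close> seen from time \<open>j\<close> forget the first
  \<open>j\<close> digits, and \<open>xi (K + j)\<close> refines them. Pythagoras turns the effect
  of remembering the older digits into an increment of \<open>Q\<close>, which is also why
  \<open>Q\<close> grows with \<open>K\<close>.\<close>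

lemma sum_past:
  "(\<Sum>c\<in>{0..<int p ^ q}. \<integral>z. (colprob (K + j) q c z - colprob K q c ((T ^^ j) z))\<^sup>2 \<partial>M)
    = Q (K + j) q - Q K q"
proof -
  let ?f = "\<lambda>c w. of_bool (col q ((T ^^ (K + j)) w) = c) :: real"
  have sh: "colprob K q c ((T ^^ j) z) = ce M (\<lambda>w. xi K ((T ^^ j) w)) (?f c) z" for c z
    unfolding colprob_def using ce_Tn[OF xi_fpart, of "\<lambda>w. of_bool (col q ((T ^^ K) w) = c)" K j z]
    by (simp add: funpow_add)
  have "(\<integral>z. (colprob (K + j) q c z - colprob K q c ((T ^^ j) z))\<^sup>2 \<partial>M)
      = (\<integral>z. (colprob (K + j) q c z)\<^sup>2 \<partial>M) - (\<integral>z. (colprob K q c z)\<^sup>2 \<partial>M)" for c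
  proof -
    have "(\<integral>z. (colprob (K + j) q c z - colprob K q c ((T ^^ j) z))\<^sup>2 \<partial>M)
      = (\<integral>z. (colprob (K + j) q c z)\<^sup>2 \<partial>M) - (\<integral>z. (colprob K q c ((T ^^ j) z))\<^sup>2 \<partial>M)"
      unfolding sh unfolding colprob_def
      using ce_pythagoras[of "?f c" 1 "\<lambda>w. xi K ((T ^^ j) w)" "xi (K + j)" "\<lambda>_. 1"]
      by (simp add: xi_fpart fpart_Tn xi_shift depends_on_const)
    also have "(\<integral>z. (colprob K q c ((T ^^ j) z))\<^sup>2 \<partial>M) = (\<integral>z. (colprob K q c z)\<^sup>2 \<partial>M)"
      by (rule integral_Tn) measurable
    finally show ?thesis .
  qed
  then show ?thesis
    using sum_colprob_sq[of "K + j" q] sum_colprob_sq[of K q] by (simp add: sum_subtractf)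
qed

lemma Q_mono: "K \<le> J \<Longrightarrow> Q K q \<le> Q J q"
proof -
  assume "K \<le> J"
  have "0 \<le> Q (K + (J - K)) q - Q K q"
    unfolding sum_past[symmetric] by (intro sum_nonneg Bochner_Integration.integral_nonneg) simp
  then show ?thesis using \<open>K \<le> J\<close> by simp
qed

text \<open>At each point only one column is evaluated, so its square is bounded by the sum over all
  columns; then \<open>\<bar>x\<bar> \<le> e + x\<^sup>2 / e\<close>. In this way the number of
  columns does not enter the bound.\<close>

lemma L1_from_L2:
  fixes D :: "int \<Rightarrow> 'a \<Rightarrow> real" and d :: "'a \<Rightarrow> real"
  assumes e: "e > 0" and D: "\<And>c. D c \<in> borel_measurable M" "\<And>c z. \<bar>D c z\<bar> \<le> 1"
    and d: "\<And>z. d z = D (col q ((T ^^ K) z)) z"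
    and le: "(\<Sum>c\<in>{0..<int p ^ q}. \<integral>z. (D c z)\<^sup>2 \<partial>M) \<le> e\<^sup>2"
  shows "(\<integral>z. \<bar>d z\<bar> \<partial>M) \<le> 2 * e"
proof -
  note [measurable] = D(1)
  have sq: "integrable M (\<lambda>z. (D c z)\<^sup>2)" for c
    by (rule integrable_bdd[where B="1\<^sup>2"]) (use abs_sq_le[OF D(2)] in auto)
  have "d = (\<lambda>z. \<Sum>c\<in>{0..<int p ^ q}. of_bool (col q ((T ^^ K) z) = c) * D c z)"
    using d unfolding sum_col by blast
  then have [measurable]: "d \<in> borel_measurable M" by simp
  have pt: "\<bar>d z\<bar> \<le> e + (\<Sum>c\<in>{0..<int p ^ q}. (D c z)\<^sup>2) / e" for z
  proof -
    have "(d z)\<^sup>2 \<le> (\<Sum>c\<in>{0..<int p ^ q}. (D c z)\<^sup>2)"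
      unfolding d using col_range[of q "(T ^^ K) z"]
      by (intro member_le_sum[where f="\<lambda>c. (D c z)\<^sup>2"]) auto
    then have "(d z)\<^sup>2 / e \<le> (\<Sum>c\<in>{0..<int p ^ q}. (D c z)\<^sup>2) / e" using e by (simp add: divide_right_mono)
    moreover have "\<bar>d z\<bar> \<le> e + (d z)\<^sup>2 / e"
    proof (cases "\<bar>d z\<bar> \<le> e")
      case True
      then show ?thesis using e by (simp add: add_increasing2)
    next
      case False
      then have "e * \<bar>d z\<bar> \<le> \<bar>d z\<bar> * \<bar>d z\<bar>" using e by (intro mult_right_mono) auto
      then have "\<bar>d z\<bar> \<le> (d z)\<^sup>2 / e" using e by (simp add: pos_le_divide_eq power2_eq_square mult.commute)
      then show ?thesis using e by simp
    qed
    ultimately show ?thesis by linarith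
  qed
  have "(\<integral>z. \<bar>d z\<bar> \<partial>M) \<le> (\<integral>z. e + (\<Sum>c\<in>{0..<int p ^ q}. (D c z)\<^sup>2) / e \<partial>M)"
  proof (rule integral_mono)
    show "integrable M (\<lambda>z. \<bar>d z\<bar>)" by (rule integrable_bdd[where B=1]) (use d D in auto)
    show "integrable M (\<lambda>z. e + (\<Sum>c\<in>{0..<int p ^ q}. (D c z)\<^sup>2) / e)"
      using sq by (intro Bochner_Integration.integrable_add Bochner_Integration.integrable_divide
          Bochner_Integration.integrable_sum) auto
  qed (rule pt)
  also have "\<dots> = e + (\<Sum>c\<in>{0..<int p ^ q}. \<integral>z. (D c z)\<^sup>2 \<partial>M) / e"
    using sq by (simp add: prob_space)
  also have "\<dots> \<le> e + e\<^sup>2 / e" using le e by (simp add: divide_right_mono)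
  also have "\<dots> = 2 * e" using e by (simp add: power2_eq_square)
  finally show ?thesis .
qed

lemma g_past_close:
  assumes "e > 0" "Q (K + j) q - Q K q \<le> e\<^sup>2"
  shows "(\<integral>z. \<bar>g (K + j) q z - g K q ((T ^^ j) z)\<bar> \<partial>M) \<le> 2 * e"
proof (rule L1_from_L2[OF assms(1), where D="\<lambda>c z. colprob (K + j) q c z - colprob K q c ((T ^^ j) z)"
      and q=q and K="K + j"])
  show "\<bar>colprob (K + j) q c z - colprob K q c ((T ^^ j) z)\<bar> \<le> 1" for c z
    using colprob_bounds[of "K + j" q c z] colprob_bounds[of K q c "(T ^^ j) z"] by linarith
  show "g (K + j) q z - g K q ((T ^^ j) z)
      = colprob (K + j) q (col q ((T ^^ (K + j)) z)) z - colprob K q (col q ((T ^^ (K + j)) z)) ((T ^^ j) z)" for z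
    unfolding g_def by (simp add: funpow_add)
  show "(\<Sum>c = 0..<int p ^ q. \<integral>z. (colprob (K + j) q c z - colprob K q c ((T ^^ j) z))\<^sup>2 \<partial>M) \<le> e\<^sup>2"
    using sum_past[of K j q] assms(2) by simp
qed measurable

lemma g_zoom_close:
  assumes "e > 0" "Q (K + k) (q - k) - Q K q \<le> e\<^sup>2" "k \<le> q"
  shows "(\<integral>z. \<bar>g (K + k) (q - k) z - g K q z\<bar> \<partial>M) \<le> 2 * e"
proof (rule L1_from_L2[OF assms(1), where q=q and K=K and
      D="\<lambda>c z. ce M (xi (K + k)) (\<lambda>w. of_bool (col q ((T ^^ K) w) = c)) z - colprob K q c z"])
  let ?R = "\<lambda>c. ce M (xi (K + k)) (\<lambda>w. of_bool (col q ((T ^^ K) w) = c))"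
  have Rm [measurable]: "?R c \<in> borel_measurable M" for c by (rule ce_measurable[OF xi_fpart])
  show "(\<lambda>z. ?R c z - colprob K q c z) \<in> borel_measurable M" for c by measurable
  show "\<bar>?R c z - colprob K q c z\<bar> \<le> 1" for c z
  proof -
    have "0 \<le> ?R c z" "?R c z \<le> 1" by (rule ce_event_bounds; measurable)+
    then show ?thesis using colprob_bounds[of K q c z] by linarith
  qed
  show "g (K + k) (q - k) z - g K q z = ?R (col q ((T ^^ K) z)) z - colprob K q (col q ((T ^^ K) z)) z" for z
  proof -
    have e: "K + k + (q - k) = K + q" using assms(3) by simp
    have "g (K + k) (q - k) z = ?R (col q ((T ^^ K) z)) z"
      unfolding g_alt e by (rule ce_event_shift[symmetric]) simp
    then show ?thesis unfolding g_def[of K q z] by (simp only:)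
  qed
  show "(\<Sum>c = 0..<int p ^ q. \<integral>z. (?R c z - colprob K q c z)\<^sup>2 \<partial>M) \<le> e\<^sup>2"
    using sum_zoom[OF assms(3), of K] assms(2) by simp
qed

text \<open>Once the first \<open>k\<close> further digits are known, a column outside the current level-\<open>k\<close> column
  has probability \<open>0\<close>; so its conditional probability changes by at least its full initial value.\<close>

lemma g_almost_01:
  assumes "k \<le> q"
  shows "(\<integral>z. g K q z * (1 - g K k z) \<partial>M) \<le> Q (K + k) (q - k) - Q K q"
proof -
  let ?C = "{0..<int p ^ q}"
  let ?f = "\<lambda>c w. of_bool (col q ((T ^^ K) w) = c) :: real"
  let ?R = "\<lambda>c. ce M (xi (K + k)) (?f c)"
  let ?par = "\<lambda>c. c div int p ^ (q - k)"
  let ?P = "colprob K q" let ?P' = "\<lambda>c. colprob K k (?par c)"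
  have Rm [measurable]: "?R c \<in> borel_measurable M" for c by (rule ce_measurable[OF xi_fpart])
  have Rb: "0 \<le> ?R c z" "?R c z \<le> 1" for c z by (rule ce_event_bounds; measurable)+
  have int: "integrable M f" if "f \<in> borel_measurable M" "\<And>z. 0 \<le> f z" "\<And>z. f z \<le> 1"
    for f :: "'a \<Rightarrow> real"
    by (rule integrable_bdd[where B=1]) (use that in auto)
  have dep: "depends_on (xi K) (\<lambda>z. ?P c z * (1 - ?P' c z))" "depends_on (xi K) (\<lambda>z. (?P c z)\<^sup>2)" for c
  proof -
    show "depends_on (xi K) (\<lambda>z. ?P c z * (1 - ?P' c z))"
    proof (rule depends_onI)
      fix z w assume e: "xi K z = xi K w"
      show "?P c z * (1 - ?P' c z) = ?P c w * (1 - ?P' c w)"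
        unfolding depends_onD[OF colprob_depends[of K q c] e] depends_onD[OF colprob_depends[of K k "?par c"] e]
        by (rule refl)
    qed
    show "depends_on (xi K) (\<lambda>z. (?P c z)\<^sup>2)"
      by (rule depends_on_comp[OF colprob_depends])
  qed
  have parcol: "?par (col q z) = col k z" for z using col_div[OF assms, of z] by simp
  \<comment> \<open>For one column, the left side is the mean of \<open>?P\<close> squared over the
    event that the \<open>k\<close> digits after time \<open>K\<close> are not those of
    \<open>c\<close>; there \<open>?R\<close> vanishes and the whole of \<open>?P\<close> squared
    counts as change.\<close>
  have single: "(\<integral>z. ?f c z * (?P c z * (1 - ?P' c z)) \<partial>M) \<le> (\<integral>z. (?R c z - ?P c z)\<^sup>2 \<partial>M)" for c
  proof -
    let ?n = "\<lambda>z. of_bool (col k ((T ^^ K) z) = ?par c) :: real"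
    have "(\<integral>z. ?f c z * (?P c z * (1 - ?P' c z)) \<partial>M) = (\<integral>z. (?P c z * (1 - ?P' c z)) * ?P c z \<partial>M)"
      unfolding colprob_def[of K q c]
      using ce_integral[OF _ _ xi_fpart dep(1)[of c], of "?f c" 1] unfolding colprob_def[of K q c]
      by (simp add: mult.commute)
    also have "\<dots> = (\<integral>z. (?P c z)\<^sup>2 - (?P c z)\<^sup>2 * ?P' c z \<partial>M)"
      by (rule Bochner_Integration.integral_cong) (auto simp: power2_eq_square algebra_simps)
    also have "\<dots> = (\<integral>z. (?P c z)\<^sup>2 \<partial>M) - (\<integral>z. (?P c z)\<^sup>2 * ?P' c z \<partial>M)"
      by (rule Bochner_Integration.integral_diff; rule int; measurable?)
        (auto intro!: power_le_one mult_le_one colprob_bounds mult_nonneg_nonneg)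
    also have "(\<integral>z. (?P c z)\<^sup>2 * ?P' c z \<partial>M) = (\<integral>z. (?P c z)\<^sup>2 * ?n z \<partial>M)"
      using ce_integral[OF _ _ xi_fpart dep(2)[of c], of ?n 1] unfolding colprob_def[of K k]
      by simp
    also have "(\<integral>z. (?P c z)\<^sup>2 \<partial>M) - (\<integral>z. (?P c z)\<^sup>2 * ?n z \<partial>M) = (\<integral>z. (?P c z)\<^sup>2 - (?P c z)\<^sup>2 * ?n z \<partial>M)"
      by (rule Bochner_Integration.integral_diff[symmetric]; rule int; measurable?)
        (auto intro!: power_le_one mult_le_one colprob_bounds mult_nonneg_nonneg)
    also have "\<dots> \<le> (\<integral>z. (?R c z - ?P c z)\<^sup>2 \<partial>M)"
    proof (rule integral_mono)
      show "integrable M (\<lambda>z. (?P c z)\<^sup>2 - (?P c z)\<^sup>2 * ?n z)"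
        by (rule int) (auto intro!: power_le_one mult_le_one colprob_bounds mult_nonneg_nonneg simp: of_bool_def)
      show "integrable M (\<lambda>z. (?R c z - ?P c z)\<^sup>2)"
      proof (rule integrable_bdd[where B="1\<^sup>2"])
        fix z
        have "\<bar>?R c z - ?P c z\<bar> \<le> 1" using Rb[of c z] colprob_bounds[of K q c z] by linarith
        from abs_sq_le[OF this] show "\<bar>(?R c z - ?P c z)\<^sup>2\<bar> \<le> 1\<^sup>2" by simp
      qed measurable
      fix z
      show "(?P c z)\<^sup>2 - (?P c z)\<^sup>2 * ?n z \<le> (?R c z - ?P c z)\<^sup>2"
      proof (cases "col k ((T ^^ K) z) = ?par c")
        case False
        have "?R c z = ce M (xi (K + k)) (\<lambda>_. 0) z"
        proof (rule ce_cong)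
          fix w assume "xi (K + k) w = xi (K + k) z"
          then have "xi k ((T ^^ K) w) = xi k ((T ^^ K) z)"
            by (rule depends_onD[OF xi_shift, rotated]) simp
          then have "col k ((T ^^ K) w) = col k ((T ^^ K) z)" unfolding xi_def col_def by simp
          then have "col q ((T ^^ K) w) \<noteq> c" using parcol[of "(T ^^ K) w"] False by metis
          then show "?f c w = 0" by simp
        qed
        then have "?R c z = 0" unfolding ce_def by simp
        then show ?thesis by simp
      qed simp
    qed
    finally show ?thesis .
  qed
  have "(\<integral>z. g K q z * (1 - g K k z) \<partial>M) = (\<integral>z. ?P (col q ((T ^^ K) z)) z * (1 - ?P' (col q ((T ^^ K) z)) z) \<partial>M)"
    unfolding g_def parcol by (rule refl)
  also have "\<dots> = (\<Sum>c\<in>?C. \<integral>z. ?f c z * (?P c z * (1 - ?P' c z)) \<partial>M)"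
    by (rule sum_col_integral[where H="\<lambda>c z. ?P c z * (1 - ?P' c z)"], rule int)
      (auto intro!: mult_le_one mult_nonneg_nonneg simp: colprob_bounds)
  also have "\<dots> \<le> (\<Sum>c\<in>?C. \<integral>z. (?R c z - ?P c z)\<^sup>2 \<partial>M)" by (rule sum_mono) (rule single)
  also have "\<dots> = Q (K + k) (q - k) - Q K q" by (rule sum_zoom[OF assms])
  finally show ?thesis .
qed

end

section \<open>The zero-one law\<close>

text \<open>By the ergodic theorem the mean is a limit of averages of the functions
  \<open>f \<circ> T\<^sup>i\<close>, each within \<open>c\<close> of \<open>f\<close> in
  mean.\<close>

lemma (in ergodic_mpt) L1_close_to_mean:
  fixes f :: "'a \<Rightarrow> real"
  assumes f [measurable]: "f \<in> borel_measurable M" and B: "\<And>z. \<bar>f z\<bar> \<le> B"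
    and c: "\<And>i. (\<integral>z. \<bar>f ((T ^^ i) z) - f z\<bar> \<partial>M) \<le> c"
  shows "(\<integral>z. \<bar>integral\<^sup>L M f - f z\<bar> \<partial>M) \<le> c"
proof -
  define A where "A n z = (\<Sum>k<n. f ((T ^^ k) z)) / real n" for n z
  have [measurable]: "A n \<in> borel_measurable M" for n unfolding A_def by measurable
  have B0: "0 \<le> B" using B[of undefined] abs_ge_zero order_trans by blast
  have AB: "\<bar>A n z\<bar> \<le> B" for n z
  proof (cases "n = 0")
    case True
    then show ?thesis using B0 by (simp add: A_def)
  next
    case False
    have "\<bar>\<Sum>k<n. f ((T ^^ k) z)\<bar> \<le> real n * B"
      using sum_norm_bound[of "{..<n}" "\<lambda>k. f ((T ^^ k) z)" B] B by auto
    then show ?thesis using False unfolding A_def by (simp add: abs_divide pos_divide_le_eq mult.commute)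
  qed
  have lim: "(\<lambda>n. \<integral>z. \<bar>A n z - f z\<bar> \<partial>M) \<longlonglongrightarrow> (\<integral>z. \<bar>integral\<^sup>L M f - f z\<bar> \<partial>M)"
  proof (rule integral_dominated_convergence[where w="\<lambda>_. 2 * B"])
    show "AE z in M. (\<lambda>n. \<bar>A n z - f z\<bar>) \<longlonglongrightarrow> \<bar>integral\<^sup>L M f - f z\<bar>"
      using birkhoff[OF f B] unfolding A_def by eventually_elim (intro tendsto_intros)
    show "AE z in M. norm \<bar>A n z - f z\<bar> \<le> 2 * B" for n
    proof (rule AE_I2)
      fix z show "norm \<bar>A n z - f z\<bar> \<le> 2 * B" using AB[of n z] B[of z] by simp
    qed
  qed auto
  have "(\<integral>z. \<bar>A n z - f z\<bar> \<partial>M) \<le> c" if n: "n > 0" for n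
  proof -
    have int: "integrable M (\<lambda>z. \<bar>f ((T ^^ i) z) - f z\<bar>)" for i
    proof (rule integrable_bdd[where B="2 * B"])
      fix z show "\<bar>\<bar>f ((T ^^ i) z) - f z\<bar>\<bar> \<le> 2 * B" using B[of "(T ^^ i) z"] B[of z] by linarith
    qed measurable
    have "(\<integral>z. \<bar>A n z - f z\<bar> \<partial>M) \<le> (\<integral>z. (\<Sum>i<n. \<bar>f ((T ^^ i) z) - f z\<bar>) / real n \<partial>M)"
    proof (rule integral_mono)
      show "integrable M (\<lambda>z. \<bar>A n z - f z\<bar>)"
      proof (rule integrable_bdd[where B="2 * B"])
        fix z show "\<bar>\<bar>A n z - f z\<bar>\<bar> \<le> 2 * B" using AB[of n z] B[of z] by simp
      qed measurable
      show "integrable M (\<lambda>z. (\<Sum>i<n. \<bar>f ((T ^^ i) z) - f z\<bar>) / real n)"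
        by (intro Bochner_Integration.integrable_divide Bochner_Integration.integrable_sum int)
      fix z
      have "A n z - f z = (\<Sum>i<n. f ((T ^^ i) z) - f z) / real n"
        using n unfolding A_def by (simp add: sum_subtractf diff_divide_distrib)
      also have "\<bar>\<dots>\<bar> \<le> (\<Sum>i<n. \<bar>f ((T ^^ i) z) - f z\<bar>) / real n"
        by (simp add: abs_divide divide_right_mono)
      finally show "\<bar>A n z - f z\<bar> \<le> (\<Sum>i<n. \<bar>f ((T ^^ i) z) - f z\<bar>) / real n" .
    qed
    also have "\<dots> = (\<Sum>i<n. \<integral>z. \<bar>f ((T ^^ i) z) - f z\<bar> \<partial>M) / real n"
      by (subst integral_divide_zero) (subst Bochner_Integration.integral_sum, rule int, rule refl)
    also have "\<dots> \<le> (\<Sum>i<n. c) / real n" by (intro divide_right_mono sum_mono c) simp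
    also have "\<dots> = c" using n by simp
    finally show ?thesis .
  qed
  then show ?thesis by (intro LIMSEQ_le_const2[OF lim]) (auto intro!: exI[of _ 1])
qed

lemma (in prob_space) L1_triangle:
  fixes a b c :: "'a \<Rightarrow> real"
  assumes "a \<in> borel_measurable M" "b \<in> borel_measurable M" "c \<in> borel_measurable M"
    and "\<And>z. a z \<in> {0..1}" "\<And>z. b z \<in> {0..1}" "\<And>z. c z \<in> {0..1}"
  shows "(\<integral>z. \<bar>a z - c z\<bar> \<partial>M) \<le> (\<integral>z. \<bar>a z - b z\<bar> \<partial>M) + (\<integral>z. \<bar>b z - c z\<bar> \<partial>M)"
proof -
  have i: "integrable M (\<lambda>z. \<bar>u z - v z\<bar>)"
    if [measurable]: "u \<in> borel_measurable M" "v \<in> borel_measurable M"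
      and uv: "\<And>z. u z \<in> {0..1}" "\<And>z. v z \<in> {0..1}" for u v :: "'a \<Rightarrow> real"
  proof (rule integrable_bdd[where B=1])
    fix z show "\<bar>\<bar>u z - v z\<bar>\<bar> \<le> 1" using uv(1)[of z] uv(2)[of z] by auto
  qed measurable
  have "(\<integral>z. \<bar>a z - c z\<bar> \<partial>M) \<le> (\<integral>z. \<bar>a z - b z\<bar> + \<bar>b z - c z\<bar> \<partial>M)"
    by (rule integral_mono[OF i Bochner_Integration.integrable_add[OF i i]]) (use assms in simp_all)
  also have "\<dots> = (\<integral>z. \<bar>a z - b z\<bar> \<partial>M) + (\<integral>z. \<bar>b z - c z\<bar> \<partial>M)"
    by (rule Bochner_Integration.integral_add[OF i i]) (use assms in simp_all)
  finally show ?thesis .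
qed

locale ergodic_digits = digits M T p X Y + ergodic_mpt M T
  for M :: "'a measure" and T :: "'a \<Rightarrow> 'a" and p :: nat and X Y :: "'a \<Rightarrow> real"
begin

text \<open>In the limit \<open>K, q \<rightarrow> \<infinity>\<close> the functions \<open>g K q\<close> become \<open>T\<close>-invariant and \<open>{0,1}\<close>-valued, so
  ergodicity forces their mean towards \<open>0\<close> or \<open>1\<close>.\<close>

lemma Q_zero_one:
  "(\<forall>e>0. \<exists>q. \<forall>K. Q K q \<le> e) \<or> (\<forall>q. \<forall>e>0. \<exists>K. 1 - e \<le> Q K q)"
proof -
  define S where "S q = (SUP K. Q K q)" for q
  have bdd: "bdd_above (range (\<lambda>K. Q K q))" for q by (rule bdd_aboveI[of _ 1]) (use Q_bounds in auto)
  have QS: "Q K q \<le> S q" for K q unfolding S_def by (rule cSUP_upper[OF _ bdd]) simp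
  have Sge: "\<exists>K0. \<forall>K\<ge>K0. S q - d \<le> Q K q" if "d > 0" for q d
  proof -
    have "S q - d < S q" using that by simp
    then obtain K0 where "S q - d < Q K0 q" unfolding S_def using less_cSUP_iff[OF _ bdd[of q]] by auto
    then show ?thesis using Q_mono[of K0 _ q] by (meson less_imp_le order_trans)
  qed
  have S01: "0 \<le> S q" "S q \<le> 1" for q
  proof -
    show "0 \<le> S q" using QS[of 0 q] Q_bounds(1)[of 0 q] by linarith
    show "S q \<le> 1" unfolding S_def by (rule cSUP_least) (auto simp: Q_bounds)
  qed
  have Smono: "S q \<le> S k" if "k \<le> q" for k q
    unfolding S_def[of q] by (rule cSUP_least) (auto intro: order_trans[OF Q_antimono[OF that] QS])
  define I where "I = (INF q. S q)"
  have bddS: "bdd_below (range S)" by (rule bdd_belowI[of _ 0]) (use S01 in auto)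
  have IS: "I \<le> S q" for q unfolding I_def by (rule cINF_lower[OF bddS]) simp
  have I0: "0 \<le> I" unfolding I_def by (rule cINF_greatest) (auto simp: S01)
  have I1: "I \<le> 1" using IS[of 0] S01(2)[of 0] by linarith
  have main: "I * (1 - I) \<le> 25 * e" if e: "0 < e" "e \<le> 1" for e
  proof -
    \<comment> \<open>\<open>L1_from_L2\<close> loses a square root: an increment of
      \<open>Q\<close> of size \<open>e\<^sup>2\<close> gives a distance of order \<open>e\<close>
      in mean.\<close>
    define d where "d = e\<^sup>2"
    have d: "0 < d" "d \<le> e" using e by (auto simp: d_def power2_eq_square mult_le_one)
    have "I < I + d" using d by simp
    then obtain q where q: "S q \<le> I + d" unfolding I_def using cINF_less_iff[OF _ bddS] less_imp_le by blast
    have Sd: "I \<le> S k" "k \<ge> q \<Longrightarrow> S k \<le> I + d" for k using IS Smono q order_trans by blast+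
    obtain Ka where Ka: "\<And>K. K \<ge> Ka \<Longrightarrow> S q - d \<le> Q K q" using Sge[OF d(1)] by blast
    obtain Kb where Kb: "\<And>K. K \<ge> Kb \<Longrightarrow> S (2 * q) - d \<le> Q K (2 * q)" using Sge[OF d(1)] by blast
    \<comment> \<open>At this past length \<open>Q\<close> is within \<open>d\<close> of its
      supremum over pasts for both block lengths \<open>q\<close> and \<open>2 * q\<close>, and
      these suprema are within \<open>d\<close> of \<open>I\<close>; neither older digits nor
      revealed ones can change much.\<close>
    define K where "K = max Ka Kb"
    have K1: "S q - d \<le> Q J q" if "J \<ge> K" for J using Ka that unfolding K_def by simp
    have K2: "S (2 * q) - d \<le> Q K (2 * q)" using Kb unfolding K_def by simp
    let ?f = "g K q"
    have fb: "?f z \<in> {0..1}" for z using g_bounds by simp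
    have almost: "(\<integral>z. ?f z * (1 - ?f z) \<partial>M) \<le> 4 * d"
    proof -
      have i: "integrable M (\<lambda>z. u z * (1 - ?f z))" if [measurable]: "u \<in> borel_measurable M" and u: "\<And>z. u z \<in> {0..1}" for u
      proof (rule integrable_bdd[where B=1])
        fix z show "\<bar>u z * (1 - ?f z)\<bar> \<le> 1" using u[of z] fb[of z] by (auto simp: abs_mult intro!: mult_le_one)
      qed measurable
      have "(\<integral>z. g K (2 * q) z * (1 - ?f z) \<partial>M) \<le> Q (K + q) (2 * q - q) - Q K (2 * q)"
        by (rule g_almost_01) simp
      also have "\<dots> \<le> 2 * d" using QS[of "K + q" q] K2 Sd(2)[of q] Sd(1)[of "2 * q"] by simp
      finally have 1: "(\<integral>z. g K (2 * q) z * (1 - ?f z) \<partial>M) \<le> 2 * d" .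
      have "(\<integral>z. ?f z * (1 - ?f z) \<partial>M) \<le> (\<integral>z. g K (2 * q) z * (1 - ?f z) + (?f z - g K (2 * q) z) \<partial>M)"
      proof (rule integral_mono)
        fix z
        have "(?f z - g K (2 * q) z) * (1 - ?f z) \<le> (?f z - g K (2 * q) z) * 1"
          using fb[of z] g_antimono[of q "2 * q" K z] by (intro mult_left_mono) auto
        then show "?f z * (1 - ?f z) \<le> g K (2 * q) z * (1 - ?f z) + (?f z - g K (2 * q) z)"
          by (simp add: algebra_simps)
      qed (use g_bounds in \<open>intro Bochner_Integration.integrable_add Bochner_Integration.integrable_diff i g_integrable g_meas; simp\<close>)+
      also have "\<dots> = (\<integral>z. g K (2 * q) z * (1 - ?f z) \<partial>M) + (Q K q - Q K (2 * q))"
        unfolding Q_def using i[of "g K (2 * q)"] g_integrable g_bounds by simp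
      also have "\<dots> \<le> 4 * d" using 1 QS[of K q] K2 Sd(2)[of q] Sd(1)[of "2 * q"] by simp
      finally show ?thesis .
    qed
    \<comment> \<open>Time \<open>J\<close> and time \<open>J + i\<close> are connected by four
      short steps: lengthen the past at block length \<open>q\<close>, lengthen the block to
      \<open>q + i\<close>, reveal \<open>i\<close> digits of it, and shorten the past again.
      \<open>J\<close> is chosen to make \<open>Q\<close> nearly maximal for blocks of length
      \<open>q + i\<close>.\<close>
    have inv: "(\<integral>z. \<bar>?f ((T ^^ i) z) - ?f z\<bar> \<partial>M) \<le> 9 * e" for i
    proof -
      obtain Kc where Kc: "\<And>K. K \<ge> Kc \<Longrightarrow> S (q + i) - d \<le> Q K (q + i)" using Sge[OF d(1)] by blast
      define J where "J = max K Kc - K"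
      have J: "S (q + i) - d \<le> Q (K + J) (q + i)" using Kc unfolding J_def by simp
      have past: "(\<integral>z. \<bar>g (K + j) q z - ?f ((T ^^ j) z)\<bar> \<partial>M) \<le> 2 * e" for j
        by (rule g_past_close) (use e QS[of "K + j" q] K1[of K] in \<open>auto simp: d_def\<close>)
      have a1: "(\<integral>z. \<bar>?f ((T ^^ J) z) - g (K + J) q z\<bar> \<partial>M) \<le> 2 * e"
        using past[of J] by (simp add: abs_minus_commute)
      have a2: "(\<integral>z. \<bar>g (K + J) q z - g (K + J) (q + i) z\<bar> \<partial>M) \<le> 2 * d"
      proof -
        have "\<bar>g (K + J) q z - g (K + J) (q + i) z\<bar> = g (K + J) q z - g (K + J) (q + i) z" for z
          using g_antimono[of q "q + i" "K + J" z] by simp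
        then have "(\<integral>z. \<bar>g (K + J) q z - g (K + J) (q + i) z\<bar> \<partial>M) = Q (K + J) q - Q (K + J) (q + i)"
          unfolding Q_def using g_integrable by simp
        then show ?thesis using QS[of "K + J" q] J Sd(2)[of q] Sd(1)[of "q + i"] by simp
      qed
      have a3: "(\<integral>z. \<bar>g (K + J) (q + i) z - g (K + J + i) q z\<bar> \<partial>M) \<le> 3 * e"
      proof -
        have "Q (K + J + i) (q + i - i) - Q (K + J) (q + i) \<le> 2 * d"
          using QS[of "K + J + i" q] J Sd(2)[of q] Sd(1)[of "q + i"] by simp
        \<comment> \<open>\<open>2 * d = 2 * e\<^sup>2\<close> lies below
          \<open>9 / 4 * e\<^sup>2\<close>; this is where the constant \<open>3 * e\<close> of this
          step comes from.\<close>
        also have "\<dots> \<le> (3 / 2 * e)\<^sup>2" unfolding d_def by (simp add: power2_eq_square)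
        finally have "(\<integral>z. \<bar>g (K + J + i) (q + i - i) z - g (K + J) (q + i) z\<bar> \<partial>M) \<le> 2 * (3 / 2 * e)"
          using e by (intro g_zoom_close) auto
        then show ?thesis by (simp add: abs_minus_commute)
      qed
      have a4: "(\<integral>z. \<bar>g (K + J + i) q z - ?f ((T ^^ (J + i)) z)\<bar> \<partial>M) \<le> 2 * e"
        using past[of "J + i"] by (simp add: add.assoc)
      have tri: "(\<integral>z. \<bar>u z - w z\<bar> \<partial>M) \<le> (\<integral>z. \<bar>u z - v z\<bar> \<partial>M) + (\<integral>z. \<bar>v z - w z\<bar> \<partial>M)"
        if "u \<in> borel_measurable M" "v \<in> borel_measurable M" "w \<in> borel_measurable M"
          "\<And>z. u z \<in> {0..1}" "\<And>z. v z \<in> {0..1}" "\<And>z. w z \<in> {0..1}" for u v w :: "'a \<Rightarrow> real"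
        using that by (rule L1_triangle)
      have gb: "g k l z \<in> {0..1}" for k l z using g_bounds by simp
      have gT [measurable]: "(\<lambda>z. ?f ((T ^^ n) z)) \<in> borel_measurable M" for n by measurable
      have "(\<integral>z. \<bar>?f ((T ^^ i) z) - ?f z\<bar> \<partial>M) = (\<integral>z. \<bar>?f ((T ^^ i) ((T ^^ J) z)) - ?f ((T ^^ J) z)\<bar> \<partial>M)"
        by (rule integral_Tn[symmetric]) measurable
      also have "\<dots> = (\<integral>z. \<bar>?f ((T ^^ J) z) - ?f ((T ^^ (J + i)) z)\<bar> \<partial>M)"
        by (simp only: funpow_add comp_def add.commute[of J i] abs_minus_commute)
      also have "\<dots> \<le> (\<integral>z. \<bar>?f ((T ^^ J) z) - g (K + J) q z\<bar> \<partial>M) + (\<integral>z. \<bar>g (K + J) q z - ?f ((T ^^ (J + i)) z)\<bar> \<partial>M)"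
        by (rule tri; (intro gT g_meas gb)?)
      also have "(\<integral>z. \<bar>g (K + J) q z - ?f ((T ^^ (J + i)) z)\<bar> \<partial>M)
        \<le> (\<integral>z. \<bar>g (K + J) q z - g (K + J) (q + i) z\<bar> \<partial>M) + (\<integral>z. \<bar>g (K + J) (q + i) z - ?f ((T ^^ (J + i)) z)\<bar> \<partial>M)"
        by (rule tri; (intro gT g_meas gb)?)
      also have "(\<integral>z. \<bar>g (K + J) (q + i) z - ?f ((T ^^ (J + i)) z)\<bar> \<partial>M)
        \<le> (\<integral>z. \<bar>g (K + J) (q + i) z - g (K + J + i) q z\<bar> \<partial>M) + (\<integral>z. \<bar>g (K + J + i) q z - ?f ((T ^^ (J + i)) z)\<bar> \<partial>M)"
        by (rule tri; (intro gT g_meas gb)?)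
      finally show ?thesis using a1 a2 a3 a4 d by linarith
    qed
    define m where "m = Q K q"
    have mint: "integral\<^sup>L M ?f = m" unfolding m_def Q_def by (rule refl)
    have close: "(\<integral>z. \<bar>m - ?f z\<bar> \<partial>M) \<le> 9 * e"
    proof -
      have "\<bar>?f z\<bar> \<le> 1" for z using fb[of z] by auto
      from L1_close_to_mean[OF g_meas this inv] show ?thesis unfolding mint .
    qed
    have m01: "0 \<le> m" "m \<le> 1" unfolding m_def by (rule Q_bounds)+
    \<comment> \<open>If \<open>?f\<close> is nearly \<open>{0,1}\<close>-valued and nearly equal to
      its mean \<open>m\<close>, then \<open>m\<close> is nearly \<open>0\<close> or
      \<open>1\<close>. The bound \<open>22 * e\<close> is \<open>4 * d + 2 * (9 * e)\<close> with
      \<open>d \<le> e\<close>.\<close>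
    have "m - m\<^sup>2 = (\<integral>z. ?f z * (1 - ?f z) + ((?f z)\<^sup>2 - m\<^sup>2) \<partial>M)"
    proof -
      have "?f z * (1 - ?f z) + ((?f z)\<^sup>2 - m\<^sup>2) = ?f z - m\<^sup>2" for z by (simp add: power2_eq_square algebra_simps)
      then have "(\<integral>z. ?f z * (1 - ?f z) + ((?f z)\<^sup>2 - m\<^sup>2) \<partial>M) = (\<integral>z. ?f z - m\<^sup>2 \<partial>M)" by (simp only:)
      then show ?thesis using mint g_integrable[of K q] by (simp add: prob_space)
    qed
    also have "\<dots> \<le> (\<integral>z. ?f z * (1 - ?f z) + 2 * \<bar>m - ?f z\<bar> \<partial>M)"
    proof (rule integral_mono)
      show "integrable M (\<lambda>z. ?f z * (1 - ?f z) + ((?f z)\<^sup>2 - m\<^sup>2))"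
      proof (rule integrable_bdd[where B=2])
        fix z show "\<bar>?f z * (1 - ?f z) + ((?f z)\<^sup>2 - m\<^sup>2)\<bar> \<le> 2"
        proof -
          have "?f z * (1 - ?f z) + ((?f z)\<^sup>2 - m\<^sup>2) = ?f z - m\<^sup>2" by (simp add: power2_eq_square algebra_simps)
          moreover have "m\<^sup>2 \<le> 1" "0 \<le> m\<^sup>2" using m01 by (auto simp: power_le_one)
          ultimately show ?thesis using fb[of z] unfolding atLeastAtMost_iff by linarith
        qed
      qed measurable
      show "integrable M (\<lambda>z. ?f z * (1 - ?f z) + 2 * \<bar>m - ?f z\<bar>)"
      proof (rule integrable_bdd[where B=3])
        fix z
        have "0 \<le> ?f z * (1 - ?f z)" "?f z * (1 - ?f z) \<le> 1" using fb[of z] by (auto intro!: mult_le_one)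
        moreover have "\<bar>m - ?f z\<bar> \<le> 1" using fb[of z] m01 by auto
        moreover have "\<bar>a + 2 * b\<bar> \<le> 3" if "0 \<le> a" "a \<le> 1" "0 \<le> b" "b \<le> 1" for a b :: real
          using that by linarith
        ultimately show "\<bar>?f z * (1 - ?f z) + 2 * \<bar>m - ?f z\<bar>\<bar> \<le> 3" by simp
      qed measurable
      fix z
      have "(?f z)\<^sup>2 - m\<^sup>2 = (?f z + m) * (?f z - m)" by (simp add: power2_eq_square algebra_simps)
      also have "\<dots> \<le> (?f z + m) * \<bar>m - ?f z\<bar>" using fb[of z] m01 by (intro mult_left_mono) auto
      also have "\<dots> \<le> 2 * \<bar>m - ?f z\<bar>" using fb[of z] m01 by (intro mult_right_mono) auto
      finally show "?f z * (1 - ?f z) + ((?f z)\<^sup>2 - m\<^sup>2) \<le> ?f z * (1 - ?f z) + 2 * \<bar>m - ?f z\<bar>" by simp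
    qed
    also have "\<dots> = (\<integral>z. ?f z * (1 - ?f z) \<partial>M) + 2 * (\<integral>z. \<bar>m - ?f z\<bar> \<partial>M)"
    proof -
      have i1: "integrable M (\<lambda>z. ?f z * (1 - ?f z))"
      proof (rule integrable_bdd[where B=1])
        fix z show "\<bar>?f z * (1 - ?f z)\<bar> \<le> 1" using fb[of z] by (auto simp: abs_mult intro!: mult_le_one)
      qed measurable
      have i2: "integrable M (\<lambda>z. \<bar>m - ?f z\<bar>)"
      proof (rule integrable_bdd[where B=1])
        fix z show "\<bar>\<bar>m - ?f z\<bar>\<bar> \<le> 1" using fb[of z] m01 by auto
      qed measurable
      show ?thesis using i1 i2 by simp
    qed
    also have "\<dots> \<le> 22 * e" using almost close d by linarith
    finally have m: "m - m\<^sup>2 \<le> 22 * e" .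
    have mI: "\<bar>I - m\<bar> \<le> d" unfolding m_def using K1[of K] QS[of K q] Sd[of q] by auto
    have "I * (1 - I) - (m - m\<^sup>2) = (I - m) * (1 - I - m)" by (simp add: power2_eq_square algebra_simps)
    also have "\<dots> \<le> \<bar>I - m\<bar> * \<bar>1 - I - m\<bar>" by (metis abs_ge_self abs_mult)
    also have "\<dots> \<le> d * 1" using mI I0 I1 m01 by (intro mult_mono) auto
    finally show ?thesis using m d e by linarith
  qed
  have "I * (1 - I) \<le> 0"
  proof (rule ccontr)
    assume "\<not> ?thesis"
    then have pos: "0 < I * (1 - I)" by simp
    have "I * (1 - I) \<le> 1" using I0 I1 by (intro mult_le_one) auto
    then have "I * (1 - I) \<le> 25 * (I * (1 - I) / 50)" using pos by (intro main) auto
    then show False using pos by simp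
  qed
  moreover have "0 \<le> I * (1 - I)" using I0 I1 by simp
  ultimately have "I = 0 \<or> I = 1" by auto
  then show ?thesis
  proof
    assume I: "I = 0"
    have "\<exists>q. \<forall>K. Q K q \<le> e" if "e > 0" for e
    proof -
      have "I < e" using I that by simp
      then obtain q where "S q < e" unfolding I_def using cINF_less_iff[OF _ bddS] by blast
      then have "\<forall>K. Q K q \<le> e" using QS[of _ q] by (meson less_imp_le order_trans)
      then show ?thesis by blast
    qed
    then show ?thesis by blast
  next
    assume I: "I = 1"
    have "\<exists>K. 1 - e \<le> Q K q" if e: "e > 0" for q e
    proof -
      obtain K where "S q - e \<le> Q K q" using Sge[OF e] by blast
      then show ?thesis using IS[of q] I by (intro exI[of _ K]) linarith
    qed
    then show ?thesis by blast
  qed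
qed

end

section \<open>Fourier coefficients of the conditional laws\<close>

text \<open>Half-open, because \<open>frac\<close> takes values in \<open>[0, 1)\<close>: rotations
  and the flow then map the space into itself.\<close>

definition unitU :: "real measure" where
  "unitU = restrict_space lborel {0..<1}"

lemma space_unitU [simp]: "space unitU = {0..<1}"
  by (simp add: unitU_def space_restrict_space)

lemma prob_space_unitU: "prob_space unitU"
  by (rule prob_spaceI) (simp add: unitU_def emeasure_restrict_space space_restrict_space)

lemma measurable_unitU: "f \<in> borel_measurable borel \<Longrightarrow> f \<in> borel_measurable unitU"
  unfolding unitU_def by (rule measurable_restrict_space1) simp

lemma integral_unitU:
  fixes f :: "real \<Rightarrow> real"
  assumes [measurable]: "f \<in> borel_measurable borel"
  shows "integral\<^sup>L unitU f = (\<integral>t. f t * indicator {0..1} t \<partial>lborel)"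
proof -
  have "integral\<^sup>L unitU f = (\<integral>t. indicator {0..<1} t *\<^sub>R f t \<partial>lborel)"
    unfolding unitU_def by (rule integral_restrict_space) simp
  also have "\<dots> = (\<integral>t. f t * indicator {0..1} t \<partial>lborel)"
  proof (rule integral_cong_AE)
    show "AE t in lborel. indicator {0..<1} t *\<^sub>R f t = f t * indicator {0..1} t"
      using AE_lborel_singleton[of 1] by eventually_elim (auto simp: indicator_def)
  qed measurable
  finally show ?thesis .
qed

section \<open>Elementary estimates for trigonometric functions and their averages\<close>

lemma abs_cos_diff_le: "\<bar>cos a - cos b\<bar> \<le> \<bar>a - b :: real\<bar>"
proof -
  have "cos a - cos b = 2 * sin ((a + b) / 2) * sin ((b - a) / 2)"
    by (rule cos_diff_cos)
  then have "\<bar>cos a - cos b\<bar> = 2 * \<bar>sin ((a + b) / 2)\<bar> * \<bar>sin ((b - a) / 2)\<bar>" by (simp add: abs_mult)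
  also have "\<dots> \<le> 2 * 1 * \<bar>(b - a) / 2\<bar>"
    by (intro mult_mono abs_sin_x_le_abs_x) auto
  finally show ?thesis by simp
qed

lemma abs_sin_diff_le: "\<bar>sin a - sin b\<bar> \<le> \<bar>a - b :: real\<bar>"
  using abs_cos_diff_le[of "pi / 2 - a" "pi / 2 - b"] by (simp add: cos_diff abs_minus_commute)

lemma sq_diff_le:
  fixes x y :: real
  assumes "\<bar>x\<bar> \<le> 1" "\<bar>y\<bar> \<le> 1" "\<bar>x - y\<bar> \<le> d"
  shows "\<bar>x\<^sup>2 - y\<^sup>2\<bar> \<le> 2 * d"
proof -
  have "\<bar>x\<^sup>2 - y\<^sup>2\<bar> = \<bar>x + y\<bar> * \<bar>x - y\<bar>" by (simp add: abs_mult[symmetric] power2_eq_square algebra_simps)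
  also have "\<dots> \<le> 2 * d" using assms by (intro mult_mono) auto
  finally show ?thesis .
qed

text \<open>Integration by parts against \<open>d(sin (A p\<^sup>t))\<close>: averaging over a logarithmic scale kills
  every high frequency.\<close>

lemma log_scale_oscillation:
  fixes p :: nat
  assumes p: "2 \<le> p" and A: "A \<noteq> 0"
  shows "\<bar>integral\<^sup>L unitU (\<lambda>t. cos (A * real p powr t))\<bar> \<le> 4 / \<bar>A\<bar>"
proof -
  \<comment> \<open>\<open>F\<close> is \<open>sin (A * p powr t)\<close> divided by the derivative
    of its phase; differentiating that divisor leaves the correction \<open>s\<close>, which is of
    order \<open>1 / \<bar>A\<bar>\<close>.\<close>
  define F where "F t = sin (A * real p powr t) * real p powr (- t) / (A * ln (real p))" for t
  define s where "s t = sin (A * real p powr t) * real p powr (- t) / A" for t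
  \<comment> \<open>This bound makes \<open>1 / ln p\<close> at most \<open>3 / 2\<close>, so that
    two boundary terms and the integral of \<open>s\<close> add up to
    \<open>4 / \<bar>A\<bar>\<close>.\<close>
  have "ln 2 \<le> ln (real p)" using p by simp
  then have lnp: "ln (real p) \<ge> 2 / 3" "ln (real p) > 0"
    using ln2_ge_two_thirds by linarith+
  have der: "(F has_real_derivative (cos (A * real p powr t) - s t)) (at t)" for t
    unfolding F_def s_def using A lnp p
    by (auto intro!: derivative_eq_intros simp: field_simps powr_minus)
  have cont: "isCont (\<lambda>t. cos (A * real p powr t) - s t) t" for t
    unfolding s_def using A p by (intro continuous_intros) auto
  have ftc: "has_bochner_integral lborel (\<lambda>t. (cos (A * real p powr t) - s t) * indicator {0..1} t) (F 1 - F 0)"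
    by (rule has_bochner_integral_FTC_Icc_real) (use der cont in auto)
  have sint: "integrable lborel (\<lambda>t. indicator {0..1} t *\<^sub>R s t)"
    by (rule borel_integrable_compact) (use A p in \<open>auto simp: s_def intro!: continuous_intros\<close>)
  have sb: "\<bar>s t\<bar> \<le> 1 / \<bar>A\<bar>" if "0 \<le> t" for t
  proof -
    have "real p powr (- t) \<le> real p powr 0" using p that by (intro powr_mono) auto
    then have "\<bar>sin (A * real p powr t)\<bar> * real p powr (- t) \<le> 1 * 1" using p by (intro mult_mono) auto
    then show ?thesis unfolding s_def using A by (simp add: abs_mult abs_divide divide_right_mono)
  qed
  have Fb: "\<bar>F t\<bar> \<le> 3 / 2 / \<bar>A\<bar>" if "0 \<le> t" for t
  proof -
    have "F t = s t / ln (real p)" unfolding F_def s_def by simp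
    then have "\<bar>F t\<bar> = \<bar>s t\<bar> / ln (real p)" using lnp by (simp add: abs_divide)
    also have "\<dots> \<le> (1 / \<bar>A\<bar>) / ln (real p)" using sb[OF that] lnp by (intro divide_right_mono) auto
    also have "\<dots> \<le> (1 / \<bar>A\<bar>) / (2 / 3)" using lnp by (intro divide_left_mono) auto
    finally show ?thesis by simp
  qed
  have "integral\<^sup>L unitU (\<lambda>t. cos (A * real p powr t)) = (\<integral>t. cos (A * real p powr t) * indicator {0..1} t \<partial>lborel)"
    by (rule integral_unitU) measurable
  also have "\<dots> = (\<integral>t. (cos (A * real p powr t) - s t) * indicator {0..1} t + indicator {0..1} t *\<^sub>R s t \<partial>lborel)"
    by (rule Bochner_Integration.integral_cong) (auto simp: algebra_simps)
  also have "\<dots> = (F 1 - F 0) + (\<integral>t. indicator {0..1} t *\<^sub>R s t \<partial>lborel)"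
    using ftc sint by (subst Bochner_Integration.integral_add) (auto simp: has_bochner_integral_iff)
  finally have eq: "integral\<^sup>L unitU (\<lambda>t. cos (A * real p powr t)) = (F 1 - F 0) + (\<integral>t. indicator {0..1} t *\<^sub>R s t \<partial>lborel)" .
  have "\<bar>\<integral>t. indicator {0..1} t *\<^sub>R s t \<partial>lborel\<bar> \<le> (\<integral>t. \<bar>indicator {0..1} t *\<^sub>R s t\<bar> \<partial>lborel)"
    by (rule integral_abs_bound)
  also have "\<dots> \<le> (\<integral>t. indicator {0..1::real} t * (1 / \<bar>A\<bar>) \<partial>lborel)"
  proof (rule integral_mono)
    show "integrable lborel (\<lambda>t. \<bar>indicator {0..1} t *\<^sub>R s t\<bar>)" using sint by auto
    show "integrable lborel (\<lambda>t. indicator {0..1::real} t * (1 / \<bar>A\<bar>))"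
      by (intro integrable_mult_left) (simp add: integrable_indicator_iff)
    show "\<bar>indicator {0..1} t *\<^sub>R s t\<bar> \<le> indicator {0..1} t * (1 / \<bar>A\<bar>)" for t
      using sb[of t] by (auto simp: indicator_def)
  qed
  also have "\<dots> = 1 / \<bar>A\<bar>" by simp
  finally have "\<bar>\<integral>t. indicator {0..1} t *\<^sub>R s t \<partial>lborel\<bar> \<le> 1 / \<bar>A\<bar>" .
  then have "\<bar>integral\<^sup>L unitU (\<lambda>t. cos (A * real p powr t))\<bar> \<le> 3 / 2 / \<bar>A\<bar> + 3 / 2 / \<bar>A\<bar> + 1 / \<bar>A\<bar>"
    using Fb[of 0] Fb[of 1] eq by (simp del: real_scaleR_def)
  also have "\<dots> = 4 / \<bar>A\<bar>" by (simp add: add_divide_distrib[symmetric])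
  finally show ?thesis .
qed

section \<open>Energy of the conditional Fourier coefficients\<close>

context digits
begin

text \<open>Real part of the Fourier coefficient of the conditional law of
  \<open>X (T\<^sup>L w)\<close> given \<open>L\<close> digits; \<open>Sc\<close> is the imaginary
  part. The frequency \<open>v\<close> is real because characters rescaled to a cell need not have
  integer frequencies.\<close>

definition Cc :: "nat \<Rightarrow> real \<Rightarrow> 'a \<Rightarrow> real" where
  "Cc L v = ce M (xi L) (\<lambda>w. cos (2 * pi * v * X ((T ^^ L) w)))"

definition Sc :: "nat \<Rightarrow> real \<Rightarrow> 'a \<Rightarrow> real" where
  "Sc L v = ce M (xi L) (\<lambda>w. sin (2 * pi * v * X ((T ^^ L) w)))"

definition energy :: "nat \<Rightarrow> real \<Rightarrow> real" where
  "energy L v = (\<integral>z. (Cc L v z)\<^sup>2 + (Sc L v z)\<^sup>2 \<partial>M)"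

lemma CS_meas [measurable]: "Cc L v \<in> borel_measurable M" "Sc L v \<in> borel_measurable M"
  unfolding Cc_def Sc_def by (rule ce_measurable[OF xi_fpart])+

lemma CS_bound: "\<bar>Cc L v z\<bar> \<le> 1" "\<bar>Sc L v z\<bar> \<le> 1"
  unfolding Cc_def Sc_def by (rule ce_bound[OF _ _ xi_fpart]; simp)+

lemma CS_Lipschitz:
  shows "\<bar>Cc L v z - Cc L u z\<bar> \<le> 2 * pi * \<bar>v - u\<bar>" "\<bar>Sc L v z - Sc L u z\<bar> \<le> 2 * pi * \<bar>v - u\<bar>"
proof -
  have *: "\<bar>2 * pi * v * X w - 2 * pi * u * X w\<bar> \<le> 2 * pi * \<bar>v - u\<bar>" for w
  proof -
    have "2 * pi * v * X w - 2 * pi * u * X w = 2 * pi * (v - u) * X w" by (simp add: algebra_simps)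
    then have "\<bar>2 * pi * v * X w - 2 * pi * u * X w\<bar> = 2 * pi * \<bar>v - u\<bar> * \<bar>X w\<bar>"
      by (simp add: abs_mult)
    also have "\<dots> \<le> 2 * pi * \<bar>v - u\<bar> * 1" using X_range[of w] by (intro mult_left_mono) auto
    finally show ?thesis by simp
  qed
  have ic: "integrable M (\<lambda>w. cos (2 * pi * v * X ((T ^^ L) w)))" for v
    by (rule integrable_bdd[where B=1]) auto
  have isn: "integrable M (\<lambda>w. sin (2 * pi * v * X ((T ^^ L) w)))" for v
    by (rule integrable_bdd[where B=1]) auto
  show "\<bar>Cc L v z - Cc L u z\<bar> \<le> 2 * pi * \<bar>v - u\<bar>"
    unfolding Cc_def by (rule ce_diff_bound[OF ic ic xi_fpart]) (auto intro: order_trans[OF abs_cos_diff_le *])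
  show "\<bar>Sc L v z - Sc L u z\<bar> \<le> 2 * pi * \<bar>v - u\<bar>"
    unfolding Sc_def by (rule ce_diff_bound[OF isn isn xi_fpart]) (auto intro: order_trans[OF abs_sin_diff_le *])
qed

lemma CS_sq_integrable: "integrable M (\<lambda>z. (Cc L v z)\<^sup>2)" "integrable M (\<lambda>z. (Sc L v z)\<^sup>2)"
  by (rule integrable_bdd[where B="1\<^sup>2"]; use abs_sq_le[OF CS_bound(1)] abs_sq_le[OF CS_bound(2)] in simp)+

lemma energy_Lipschitz: "\<bar>energy L v - energy L u\<bar> \<le> 8 * pi * \<bar>v - u\<bar>"
proof -
  have "energy L v - energy L u = (\<integral>z. ((Cc L v z)\<^sup>2 + (Sc L v z)\<^sup>2) - ((Cc L u z)\<^sup>2 + (Sc L u z)\<^sup>2) \<partial>M)"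
    unfolding energy_def by (simp add: CS_sq_integrable)
  also have "\<bar>\<dots>\<bar> \<le> 8 * pi * \<bar>v - u\<bar>"
  proof (rule integral_le_bdd)
    fix z
    show "\<bar>((Cc L v z)\<^sup>2 + (Sc L v z)\<^sup>2) - ((Cc L u z)\<^sup>2 + (Sc L u z)\<^sup>2)\<bar> \<le> 8 * pi * \<bar>v - u\<bar>"
      using sq_diff_le[OF CS_bound(1) CS_bound(1) CS_Lipschitz(1), of L v z u]
        sq_diff_le[OF CS_bound(2) CS_bound(2) CS_Lipschitz(2), of L v z u] by linarith
  qed
  finally show ?thesis .
qed

lemma energy_continuous: "continuous_on UNIV (energy L)"
proof (rule continuous_onI)
  fix v e :: real assume "e > 0"
  then show "\<exists>d>0. \<forall>u\<in>UNIV. dist u v < d \<longrightarrow> dist (energy L u) (energy L v) \<le> e"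
  proof (intro exI[of _ "e / (8 * pi)"] conjI ballI impI)
    fix u assume "dist u v < e / (8 * pi)"
    then have "8 * pi * \<bar>u - v\<bar> \<le> e" by (simp add: dist_real_def pos_less_divide_eq mult.commute less_imp_le)
    then show "dist (energy L u) (energy L v) \<le> e"
      using energy_Lipschitz[of L u v] by (simp add: dist_real_def)
  qed simp
qed

lemma energy_meas [measurable]: "energy L \<in> borel_measurable borel"
  by (rule borel_measurable_continuous_onI[OF energy_continuous])

lemma energy_bounds: "0 \<le> energy L v" "energy L v \<le> 2"
proof -
  show "0 \<le> energy L v" unfolding energy_def by (rule Bochner_Integration.integral_nonneg) simp
  have "\<bar>energy L v\<bar> \<le> 2" unfolding energy_def
  proof (rule integral_le_bdd)
    fix z show "\<bar>(Cc L v z)\<^sup>2 + (Sc L v z)\<^sup>2\<bar> \<le> 2"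
      using abs_sq_le[OF CS_bound(1), of L v z] abs_sq_le[OF CS_bound(2), of L v z] by simp
  qed
  then show "energy L v \<le> 2" by simp
qed

text \<open>The joint law of two columns drawn independently inside a common cell.\<close>

definition pairmass :: "nat \<Rightarrow> nat \<Rightarrow> int \<Rightarrow> int \<Rightarrow> real" where
  "pairmass L q c d = (\<integral>z. colprob L q c z * colprob L q d z \<partial>M)"

lemma colprob_prod_integrable: "integrable M (\<lambda>z. colprob L q c z * colprob L q d z)"
  by (rule integrable_bdd[where B=1]) (auto simp: abs_mult colprob_bounds intro!: mult_le_one)

lemma sum_colprob: "AE z in M. (\<Sum>c\<in>{0..<int p ^ q}. colprob L q c z) = 1"
  using AE_cell_pos[OF xi_fpart[of L]]
proof eventually_elim
  case (elim z)
  note [measurable] = xi_fpart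
  have "(\<Sum>c\<in>{0..<int p ^ q}. colprob L q c z)
      = ce M (xi L) (\<lambda>w. \<Sum>c\<in>{0..<int p ^ q}. of_bool (col q ((T ^^ L) w) = c)) z"
    unfolding colprob_def by (rule ce_sum[symmetric, OF _ xi_fpart]) (rule integrable_bdd[where B=1]; simp)
  also have "(\<lambda>w. \<Sum>c\<in>{0..<int p ^ q}. of_bool (col q ((T ^^ L) w) = c)) = (\<lambda>_. 1 :: real)"
    using sum_col[of q _ "\<lambda>_. 1"] by simp
  also have "ce M (xi L) (\<lambda>_. 1) z = 1"
    unfolding ce_def using elim integral_of_bool[of "\<lambda>w. xi L w = xi L z"] by simp
  finally show ?case .
qed

lemma sum_pairmass: "(\<Sum>c\<in>{0..<int p ^ q}. \<Sum>d\<in>{0..<int p ^ q}. pairmass L q c d) = 1"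
proof -
  let ?C = "{0..<int p ^ q}"
  have "(\<Sum>c\<in>?C. \<Sum>d\<in>?C. pairmass L q c d) = (\<integral>z. (\<Sum>c\<in>?C. \<Sum>d\<in>?C. colprob L q c z * colprob L q d z) \<partial>M)"
    unfolding pairmass_def by (simp add: Bochner_Integration.integral_sum colprob_prod_integrable)
  also have "\<dots> = (\<integral>z. 1 \<partial>M)"
  proof (rule integral_cong_AE)
    show "AE z in M. (\<Sum>c\<in>?C. \<Sum>d\<in>?C. colprob L q c z * colprob L q d z) = 1"
      using sum_colprob[of L q] by eventually_elim (simp add: sum_product[symmetric])
  qed measurable
  finally show ?thesis by (simp add: prob_space)
qed

lemma pairmass_nonneg: "0 \<le> pairmass L q c d"
  unfolding pairmass_def by (intro Bochner_Integration.integral_nonneg mult_nonneg_nonneg colprob_bounds)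

lemma pairmass_le: "pairmass L q c d \<le> (pairmass L q c c + pairmass L q d d) / 2"
proof -
  have "pairmass L q c d \<le> (\<integral>z. (colprob L q c z * colprob L q c z + colprob L q d z * colprob L q d z) / 2 \<partial>M)"
    unfolding pairmass_def
  proof (rule integral_mono)
    fix z
    have "0 \<le> (colprob L q c z - colprob L q d z)\<^sup>2" by simp
    then show "colprob L q c z * colprob L q d z \<le> (colprob L q c z * colprob L q c z + colprob L q d z * colprob L q d z) / 2"
      by (simp add: power2_eq_square algebra_simps)
  qed (auto intro!: colprob_prod_integrable)
  then show ?thesis unfolding pairmass_def by (simp add: colprob_prod_integrable)
qed

lemma sum_pairmass_diag: "(\<Sum>c\<in>{0..<int p ^ q}. pairmass L q c c) = Q L q"
  using sum_colprob_sq[of L q] by (simp add: pairmass_def power2_eq_square)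

text \<open>A near-diagonal entry is at most the mean of two diagonal ones, each row has at most
  \<open>2 * H + 1\<close> of them, and the diagonal sums to \<open>Q L q\<close>.\<close>

lemma near_diagonal_le:
  fixes H :: nat
  shows "(\<Sum>c\<in>{0..<int p ^ q}. \<Sum>d\<in>{0..<int p ^ q}. of_bool (\<bar>c - d\<bar> \<le> int H) * pairmass L q c d)
    \<le> real (2 * H + 1) * Q L q"
proof -
  let ?C = "{0..<int p ^ q}"
  let ?n = "\<lambda>c d. of_bool (\<bar>c - d\<bar> \<le> int H) :: real"
  have cnt: "(\<Sum>d\<in>?C. ?n c d) \<le> real (2 * H + 1)" for c
  proof -
    have "(\<Sum>d\<in>?C. ?n c d) = real (card {d\<in>?C. \<bar>c - d\<bar> \<le> int H})" by (simp add: sum.If_cases of_bool_def Int_def)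
    also have "card {d\<in>?C. \<bar>c - d\<bar> \<le> int H} \<le> card {c - int H..c + int H}"
      by (rule card_mono) auto
    also have "card {c - int H..c + int H} = 2 * H + 1" by simp
    finally show ?thesis by simp
  qed
  have "(\<Sum>c\<in>?C. \<Sum>d\<in>?C. ?n c d * pairmass L q c d)
      \<le> (\<Sum>c\<in>?C. \<Sum>d\<in>?C. ?n c d * ((pairmass L q c c + pairmass L q d d) / 2))"
    by (intro sum_mono mult_left_mono pairmass_le) simp
  also have "\<dots> = ((\<Sum>c\<in>?C. \<Sum>d\<in>?C. ?n c d * pairmass L q c c) + (\<Sum>c\<in>?C. \<Sum>d\<in>?C. ?n c d * pairmass L q d d)) / 2"
    by (simp only: times_divide_eq_right distrib_left add_divide_distrib sum.distrib sum_divide_distrib)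
  also have "(\<Sum>c\<in>?C. \<Sum>d\<in>?C. ?n c d * pairmass L q d d) = (\<Sum>c\<in>?C. \<Sum>d\<in>?C. ?n c d * pairmass L q c c)"
    by (subst sum.swap) (simp add: abs_minus_commute)
  also have "(\<Sum>c\<in>?C. \<Sum>d\<in>?C. ?n c d * pairmass L q c c) = (\<Sum>c\<in>?C. (\<Sum>d\<in>?C. ?n c d) * pairmass L q c c)"
    by (simp add: sum_distrib_right)
  also have "\<dots> \<le> (\<Sum>c\<in>?C. real (2 * H + 1) * pairmass L q c c)"
    by (intro sum_mono mult_right_mono cnt pairmass_nonneg)
  also have "\<dots> = real (2 * H + 1) * Q L q" by (simp only: sum_distrib_left[symmetric] sum_pairmass_diag)
  finally show ?thesis by (simp add: mult.commute)
qed

lemma ce_col: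
  "ce M (xi L) (\<lambda>w. F (col q ((T ^^ L) w))) z = (\<Sum>c\<in>{0..<int p ^ q}. colprob L q c z * F c)"
proof -
  have "ce M (xi L) (\<lambda>w. F (col q ((T ^^ L) w))) z
      = ce M (xi L) (\<lambda>w. \<Sum>c\<in>{0..<int p ^ q}. of_bool (col q ((T ^^ L) w) = c) * F c) z"
    unfolding sum_col by (rule refl)
  also have "\<dots> = (\<Sum>c\<in>{0..<int p ^ q}. ce M (xi L) (\<lambda>w. of_bool (col q ((T ^^ L) w) = c) * F c) z)"
    by (rule ce_sum[OF _ xi_fpart]) (rule integrable_of_bool; simp)
  also have "\<dots> = (\<Sum>c\<in>{0..<int p ^ q}. colprob L q c z * F c)"
    unfolding colprob_def
    using ce_pull_out[OF depends_on_const, of M "xi L"] by (simp add: mult.commute)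
  finally show ?thesis .
qed

text \<open>The coordinate at time \<open>L\<close> is replaced by the left end of its column, which
  moves the phase by at most \<open>?h = 2 * pi * v / p ^ q\<close>; each of the two squares then
  changes by at most \<open>2 * ?h\<close>. What is left is the squared modulus of an exponential
  sum, expanded into pairs of columns.\<close>

lemma energy_le:
  assumes "0 \<le> v"
  shows "energy L v \<le> 8 * pi * v / real p ^ q +
    (\<Sum>c\<in>{0..<int p ^ q}. \<Sum>d\<in>{0..<int p ^ q}. pairmass L q c d * cos (2 * pi * v / real p ^ q * real_of_int (c - d)))"
proof -
  let ?C = "{0..<int p ^ q}"
  let ?h = "2 * pi * v / real p ^ q"
  let ?fc = "\<lambda>w. cos (?h * real_of_int (col q ((T ^^ L) w)))"
  let ?fs = "\<lambda>w. sin (?h * real_of_int (col q ((T ^^ L) w)))"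
  let ?C' = "\<lambda>z. \<Sum>c\<in>?C. colprob L q c z * cos (?h * real_of_int c)"
  let ?S' = "\<lambda>z. \<Sum>c\<in>?C. colprob L q c z * sin (?h * real_of_int c)"
  have pq: "real p ^ q > 0" using p2 by simp
  have arg: "\<bar>2 * pi * v * X w - ?h * real_of_int (col q w)\<bar> \<le> ?h" for w
  proof -
    have "2 * pi * v * X w - ?h * real_of_int (col q w) = ?h * frac (real p ^ q * X w)"
      unfolding col_def frac_def using pq by (simp add: field_simps)
    also have "\<bar>\<dots>\<bar> \<le> ?h * 1"
      unfolding abs_mult using assms pq frac_lt_1[of "real p ^ q * X w"] by (intro mult_mono) auto
    finally show ?thesis by simp
  qed
  have h0: "0 \<le> ?h" using assms pq by simp
  have cc: "?C' z = ce M (xi L) ?fc z" for z using ce_col[of L "\<lambda>c. cos (?h * real_of_int c)" q z] by simp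
  have ss: "?S' z = ce M (xi L) ?fs z" for z using ce_col[of L "\<lambda>c. sin (?h * real_of_int c)" q z] by simp
  have mc [measurable]: "?fc \<in> borel_measurable M" "?fs \<in> borel_measurable M" by measurable
  have ic: "integrable M (\<lambda>w. cos (2 * pi * v * X ((T ^^ L) w)))" "integrable M (\<lambda>w. sin (2 * pi * v * X ((T ^^ L) w)))"
    "integrable M ?fc" "integrable M ?fs"
    by (rule integrable_bdd[where B=1]; simp)+
  have b: "\<bar>?C' z\<bar> \<le> 1" "\<bar>?S' z\<bar> \<le> 1" for z
    unfolding cc ss by (rule ce_bound[OF _ _ xi_fpart]; simp)+
  have d: "\<bar>Cc L v z - ?C' z\<bar> \<le> ?h" "\<bar>Sc L v z - ?S' z\<bar> \<le> ?h" for z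
  proof -
    show "\<bar>Cc L v z - ?C' z\<bar> \<le> ?h"
      unfolding cc Cc_def by (rule ce_diff_bound[OF ic(1) ic(3) xi_fpart h0]) (rule order_trans[OF abs_cos_diff_le arg])
    show "\<bar>Sc L v z - ?S' z\<bar> \<le> ?h"
      unfolding ss Sc_def by (rule ce_diff_bound[OF ic(2) ic(4) xi_fpart h0]) (rule order_trans[OF abs_sin_diff_le arg])
  qed
  have sq: "(?C' z)\<^sup>2 + (?S' z)\<^sup>2 = (\<Sum>c\<in>?C. \<Sum>d\<in>?C. colprob L q c z * colprob L q d z * cos (?h * real_of_int (c - d)))" for z
  proof -
    have "cos (?h * real_of_int (c - d)) = cos (?h * real_of_int c) * cos (?h * real_of_int d)
        + sin (?h * real_of_int c) * sin (?h * real_of_int d)" for c d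
      by (simp only: of_int_diff right_diff_distrib cos_diff)
    then show ?thesis
      by (simp only: power2_eq_square sum_product sum.distrib[symmetric]) (intro sum.cong refl, simp add: algebra_simps)
  qed
  have intt: "integrable M (\<lambda>z. colprob L q c z * colprob L q d z * cos (?h * real_of_int (c - d)))" for c d
    by (intro integrable_mult_left colprob_prod_integrable)
  have "energy L v \<le> (\<integral>z. 4 * ?h + ((?C' z)\<^sup>2 + (?S' z)\<^sup>2) \<partial>M)"
    unfolding energy_def
  proof (rule integral_mono)
    show "integrable M (\<lambda>z. (Cc L v z)\<^sup>2 + (Sc L v z)\<^sup>2)" by (simp add: CS_sq_integrable)
    show "integrable M (\<lambda>z. 4 * ?h + ((?C' z)\<^sup>2 + (?S' z)\<^sup>2))"
      unfolding sq by (intro Bochner_Integration.integrable_add Bochner_Integration.integrable_sum intt) simp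
    fix z show "(Cc L v z)\<^sup>2 + (Sc L v z)\<^sup>2 \<le> 4 * ?h + ((?C' z)\<^sup>2 + (?S' z)\<^sup>2)"
      using sq_diff_le[OF CS_bound(1) b(1) d(1), of z] sq_diff_le[OF CS_bound(2) b(2) d(2), of z] by linarith
  qed
  also have "\<dots> = 4 * ?h + (\<Sum>c\<in>?C. \<Sum>d\<in>?C. \<integral>z. colprob L q c z * colprob L q d z * cos (?h * real_of_int (c - d)) \<partial>M)"
  proof -
    let ?t = "\<lambda>c d z. colprob L q c z * colprob L q d z * cos (?h * real_of_int (c - d))"
    have "(\<integral>z. 4 * ?h + (\<Sum>c\<in>?C. \<Sum>d\<in>?C. ?t c d z) \<partial>M) = (\<integral>z. 4 * ?h \<partial>M) + (\<integral>z. (\<Sum>c\<in>?C. \<Sum>d\<in>?C. ?t c d z) \<partial>M)"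
      by (rule Bochner_Integration.integral_add) (simp, intro Bochner_Integration.integrable_sum intt)
    also have "(\<integral>z. (\<Sum>c\<in>?C. \<Sum>d\<in>?C. ?t c d z) \<partial>M) = (\<Sum>c\<in>?C. \<integral>z. (\<Sum>d\<in>?C. ?t c d z) \<partial>M)"
      by (rule Bochner_Integration.integral_sum) (intro Bochner_Integration.integrable_sum intt)
    also have "\<dots> = (\<Sum>c\<in>?C. \<Sum>d\<in>?C. \<integral>z. ?t c d z \<partial>M)"
      by (intro sum.cong refl Bochner_Integration.integral_sum intt)
    finally show ?thesis unfolding sq by (simp add: prob_space)
  qed
  finally show ?thesis unfolding pairmass_def integral_mult_left_zero by (simp add: mult.assoc)
qed

text \<open>Averaging over the logarithmic scale suppresses all pairs of columns at distance more
  than \<open>H\<close>, and the remaining pairs have total mass at most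
  \<open>(2 * H + 1) * Q L q\<close>. As \<open>Q\<close> is small uniformly in \<open>L\<close>,
  one \<open>v\<close> serves all levels.\<close>

lemma energy_log_average:
  assumes NA: "\<And>e. e > 0 \<Longrightarrow> \<exists>q. \<forall>K. Q K q \<le> e" and e: "e > 0"
  shows "\<exists>v>0. \<forall>L. integral\<^sup>L unitU (\<lambda>t. energy L (v * real p powr t)) \<le> e"
proof -
  interpret U: prob_space unitU by (rule prob_space_unitU)
  have pp: "real p > 0" using p2 by simp
  \<comment> \<open>The discretisation error at the top of the scale is then
    \<open>8 * pi * \<epsilon> * p = e / 3\<close>.\<close>
  define \<epsilon> where "\<epsilon> = e / (24 * pi * real p)"
  have \<epsilon>: "\<epsilon> > 0" using e pp by (simp add: \<epsilon>_def)
  obtain H0 :: nat where H0: "real H0 > 3 / (\<epsilon> * e)" using reals_Archimedean2 by blast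
  define H where "H = Suc H0"
  have H: "real H > 3 / (\<epsilon> * e)" "H > 0" using H0 unfolding H_def by auto
  have "e / (3 * real (2 * H + 1)) > 0" using e by simp
  then obtain q where q: "\<And>K. Q K q \<le> e / (3 * real (2 * H + 1))" using NA by blast
  \<comment> \<open>Proportional to \<open>p ^ q\<close>, so that a pair of columns oscillates with
    frequency \<open>\<epsilon> * (c - d)\<close>, independent of \<open>q\<close>; this is why
    \<open>H\<close> could be fixed before \<open>q\<close>.\<close>
  define v where "v = \<epsilon> * real p ^ q"
  have v: "v > 0" using \<epsilon> pp by (simp add: v_def)
  let ?C = "{0..<int p ^ q}"
  have "integral\<^sup>L unitU (\<lambda>t. energy L (v * real p powr t)) \<le> e" for L
  proof -
    let ?c = "\<lambda>c d t. cos (2 * pi * \<epsilon> * real_of_int (c - d) * real p powr t)"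
    have intc: "integrable unitU (?c c d)" for c d
      by (rule U.integrable_bdd[where B=1]; (rule measurable_unitU, measurable)?) simp
    have ub: "energy L (v * real p powr t) \<le> e / 3 + (\<Sum>c\<in>?C. \<Sum>d\<in>?C. pairmass L q c d * ?c c d t)"
      if t: "t \<in> {0..<1}" for t
    proof -
      have vt: "2 * pi * (v * real p powr t) / real p ^ q * real_of_int (c - d) = 2 * pi * \<epsilon> * real_of_int (c - d) * real p powr t" for c d
        using pp by (simp add: v_def)
      have "8 * pi * (v * real p powr t) / real p ^ q = 8 * pi * \<epsilon> * real p powr t"
        using pp by (simp add: v_def)
      also have "\<dots> \<le> 8 * pi * \<epsilon> * real p powr 1" using t \<epsilon> p2 by (intro mult_left_mono powr_mono) auto
      also have "\<dots> = e / 3" using pp by (simp add: \<epsilon>_def)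
      finally have "8 * pi * (v * real p powr t) / real p ^ q \<le> e / 3" .
      then show ?thesis using energy_le[of "v * real p powr t" L q] v pp unfolding vt by simp
    qed
    have "integral\<^sup>L unitU (\<lambda>t. energy L (v * real p powr t))
        \<le> integral\<^sup>L unitU (\<lambda>t. e / 3 + (\<Sum>c\<in>?C. \<Sum>d\<in>?C. pairmass L q c d * ?c c d t))"
    proof (rule integral_mono)
      show "integrable unitU (\<lambda>t. energy L (v * real p powr t))"
      proof (rule U.integrable_bdd[where B=2])
        show "(\<lambda>t. energy L (v * real p powr t)) \<in> borel_measurable unitU"
          by (rule measurable_unitU) measurable
        show "\<bar>energy L (v * real p powr t)\<bar> \<le> 2" for t using energy_bounds[of L "v * real p powr t"] by simp
      qed
      show "integrable unitU (\<lambda>t. e / 3 + (\<Sum>c\<in>?C. \<Sum>d\<in>?C. pairmass L q c d * ?c c d t))"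
        by (intro Bochner_Integration.integrable_add Bochner_Integration.integrable_sum
            integrable_mult_right intc) simp
    qed (use ub in auto)
    also have "\<dots> = e / 3 + (\<Sum>c\<in>?C. \<Sum>d\<in>?C. pairmass L q c d * integral\<^sup>L unitU (?c c d))"
    proof -
      have i1: "integrable unitU (\<lambda>t. pairmass L q c d * ?c c d t)" for c d by (intro integrable_mult_right intc)
      have "integral\<^sup>L unitU (\<lambda>t. e / 3 + (\<Sum>c\<in>?C. \<Sum>d\<in>?C. pairmass L q c d * ?c c d t))
        = integral\<^sup>L unitU (\<lambda>t. e / 3) + integral\<^sup>L unitU (\<lambda>t. \<Sum>c\<in>?C. \<Sum>d\<in>?C. pairmass L q c d * ?c c d t)"
        by (rule Bochner_Integration.integral_add) (simp, intro Bochner_Integration.integrable_sum i1)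
      also have "integral\<^sup>L unitU (\<lambda>t. \<Sum>c\<in>?C. \<Sum>d\<in>?C. pairmass L q c d * ?c c d t)
        = (\<Sum>c\<in>?C. integral\<^sup>L unitU (\<lambda>t. \<Sum>d\<in>?C. pairmass L q c d * ?c c d t))"
        by (rule Bochner_Integration.integral_sum) (intro Bochner_Integration.integrable_sum i1)
      also have "\<dots> = (\<Sum>c\<in>?C. \<Sum>d\<in>?C. integral\<^sup>L unitU (\<lambda>t. pairmass L q c d * ?c c d t))"
        by (intro sum.cong refl Bochner_Integration.integral_sum i1)
      finally show ?thesis using U.prob_space by simp
    qed
    also have "(\<Sum>c\<in>?C. \<Sum>d\<in>?C. pairmass L q c d * integral\<^sup>L unitU (?c c d))
        \<le> (\<Sum>c\<in>?C. \<Sum>d\<in>?C. of_bool (\<bar>c - d\<bar> \<le> int H) * pairmass L q c d + pairmass L q c d * (e / 3))"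
    proof (intro sum_mono)
      fix c d
      show "pairmass L q c d * integral\<^sup>L unitU (?c c d) \<le> of_bool (\<bar>c - d\<bar> \<le> int H) * pairmass L q c d + pairmass L q c d * (e / 3)"
      proof (cases "\<bar>c - d\<bar> \<le> int H")
        case True
        have "\<bar>integral\<^sup>L unitU (?c c d)\<bar> \<le> 1" by (rule U.integral_le_bdd) simp
        then have "pairmass L q c d * integral\<^sup>L unitU (?c c d) \<le> pairmass L q c d * 1"
          by (intro mult_left_mono pairmass_nonneg) simp
        then show ?thesis using True e pairmass_nonneg[of L q c d] by (simp add: add_increasing2)
      next
        case False
        let ?A = "2 * pi * \<epsilon> * real_of_int (c - d)"
        have cd: "real H \<le> \<bar>real_of_int (c - d)\<bar>" using False by linarith
        then have A: "?A \<noteq> 0" using \<epsilon> H(2) by auto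
        have "integral\<^sup>L unitU (?c c d) \<le> 4 / \<bar>?A\<bar>"
          using log_scale_oscillation[OF p2 A] by (simp only: abs_le_iff)
        also have "\<dots> \<le> 1 / (\<epsilon> * real H)"
        proof -
          have "4 * (\<epsilon> * real H) \<le> 2 * pi * (\<epsilon> * real H)" using pi_gt3 \<epsilon> by (intro mult_right_mono) auto
          also have "\<dots> \<le> 2 * pi * (\<epsilon> * \<bar>real_of_int (c - d)\<bar>)" using cd \<epsilon> by (intro mult_left_mono) auto
          also have "\<dots> = \<bar>?A\<bar>" using \<epsilon> by (simp add: abs_mult)
          finally show ?thesis using A \<epsilon> H(2) by (simp add: divide_le_eq le_divide_eq)
        qed
        also have "\<dots> \<le> e / 3" using H \<epsilon> e by (simp add: field_simps)
        finally have "pairmass L q c d * integral\<^sup>L unitU (?c c d) \<le> pairmass L q c d * (e / 3)"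
          by (intro mult_left_mono pairmass_nonneg)
        then show ?thesis using False by simp
      qed
    qed
    also have "\<dots> = (\<Sum>c\<in>?C. \<Sum>d\<in>?C. of_bool (\<bar>c - d\<bar> \<le> int H) * pairmass L q c d) + (\<Sum>c\<in>?C. \<Sum>d\<in>?C. pairmass L q c d) * (e / 3)"
      by (simp add: sum.distrib sum_distrib_right)
    also have "\<dots> \<le> real (2 * H + 1) * Q L q + e / 3"
      using near_diagonal_le[of H L q] sum_pairmass[of L q] by simp
    also have "real (2 * H + 1) * Q L q \<le> e / 3" using q[of L] by (simp add: field_simps)
    finally show ?thesis by simp
  qed
  then show ?thesis using v by blast
qed

end

section \<open>The suspension flow\<close>

lemma frac_plus_of_int: "frac (x + of_int n) = frac x"
  unfolding frac_def floor_add_int[symmetric] by simp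

lemma sets_unitU_borel: "A \<in> sets unitU \<Longrightarrow> A \<in> sets borel \<and> A \<subseteq> {0..<1}"
  unfolding unitU_def by (auto simp: sets_restrict_space)

lemma emeasure_unitU: "A \<in> sets borel \<Longrightarrow> A \<subseteq> {0..<1} \<Longrightarrow> emeasure unitU A = emeasure lborel A"
  unfolding unitU_def by (subst emeasure_restrict_space) auto

lemma frac_measurable_unitU: "(\<lambda>s. frac (s + r)) \<in> unitU \<rightarrow>\<^sub>M unitU"
  unfolding unitU_def
  unfolding frac_def
  by (rule measurable_restrict_space2) (auto simp: frac_lt_1[unfolded frac_def] intro!: measurable_restrict_space1)

lemma emeasure_lborel_translate:
  assumes [measurable]: "A \<in> sets borel"
  shows "emeasure lborel {s. s + c \<in> A} = emeasure lborel (A :: real set)"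
proof -
  have "emeasure lborel A = emeasure (distr lborel borel ((+) c)) A" by (simp add: lborel_distr_plus)
  also have "\<dots> = emeasure lborel ((+) c -` A \<inter> space lborel)" by (rule emeasure_distr) auto
  also have "(+) c -` A \<inter> space lborel = {s. s + c \<in> A}" by (auto simp: add.commute)
  finally show ?thesis by simp
qed

lemma rotation_invariant: "distr unitU unitU (\<lambda>s. frac (s + r)) = unitU"
proof (rule measure_eqI)
  fix A assume "A \<in> sets (distr unitU unitU (\<lambda>s. frac (s + r)))"
  then have AU: "A \<in> sets unitU" by simp
  then have A [measurable]: "A \<in> sets borel" and A01: "A \<subseteq> {0..<1}" using sets_unitU_borel by auto
  define c where "c = frac r"
  have c: "0 \<le> c" "c < 1" by (auto simp: c_def frac_lt_1)
  have fr: "frac (s + r) = (if s < 1 - c then s + c else s + (c - 1))" if "s \<in> {0..<1}" for s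
  proof -
    have 1: "frac (s + r) = frac (s + c)"
    proof -
      have "s + r = (s + c) + of_int \<lfloor>r\<rfloor>" by (simp add: c_def frac_def)
      then show ?thesis by (simp only: frac_plus_of_int)
    qed

    show ?thesis
    proof (cases "s < 1 - c")
      case True
      then have "frac (s + c) = s + c" using that c by (simp add: frac_eq)
      then show ?thesis using 1 True by simp
    next
      case False
      then have "frac (s + (c - 1)) = s + (c - 1)" using that c by (simp add: frac_eq)
      moreover have "frac (s + c) = frac (s + (c - 1))" using frac_1_eq[of "s + (c - 1)"] by simp
      ultimately show ?thesis using 1 False by simp
    qed
  qed
  \<comment> \<open>The rotation by \<open>c\<close> moves \<open>[0, 1 - c)\<close> up by
    \<open>c\<close> and the rest down by \<open>1 - c\<close>; these are the preimages of the parts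
    of \<open>A\<close> above and below \<open>c\<close>.\<close>
  let ?A1 = "{s. s + c \<in> A \<inter> {c..<1}}" and ?A2 = "{s. s + (c - 1) \<in> A \<inter> {0..<c}}"
  have "(\<lambda>s. frac (s + r)) -` A \<inter> space unitU = ?A1 \<union> ?A2"
    using A01 c by (auto simp: fr split: if_splits)
  then have "emeasure (distr unitU unitU (\<lambda>s. frac (s + r))) A = emeasure unitU (?A1 \<union> ?A2)"
    using emeasure_distr[OF frac_measurable_unitU AU] by simp
  also have "\<dots> = emeasure lborel (?A1 \<union> ?A2)"
  proof (rule emeasure_unitU)
    show "?A1 \<union> ?A2 \<in> sets borel" by measurable
    show "?A1 \<union> ?A2 \<subseteq> {0..<1}"
    proof
      fix s assume "s \<in> ?A1 \<union> ?A2"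
      then have "s + c \<in> {c..<1} \<or> s + (c - 1) \<in> {0..<c}" by blast
      then show "s \<in> {0..<1}" using c unfolding atLeastLessThan_iff by linarith
    qed
  qed
  also have "\<dots> = emeasure lborel ?A1 + emeasure lborel ?A2"
  proof (rule plus_emeasure[symmetric])
    show "?A1 \<inter> ?A2 = {}"
    proof (rule equals0I)
      fix s assume "s \<in> ?A1 \<inter> ?A2"
      then have "s + c \<in> {c..<1}" "s + (c - 1) \<in> {0..<c}" by blast+
      then show False unfolding atLeastLessThan_iff by linarith
    qed
  qed measurable
  also have "\<dots> = emeasure lborel (A \<inter> {c..<1}) + emeasure lborel (A \<inter> {0..<c})"
    by (subst (1 2) emeasure_lborel_translate) auto
  also have "\<dots> = emeasure lborel ((A \<inter> {c..<1}) \<union> (A \<inter> {0..<c}))"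
    by (rule plus_emeasure) auto
  also have "(A \<inter> {c..<1}) \<union> (A \<inter> {0..<c}) = A" using A01 c by auto
  finally show "emeasure (distr unitU unitU (\<lambda>s. frac (s + r))) A = emeasure unitU A"
    using emeasure_unitU[OF A A01] by simp
qed simp

context mpt
begin

abbreviation PM :: "('a \<times> real) measure" where "PM \<equiv> M \<Otimes>\<^sub>M unitU"

text \<open>Time-\<open>\<beta>\<close> map of the suspension flow over \<open>T\<close> with constant roof \<open>1\<close>.\<close>

definition flow :: "real \<Rightarrow> 'a \<times> real \<Rightarrow> 'a \<times> real" where
  "flow \<beta> z = ((T ^^ nat \<lfloor>snd z + \<beta>\<rfloor>) (fst z), frac (snd z + \<beta>))"

lemma snd_borel [measurable]: "snd \<in> borel_measurable PM"
proof -
  have "(\<lambda>s. s) \<in> borel_measurable unitU" by (rule measurable_unitU) measurable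
  then show ?thesis using measurable_compose[OF measurable_snd] by blast
qed

lemma T_joint_measurable:
  assumes [measurable]: "n \<in> PM \<rightarrow>\<^sub>M count_space (UNIV :: nat set)"
  shows "(\<lambda>z. (T ^^ n z) (fst z)) \<in> PM \<rightarrow>\<^sub>M M"
  by (rule measurable_compose_countable[where f="\<lambda>n z. (T ^^ n) (fst z)"]) measurable

lemma flow_measurable [measurable]: "flow \<beta> \<in> PM \<rightarrow>\<^sub>M PM"
proof -
  have 1: "(\<lambda>z. (T ^^ nat \<lfloor>snd z + \<beta>\<rfloor>) (fst z)) \<in> PM \<rightarrow>\<^sub>M M" by (rule T_joint_measurable) measurable
  have 2: "(\<lambda>z. frac (snd z + \<beta>)) \<in> PM \<rightarrow>\<^sub>M unitU"
    using measurable_compose[OF measurable_snd frac_measurable_unitU[of \<beta>]] by blast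
  show ?thesis unfolding flow_def using measurable_Pair[OF 1 2] by simp
qed

lemma prob_space_PM: "prob_space PM"
proof -
  interpret U: prob_space unitU by (rule prob_space_unitU)
  interpret pair_prob_space M unitU ..
  show ?thesis by (rule prob_space_axioms)
qed

lemma mpt_flow: "mpt PM (flow \<beta>)"
proof -
  interpret U: prob_space unitU by (rule prob_space_unitU)
  interpret P: pair_sigma_finite M unitU ..
  interpret PP: prob_space PM by (rule prob_space_PM)
  show ?thesis
  proof
    show "flow \<beta> \<in> PM \<rightarrow>\<^sub>M PM" by (rule flow_measurable)
    show "distr PM PM (flow \<beta>) = PM"
    proof (rule measure_eqI)
      fix A assume "A \<in> sets (distr PM PM (flow \<beta>))"
      then have A [measurable]: "A \<in> sets PM" by simp
      let ?H = "\<lambda>s. \<integral>\<^sup>+w. indicator A (w, s) \<partial>M"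
      have Hm: "?H \<in> borel_measurable unitU" by measurable
      have "emeasure (distr PM PM (flow \<beta>)) A = (\<integral>\<^sup>+z. indicator A z \<partial>distr PM PM (flow \<beta>))" by simp
      also have "\<dots> = (\<integral>\<^sup>+z. indicator A (flow \<beta> z) \<partial>PM)" by (rule nn_integral_distr) measurable
      also have "\<dots> = (\<integral>\<^sup>+s. \<integral>\<^sup>+w. indicator A (flow \<beta> (w, s)) \<partial>M \<partial>unitU)"
        by (rule P.nn_integral_snd[symmetric]) measurable
      also have "\<dots> = (\<integral>\<^sup>+s. ?H (frac (s + \<beta>)) \<partial>unitU)"
      proof (rule nn_integral_cong)
        fix s assume "s \<in> space unitU"
        then have "frac (s + \<beta>) \<in> space unitU" by (simp add: frac_lt_1)
        then have "(\<lambda>w. (w, frac (s + \<beta>))) \<in> M \<rightarrow>\<^sub>M PM" by measurable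
        then have [measurable]: "(\<lambda>w. indicator A (w, frac (s + \<beta>)) :: ennreal) \<in> borel_measurable M"
          by (rule measurable_compose) measurable
        show "(\<integral>\<^sup>+w. indicator A (flow \<beta> (w, s)) \<partial>M) = ?H (frac (s + \<beta>))"
          unfolding flow_def using nn_integral_Tn[of "\<lambda>w. indicator A (w, frac (s + \<beta>))"] by simp
      qed
      also have "\<dots> = (\<integral>\<^sup>+s. ?H s \<partial>distr unitU unitU (\<lambda>s. frac (s + \<beta>)))"
        by (rule nn_integral_distr[symmetric, OF frac_measurable_unitU]) (use Hm in simp)
      also have "\<dots> = (\<integral>\<^sup>+s. ?H s \<partial>unitU)" by (simp only: rotation_invariant)
      also have "\<dots> = (\<integral>\<^sup>+z. indicator A z \<partial>PM)" by (rule P.nn_integral_snd) measurable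
      also have "\<dots> = emeasure PM A" by simp
      finally show "emeasure (distr PM PM (flow \<beta>)) A = emeasure PM A" .
    qed simp
  qed
qed

lemma flow_iter:
  assumes "0 \<le> s" "s < 1" "0 \<le> \<beta>"
  shows "(flow \<beta> ^^ k) (w, s) = ((T ^^ nat \<lfloor>s + real k * \<beta>\<rfloor>) w, frac (s + real k * \<beta>))"
proof (induction k)
  case 0
  then show ?case using assms by (simp add: frac_eq floor_eq_iff nat_eq_iff)
next
  case (Suc k)
  let ?a = "s + real k * \<beta>"
  have a: "?a + \<beta> = s + real (Suc k) * \<beta>" by (simp add: algebra_simps)
  have fl: "\<lfloor>frac ?a + \<beta>\<rfloor> = \<lfloor>s + real (Suc k) * \<beta>\<rfloor> - \<lfloor>?a\<rfloor>"
  proof -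
    have "frac ?a + \<beta> = (?a + \<beta>) - of_int \<lfloor>?a\<rfloor>" by (simp add: frac_def)
    then show ?thesis unfolding a by (simp only: floor_diff_of_int)
  qed
  have fr: "frac (frac ?a + \<beta>) = frac (s + real (Suc k) * \<beta>)"
  proof -
    have "frac ?a + \<beta> + of_int \<lfloor>?a\<rfloor> = ?a + \<beta>" by (simp add: frac_def)
    then show ?thesis unfolding a using frac_plus_of_int[of "frac ?a + \<beta>" "\<lfloor>?a\<rfloor>"] by (simp only:)
  qed
  have "0 \<le> \<lfloor>?a\<rfloor>" "0 \<le> \<lfloor>frac ?a + \<beta>\<rfloor>" using assms by auto
  then have "nat \<lfloor>s + real (Suc k) * \<beta>\<rfloor> = nat \<lfloor>frac ?a + \<beta>\<rfloor> + nat \<lfloor>?a\<rfloor>" using fl by linarith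
  then show ?case using Suc fr by (simp add: flow_def funpow_add)
qed

text \<open>The maximal inequality for the product measure becomes a statement about single phases
  by Markov's inequality in \<open>s\<close>. The set \<open>B\<close> depends on \<open>N\<close>,
  an obstacle that \<open>good_phase\<close> has to overcome.\<close>

lemma flow_slices:
  fixes h :: "'a \<times> real \<Rightarrow> real"
  assumes h [measurable]: "h \<in> borel_measurable PM" and h01: "\<And>z. h z \<in> {0..1}"
    and eta: "\<And>s. s \<in> {0..<1} \<Longrightarrow> (\<integral>w. h (w, s) \<partial>M) \<le> F s" and F: "integrable unitU F" "integral\<^sup>L unitU F \<le> \<eta>"
    and \<beta>: "0 \<le> \<beta>" and l: "0 < l" and c: "0 < c"
  obtains B where "B \<in> sets borel" "B \<subseteq> {0..<1}" "measure lborel B \<le> \<eta> / (l * c)"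
    "\<And>s. s \<in> {0..<1} - B \<Longrightarrow> prob {w \<in> space M. \<exists>n\<in>{1..N}.
       (\<Sum>k<n. h ((T ^^ nat \<lfloor>s + real k * \<beta>\<rfloor>) w, frac (s + real k * \<beta>))) > l * real n} \<le> c"
proof -
  interpret U: prob_space unitU by (rule prob_space_unitU)
  interpret P: pair_sigma_finite M unitU ..
  interpret fl: mpt PM "flow \<beta>" by (rule mpt_flow)
  have hint: "integrable PM h" by (rule fl.integrable_bdd[where B=1]) (use h01 in \<open>auto simp: abs_le_iff intro: order_trans[of _ 0]\<close>)
  define D where "D = {z \<in> space PM. \<exists>n\<in>{1..N}. (\<Sum>k<n. h ((flow \<beta> ^^ k) z)) > l * real n}"
  have [measurable]: "D \<in> sets PM" unfolding D_def by measurable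
  have "l * measure PM D \<le> integral\<^sup>L PM h"
    unfolding D_def by (rule fl.maximal_weak_type[OF hint]) (use h01 in auto)
  also have "integral\<^sup>L PM h = (\<integral>s. \<integral>w. h (w, s) \<partial>M \<partial>unitU)"
    using P.integral_snd[of "\<lambda>w s. h (w, s)"] hint by simp
  also have "\<dots> \<le> integral\<^sup>L unitU F"
  proof (rule integral_mono)
    show "integrable unitU (\<lambda>s. \<integral>w. h (w, s) \<partial>M)"
      by (rule P.integrable_snd) (use hint in simp)
  qed (use F eta in auto)
  finally have lD: "l * measure PM D \<le> \<eta>" using F by simp
  define S where "S s = {w \<in> space M. (w, s) \<in> D}" for s
  define Pi where "Pi s = measure M (S s)" for s
  have Sm [measurable]: "S s \<in> sets M" if "s \<in> space unitU" for s
  proof -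
    have [measurable]: "(\<lambda>w. (w, s)) \<in> M \<rightarrow>\<^sub>M PM" using that by measurable
    show ?thesis unfolding S_def by measurable
  qed
  have Seq: "S s = {w \<in> space M. \<exists>n\<in>{1..N}.
       (\<Sum>k<n. h ((T ^^ nat \<lfloor>s + real k * \<beta>\<rfloor>) w, frac (s + real k * \<beta>))) > l * real n}" if "s \<in> {0..<1}" for s
    unfolding S_def D_def using that \<beta> by (auto simp: flow_iter space_pair_measure)
  have Pi_int: "(\<integral>w. indicator D (w, s) \<partial>M :: real) = Pi s" if "s \<in> space unitU" for s
  proof -
    have "(\<integral>w. indicator D (w, s) \<partial>M :: real) = (\<integral>w. indicator (S s) w \<partial>M)"
      by (rule Bochner_Integration.integral_cong) (auto simp: S_def indicator_def)
    then show ?thesis using sets.sets_into_space[OF Sm[OF that]] by (simp add: Pi_def Int_absorb2)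
  qed
  have Dint: "integrable PM (indicator D :: _ \<Rightarrow> real)" by (rule fl.integrable_bdd[where B=1]) (auto simp: indicator_def)
  have PiD: "integrable unitU (\<lambda>s. \<integral>w. indicator D (w, s) \<partial>M :: real)"
    by (rule P.integrable_snd) (use Dint in simp)
  have PiI: "integrable unitU Pi" using PiD by (rule Bochner_Integration.integrable_cong[THEN iffD1, rotated 2]) (auto simp: Pi_int)
  have "measure PM D = (\<integral>z. indicator D z \<partial>PM)" using sets.sets_into_space[of D PM] by (simp add: Int_absorb2)
  also have "\<dots> = (\<integral>s. \<integral>w. indicator D (w, s) \<partial>M \<partial>unitU)" using P.integral_snd[of "\<lambda>w s. indicator D (w, s) :: real"] Dint by simp
  also have "\<dots> = integral\<^sup>L unitU Pi" by (rule Bochner_Integration.integral_cong) (use Pi_int in auto)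
  finally have D: "measure PM D = integral\<^sup>L unitU Pi" .
  have [measurable]: "Pi \<in> borel_measurable unitU" using PiI by auto
  define B where "B = {s \<in> space unitU. Pi s > c}"
  have BU: "B \<in> sets unitU" unfolding B_def by measurable
  have Bb: "B \<in> sets borel" "B \<subseteq> {0..<1}" using sets_unitU_borel[OF BU] by auto
  have "c * measure unitU B = (\<integral>s. c * indicator B s \<partial>unitU)"
    using Bb by (simp add: Int_absorb2)
  also have "\<dots> \<le> integral\<^sup>L unitU Pi"
  proof (rule integral_mono)
    show "integrable unitU (\<lambda>s. c * indicator B s)" using BU by (intro integrable_mult_right) (auto simp: U.emeasure_eq_measure)
    show "c * indicator B s \<le> Pi s" for s unfolding B_def Pi_def by (auto simp: indicator_def)
  qed (rule PiI)
  finally have "l * (c * measure unitU B) \<le> \<eta>" using lD D l by (smt (verit) mult_left_mono)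
  moreover have "measure unitU B = measure lborel B" using emeasure_unitU[OF Bb] by (simp add: measure_def)
  ultimately have "measure lborel B \<le> \<eta> / (l * c)" using l c by (simp add: pos_le_divide_eq mult_ac)
  moreover have "prob {w \<in> space M. \<exists>n\<in>{1..N}.
       (\<Sum>k<n. h ((T ^^ nat \<lfloor>s + real k * \<beta>\<rfloor>) w, frac (s + real k * \<beta>))) > l * real n} \<le> c"
    if "s \<in> {0..<1} - B" for s
    using that Seq[of s] unfolding B_def Pi_def by auto
  ultimately show ?thesis using that Bb by blast
qed

end

text \<open>Density of the fractional parts is required with nonnegative multiples, since shifting
  the phase means running the dynamics forward in time.\<close>

lemma irrational_orbit_hits:
  assumes "\<beta> \<notin> \<rat>" "0 \<le> x" "0 < e" "x + e \<le> 1"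
  obtains l :: nat where "frac (\<sigma> + real l * \<beta>) \<in> {x..<x + e}"
proof -
  obtain h k where k: "k > 0" "\<bar>of_int k * \<beta> - of_int h - (x + e / 2 - \<sigma>)\<bar> < e / 2"
    using sequence_of_fractional_parts_is_dense[of \<beta> "e / 2" "x + e / 2 - \<sigma>"] assms by (metis half_gt_zero)
  let ?y = "\<sigma> + real (nat k) * \<beta> - of_int h"
  have nk: "real (nat k) = real_of_int k" using k(1) by simp
  have y: "x < ?y" "?y < x + e" using k(2) unfolding nk abs_less_iff by linarith+
  then have "frac ?y = ?y" using assms by (simp add: frac_eq)
  moreover have "frac ?y = frac (\<sigma> + real (nat k) * \<beta>)"
    using frac_plus_of_int[of ?y h] by simp
  ultimately show ?thesis using that[of "nat k"] y by simp
qed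

lemma borel_measurable_Lipschitz:
  fixes f :: "real \<Rightarrow> real"
  assumes "0 \<le> C" "\<And>v u. \<bar>f v - f u\<bar> \<le> C * \<bar>v - u\<bar>"
  shows "f \<in> borel_measurable borel"
proof -
  have "C-lipschitz_on UNIV f" by (rule lipschitz_onI) (use assms in \<open>auto simp: dist_real_def\<close>)
  then show ?thesis by (intro borel_measurable_continuous_onI lipschitz_on_continuous_on)
qed

section \<open>Sizes of predictions along the flow\<close>

context digits
begin

text \<open>On a fixed cell the coefficient is Lipschitz in the frequency, and there are countably
  many labels; a representative of each cell separates the two dependencies.\<close>

lemma CS_joint_measurable [measurable]:
  "(\<lambda>z. Cc L (v * real p powr snd z) ((T ^^ n) (fst z))) \<in> borel_measurable PM"
  "(\<lambda>z. Sc L (v * real p powr snd z) ((T ^^ n) (fst z))) \<in> borel_measurable PM"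
proof -
  define rep where "rep l = (SOME y. xi L y = l)" for l
  have rep: "xi L (rep (xi L y)) = xi L y" for y unfolding rep_def by (rule someI[of _ y]) simp
  have eq: "Cc L u y = Cc L u (rep (xi L y))" "Sc L u y = Sc L u (rep (xi L y))" for u y
    unfolding Cc_def Sc_def by (rule depends_onD[OF ce_depends], rule rep[symmetric])+
  have xim [measurable]: "(\<lambda>z. xi L ((T ^^ n) (fst z))) \<in> PM \<rightarrow>\<^sub>M count_space UNIV"
    by (rule measurable_compose[OF _ fpartD[OF xi_fpart]]) measurable
  have Cb [measurable]: "(\<lambda>u. Cc L u y) \<in> borel_measurable borel" "(\<lambda>u. Sc L u y) \<in> borel_measurable borel" for y
    by (rule borel_measurable_Lipschitz[of "2 * pi"]; simp add: CS_Lipschitz)+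
  have "(\<lambda>z. Cc L (v * real p powr snd z) (rep (xi L ((T ^^ n) (fst z))))) \<in> borel_measurable PM"
    by (rule measurable_compose_countable[where f="\<lambda>l z. Cc L (v * real p powr snd z) (rep l)"]) measurable
  then show "(\<lambda>z. Cc L (v * real p powr snd z) ((T ^^ n) (fst z))) \<in> borel_measurable PM"
    unfolding eq(1)[symmetric] .
  have "(\<lambda>z. Sc L (v * real p powr snd z) (rep (xi L ((T ^^ n) (fst z))))) \<in> borel_measurable PM"
    by (rule measurable_compose_countable[where f="\<lambda>l z. Sc L (v * real p powr snd z) (rep l)"]) measurable
  then show "(\<lambda>z. Sc L (v * real p powr snd z) ((T ^^ n) (fst z))) \<in> borel_measurable PM"
    unfolding eq(2)[symmetric] .
qed

text \<open>Indicator of the event that, seen from time \<open>K\<close>, some shorter past predicts the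
  character of frequency \<open>v p\<^sup>t\<close> with modulus above \<open>\<tau>\<close>.\<close>

definition hbad :: "nat \<Rightarrow> real \<Rightarrow> real \<Rightarrow> 'a \<times> real \<Rightarrow> real" where
  "hbad K \<tau> v z = of_bool (\<exists>L\<le>K. \<bar>Cc L (v * real p powr snd z) ((T ^^ (K - L)) (fst z))\<bar> > \<tau>
     \<or> \<bar>Sc L (v * real p powr snd z) ((T ^^ (K - L)) (fst z))\<bar> > \<tau>)"

lemma hbad_measurable [measurable]: "hbad K \<tau> v \<in> borel_measurable PM"
  unfolding hbad_def by measurable

text \<open>For fixed \<open>K\<close>, the last \<open>L\<close> digits before time
  \<open>K\<close> form partitions that become finer with \<open>L\<close>, and all coefficients in
  \<open>hbad\<close> are conditional expectations of a cosine or sine of one quantity at time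
  \<open>K\<close>. Doob's inequality bounds their maximum by the second moment at
  \<open>L = K\<close>.\<close>

lemma hbad_slice:
  assumes \<tau>: "0 < \<tau>"
  shows "(\<integral>w. hbad K \<tau> v (w, t) \<partial>M) \<le> energy K (v * real p powr t) / \<tau>\<^sup>2"
proof -
  let ?u = "v * real p powr t"
  let ?z = "\<lambda>L w. xi L ((T ^^ (K - L)) w)"
  have fine: "depends_on (?z (Suc L)) (?z L)" if "L < K" for L
  proof (rule depends_onI)
    fix y w assume e: "?z (Suc L) y = ?z (Suc L) w"
    have s: "K - L = Suc (K - Suc L)" using that by simp
    have "xi L ((T ^^ 1) ((T ^^ (K - Suc L)) y)) = xi L ((T ^^ 1) ((T ^^ (K - Suc L)) w))"
      by (rule depends_onD[OF xi_shift e]) simp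
    then show "?z L y = ?z L w" unfolding s by simp
  qed
  have fp: "fpart (?z L)" for L by (rule fpart_Tn[OF xi_fpart])
  have TK: "(T ^^ L) ((T ^^ (K - L)) w) = (T ^^ K) w" if "L \<le> K" for L w
    using that funpow_add[of L "K - L" T] by (simp add: comp_def fun_eq_iff)
  have C: "ce M (?z L) (\<lambda>w. cos (2 * pi * ?u * X ((T ^^ K) w))) w = Cc L ?u ((T ^^ (K - L)) w)" if "L \<le> K" for L w
    unfolding Cc_def using ce_Tn[OF xi_fpart, of "\<lambda>w. cos (2 * pi * ?u * X ((T ^^ L) w))" L "K - L" w]
    by (simp add: TK[OF that])
  have S: "ce M (?z L) (\<lambda>w. sin (2 * pi * ?u * X ((T ^^ K) w))) w = Sc L ?u ((T ^^ (K - L)) w)" if "L \<le> K" for L w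
    unfolding Sc_def using ce_Tn[OF xi_fpart, of "\<lambda>w. sin (2 * pi * ?u * X ((T ^^ L) w))" L "K - L" w]
    by (simp add: TK[OF that])
  let ?PC = "\<lambda>w. \<exists>L\<le>K. \<bar>ce M (?z L) (\<lambda>w. cos (2 * pi * ?u * X ((T ^^ K) w))) w\<bar> > \<tau>"
  let ?PS = "\<lambda>w. \<exists>L\<le>K. \<bar>ce M (?z L) (\<lambda>w. sin (2 * pi * ?u * X ((T ^^ K) w))) w\<bar> > \<tau>"
  note [measurable] = fp
  have "\<tau>\<^sup>2 * prob {w \<in> space M. ?PC w} \<le> (\<integral>w. (ce M (?z K) (\<lambda>w. cos (2 * pi * ?u * X ((T ^^ K) w))) w)\<^sup>2 \<partial>M)"
    by (rule doob_weak[where B=1 and \<zeta>="?z"]) (use fp fine \<tau> in auto)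
  then have dC: "\<tau>\<^sup>2 * prob {w \<in> space M. ?PC w} \<le> (\<integral>w. (Cc K ?u w)\<^sup>2 \<partial>M)" using C[of K] by simp
  have "\<tau>\<^sup>2 * prob {w \<in> space M. ?PS w} \<le> (\<integral>w. (ce M (?z K) (\<lambda>w. sin (2 * pi * ?u * X ((T ^^ K) w))) w)\<^sup>2 \<partial>M)"
    by (rule doob_weak[where B=1 and \<zeta>="?z"]) (use fp fine \<tau> in auto)
  then have dS: "\<tau>\<^sup>2 * prob {w \<in> space M. ?PS w} \<le> (\<integral>w. (Sc K ?u w)\<^sup>2 \<partial>M)" using S[of K] by simp
  have h: "hbad K \<tau> v (w, t) = of_bool (?PC w \<or> ?PS w)" for w
    unfolding hbad_def using C S by (auto simp: of_bool_def)
  have "(\<integral>w. hbad K \<tau> v (w, t) \<partial>M) = prob ({w \<in> space M. ?PC w} \<union> {w \<in> space M. ?PS w})"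
    unfolding h by (subst integral_of_bool) (measurable, intro arg_cong[of _ _ prob], blast)
  also have "\<dots> \<le> prob {w \<in> space M. ?PC w} + prob {w \<in> space M. ?PS w}"
    by (rule measure_Un_le) measurable
  finally have "\<tau>\<^sup>2 * (\<integral>w. hbad K \<tau> v (w, t) \<partial>M) \<le> \<tau>\<^sup>2 * (prob {w \<in> space M. ?PC w} + prob {w \<in> space M. ?PS w})"
    by (intro mult_left_mono) auto
  also have "\<dots> \<le> (\<integral>w. (Cc K ?u w)\<^sup>2 \<partial>M) + (\<integral>w. (Sc K ?u w)\<^sup>2 \<partial>M)" using dC dS by (simp add: distrib_left)
  also have "\<dots> = energy K ?u" unfolding energy_def by (simp add: CS_sq_integrable)
  finally show ?thesis using \<tau> by (simp add: pos_le_divide_eq mult.commute)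
qed

text \<open>Level and scale are the integer and fractional part of \<open>s + k * \<beta>\<close>: a
  frequency growing by the factor \<open>p powr \<beta>\<close> at each step is seen at this level
  as \<open>v * p powr t\<close>.\<close>

definition pred_size :: "real \<Rightarrow> real \<Rightarrow> real \<Rightarrow> nat \<Rightarrow> 'a \<Rightarrow> real" where
  "pred_size \<beta> v s k z = \<bar>Cc (nat \<lfloor>s + real k * \<beta>\<rfloor>) (v * real p powr frac (s + real k * \<beta>)) z\<bar>
     + \<bar>Sc (nat \<lfloor>s + real k * \<beta>\<rfloor>) (v * real p powr frac (s + real k * \<beta>)) z\<bar>"

lemma pred_size_measurable [measurable]: "pred_size \<beta> v s k \<in> borel_measurable M"
  unfolding pred_size_def by measurable

text \<open>Transference: evaluating at \<open>T\<^sup>K w\<close> with \<open>K\<close> large turns the predictions along a sequence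
  of growing pasts into values of the single function \<open>hbad K\<close> along the flow; changing the phase
  by \<open>l0 \<beta>\<close> only drops the first \<open>l0\<close> terms.\<close>

lemma pred_size_phase_shift:
  assumes s: "0 \<le> s" and \<beta>: "0 \<le> \<beta>" and K: "s + real N * \<beta> \<le> real K"
    and N0: "0 < N0" "real l0 \<le> l * real N0" and l: "0 < l" and \<tau>: "0 \<le> \<tau>"
    and R: "prob {w \<in> space M. \<exists>n\<in>{1..N}. (\<Sum>k<n. hbad K \<tau> v
       ((T ^^ nat \<lfloor>frac (s + real l0 * \<beta>) + real k * \<beta>\<rfloor>) w, frac (frac (s + real l0 * \<beta>) + real k * \<beta>))) > l * real n} \<le> c"
  shows "prob {z \<in> space M. \<exists>n\<in>{N0..N}. (\<Sum>k<n. pred_size \<beta> v s k z) > (2 * \<tau> + 4 * l) * real n} \<le> c"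
proof -
  let ?s' = "frac (s + real l0 * \<beta>)"
  define j where "j = nat \<lfloor>s + real l0 * \<beta>\<rfloor>"
  define P where "P z \<longleftrightarrow> (\<exists>n\<in>{N0..N}. (\<Sum>k<n. pred_size \<beta> v s k z) > (2 * \<tau> + 4 * l) * real n)" for z
  define hb where "hb k w = hbad K \<tau> v ((T ^^ nat \<lfloor>s + real k * \<beta>\<rfloor>) w, frac (s + real k * \<beta>))" for k w
  define h' where "h' k w = hbad K \<tau> v ((T ^^ nat \<lfloor>?s' + real k * \<beta>\<rfloor>) w, frac (?s' + real k * \<beta>))" for k w
  define R' where "R' w \<longleftrightarrow> (\<exists>n\<in>{1..N}. (\<Sum>k<n. h' k w) > l * real n)" for w
  have [measurable]: "Measurable.pred M P" unfolding P_def by measurable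
  have [measurable]: "h' k \<in> borel_measurable M" for k
  proof -
    have "frac (?s' + real k * \<beta>) \<in> space unitU" by (simp add: frac_lt_1)
    then have "(\<lambda>w. ((T ^^ nat \<lfloor>?s' + real k * \<beta>\<rfloor>) w, frac (?s' + real k * \<beta>))) \<in> M \<rightarrow>\<^sub>M PM" by measurable
    then show ?thesis unfolding h'_def by (rule measurable_compose) measurable
  qed
  have [measurable]: "Measurable.pred M R'" unfolding R'_def by measurable
  have hb01: "0 \<le> hb k w" "hb k w \<le> 1" for k w unfolding hb_def hbad_def by auto
  have nn: "0 \<le> s + real k * \<beta>" for k using s \<beta> by simp
  have jj: "s + real l0 * \<beta> = ?s' + of_int (int j)"
    unfolding j_def frac_def using nn[of l0] by simp
  have shift: "h' k ((T ^^ j) w) = hb (l0 + k) w" for k w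
  proof -
    have e: "s + real (l0 + k) * \<beta> = (?s' + real k * \<beta>) + of_int (int j)"
      using jj by (simp add: algebra_simps)
    have "\<lfloor>s + real (l0 + k) * \<beta>\<rfloor> = \<lfloor>?s' + real k * \<beta>\<rfloor> + int j" unfolding e by (simp only: floor_add_int)
    moreover have "0 \<le> \<lfloor>?s' + real k * \<beta>\<rfloor>" using \<beta> by simp
    ultimately have "nat \<lfloor>s + real (l0 + k) * \<beta>\<rfloor> = nat \<lfloor>?s' + real k * \<beta>\<rfloor> + j" by linarith
    moreover have "frac (s + real (l0 + k) * \<beta>) = frac (?s' + real k * \<beta>)" unfolding e by (rule frac_plus_of_int)
    ultimately show ?thesis unfolding h'_def hb_def by (simp add: funpow_add)
  qed
  \<comment> \<open>Where \<open>hb\<close> vanishes both coefficients are at most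
    \<open>\<tau>\<close>; elsewhere each is bounded by \<open>1\<close>.\<close>
  have le: "pred_size \<beta> v s k ((T ^^ K) w) \<le> 2 * \<tau> + 2 * hb k w" if k: "k < N" for k w
  proof -
    let ?L = "nat \<lfloor>s + real k * \<beta>\<rfloor>"
    have "s + real k * \<beta> \<le> s + real N * \<beta>" using k \<beta> by (intro add_left_mono mult_right_mono) auto
    then have LK: "?L \<le> K" using K nn[of k] by (simp add: nat_le_iff floor_le_iff)
    have TK: "(T ^^ K) w = (T ^^ (K - ?L)) ((T ^^ ?L) w)"
      using LK funpow_add[of "K - ?L" ?L T] by (simp add: comp_def fun_eq_iff)
    show ?thesis
    proof (cases "hb k w = 0")
      case True
      then have "\<bar>Cc ?L (v * real p powr frac (s + real k * \<beta>)) ((T ^^ K) w)\<bar> \<le> \<tau>"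
        "\<bar>Sc ?L (v * real p powr frac (s + real k * \<beta>)) ((T ^^ K) w)\<bar> \<le> \<tau>"
        unfolding TK hb_def hbad_def using LK by (auto simp: not_less)
      then show ?thesis using True unfolding pred_size_def by simp
    next
      case False
      then have "hb k w = 1" unfolding hb_def hbad_def by auto
      then show ?thesis using CS_bound[of ?L _ "(T ^^ K) w"] \<tau> unfolding pred_size_def by (smt (verit))
    qed
  qed
  have imp: "R' ((T ^^ j) w)" if P: "P ((T ^^ K) w)" for w
  proof -
    obtain n where n: "n \<in> {N0..N}" "(\<Sum>k<n. pred_size \<beta> v s k ((T ^^ K) w)) > (2 * \<tau> + 4 * l) * real n"
      using P unfolding P_def by blast
    have "(\<Sum>k<n. pred_size \<beta> v s k ((T ^^ K) w)) \<le> (\<Sum>k<n. 2 * \<tau> + 2 * hb k w)"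
      using n by (intro sum_mono le) auto
    also have "\<dots> = 2 * \<tau> * real n + 2 * (\<Sum>k<n. hb k w)" by (simp add: sum.distrib sum_distrib_left)
    finally have 1: "2 * l * real n < (\<Sum>k<n. hb k w)" using n by (simp add: algebra_simps)
    \<comment> \<open>The threshold \<open>4 * l\<close> left \<open>2 * l * n\<close> for the sum
      of \<open>hb\<close>; half of it pays for the \<open>l0\<close> initial terms, as
      \<open>l0 \<le> l * N0 \<le> l * n\<close>.\<close>
    have "(\<Sum>k<n. hb k w) \<le> (\<Sum>k<l0 + n. hb k w)" using hb01 by (intro sum_mono2) auto
    also have "\<dots> = (\<Sum>k<l0. hb k w) + (\<Sum>k<n. hb (l0 + k) w)"
      by (induction n) simp_all
    also have "(\<Sum>k<l0. hb k w) \<le> real l0" using sum_mono[of "{..<l0}" "\<lambda>k. hb k w" "\<lambda>_. 1"] hb01 by simp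
    finally have "2 * l * real n - real l0 < (\<Sum>k<n. hb (l0 + k) w)" using 1 by simp
    moreover have "l * real N0 \<le> l * real n" using n l by (intro mult_left_mono) auto
    ultimately have "l * real n < (\<Sum>k<n. h' k ((T ^^ j) w))" using N0(2) unfolding shift by linarith
    then show ?thesis using n N0(1) unfolding R'_def by (intro bexI[of _ n]) auto
  qed
  \<comment> \<open>Invariance is used in both directions: to evaluate \<open>P\<close> at time
    \<open>K\<close>, and to discard the \<open>j\<close> steps belonging to the phase
    shift.\<close>
  have "prob {z \<in> space M. P z} = prob {w \<in> space M. P ((T ^^ K) w)}" by (rule prob_Tn[symmetric]) measurable
  also have "\<dots> \<le> prob {w \<in> space M. R' ((T ^^ j) w)}"
    by (rule finite_measure_mono) (use imp in auto)
  also have "\<dots> = prob {w \<in> space M. R' w}" by (rule prob_Tn) measurable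
  also have "\<dots> \<le> c" using R unfolding R'_def h'_def .
  finally show ?thesis unfolding P_def .
qed

text \<open>For each \<open>N\<close> the bad phases have measure at most \<open>1 / 4\<close>, so
  among \<open>A\<close> intervals of equal length one is at most a quarter bad. The orbit of
  \<open>\<sigma>\<close> enters its left half, which carries the window of length
  \<open>1 / (2 * A)\<close> into it; hence at most half of the window is bad for this
  \<open>N\<close>. Badness is monotone in \<open>N\<close>, so some phase is good for all
  \<open>N\<close> at once.\<close>

lemma good_phase:
  assumes en: "\<And>L. integral\<^sup>L unitU (\<lambda>t. energy L (v * real p powr t)) \<le> \<eta>"
    and \<tau>: "0 < \<tau>" and l: "0 < l" and c: "0 < c" and small: "\<eta> / \<tau>\<^sup>2 / (l * c) \<le> 1 / 4"
    and \<beta>: "\<beta> \<notin> \<rat>" "0 \<le> \<beta>" and \<sigma>: "0 \<le> \<sigma>" and A: "0 < A"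
  obtains s N0 where "s \<in> {\<sigma>..<\<sigma> + 1 / (2 * real A)}"
    "\<And>N. prob {z \<in> space M. \<exists>n\<in>{N0..N}. (\<Sum>k<n. pred_size \<beta> v s k z) > (2 * \<tau> + 4 * l) * real n} \<le> c"
proof -
  interpret U: prob_space unitU by (rule prob_space_unitU)
  define \<delta> where "\<delta> = 1 / (2 * real A)"
  have \<delta>: "0 < \<delta>" "\<delta> \<le> 1" using A by (auto simp: \<delta>_def)
  define lo where "lo a = real a / real A" for a
  have "\<exists>l0::nat. frac (\<sigma> + real l0 * \<beta>) \<in> {lo a..<lo a + \<delta>}" if "a < A" for a
  proof -
    have "real (Suc a) / real A \<le> 1" using that A by simp
    moreover have "lo a + \<delta> \<le> real (Suc a) / real A" using A by (simp add: lo_def \<delta>_def field_simps)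
    ultimately have "lo a + \<delta> \<le> 1" by linarith
    then obtain l0 where "frac (\<sigma> + real l0 * \<beta>) \<in> {lo a..<lo a + \<delta>}"
      using irrational_orbit_hits[OF \<beta>(1), of "lo a" \<delta> \<sigma>] \<delta> by (auto simp: lo_def)
    then show ?thesis by blast
  qed
  then obtain lf :: "nat \<Rightarrow> nat" where lf: "\<And>a. a < A \<Longrightarrow> frac (\<sigma> + real (lf a) * \<beta>) \<in> {lo a..<lo a + \<delta>}"
    by metis
  \<comment> \<open>Only \<open>A\<close> target intervals occur, so the waiting times are bounded
    and \<open>N0\<close> can be chosen independently of \<open>N\<close>.\<close>
  define lmax where "lmax = Max (lf ` {..<A})"
  have lmax: "lf a \<le> lmax" if "a < A" for a unfolding lmax_def using that by (intro Max_ge) auto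
  obtain N1 :: nat where N1: "real lmax / l < real N1" using reals_Archimedean2 by blast
  define N0 where "N0 = Suc N1"
  have "real lmax / l \<le> real N0" using N1 unfolding N0_def by simp
  then have N0: "0 < N0" "real lmax \<le> l * real N0" using l by (auto simp: N0_def pos_divide_le_eq mult.commute)
  define K where "K N = nat \<lceil>\<sigma> + 1 + real N * \<beta>\<rceil>" for N
  have K: "s + real N * \<beta> \<le> real (K N)" if "s < \<sigma> + \<delta>" for s N
    unfolding K_def using that \<delta> by linarith
  define isB where "isB N B \<longleftrightarrow> B \<in> sets borel \<and> B \<subseteq> {0..<1} \<and> measure lborel B \<le> 1 / 4 \<and>
    (\<forall>s\<in>{0..<1} - B. prob {w \<in> space M. \<exists>n\<in>{1..N}.
       (\<Sum>k<n. hbad (K N) \<tau> v ((T ^^ nat \<lfloor>s + real k * \<beta>\<rfloor>) w, frac (s + real k * \<beta>))) > l * real n} \<le> c)" for N B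
  have "\<exists>B. isB N B" for N
  proof -
    have int: "integrable unitU (\<lambda>t. energy (K N) (v * real p powr t))"
    proof (rule U.integrable_bdd[where B=2])
      show "(\<lambda>t. energy (K N) (v * real p powr t)) \<in> borel_measurable unitU"
        by (rule measurable_unitU) measurable
      show "\<bar>energy (K N) (v * real p powr t)\<bar> \<le> 2" for t using energy_bounds[of "K N" "v * real p powr t"] by simp
    qed
    have F: "integrable unitU (\<lambda>t. energy (K N) (v * real p powr t) / \<tau>\<^sup>2)"
      "integral\<^sup>L unitU (\<lambda>t. energy (K N) (v * real p powr t) / \<tau>\<^sup>2) \<le> \<eta> / \<tau>\<^sup>2"
      using int en[of "K N"] by (simp_all add: divide_right_mono)
    have h01: "hbad (K N) \<tau> v z \<in> {0..1}" for z unfolding hbad_def by auto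
    obtain B where BB: "B \<in> sets borel" "B \<subseteq> {0..<1}" "measure lborel B \<le> (\<eta> / \<tau>\<^sup>2) / (l * c)"
      "\<And>s. s \<in> {0..<1} - B \<Longrightarrow> prob {w \<in> space M. \<exists>n\<in>{1..N}.
       (\<Sum>k<n. hbad (K N) \<tau> v ((T ^^ nat \<lfloor>s + real k * \<beta>\<rfloor>) w, frac (s + real k * \<beta>))) > l * real n} \<le> c"
      using flow_slices[OF hbad_measurable h01 hbad_slice[OF \<tau>] F \<beta>(2) l c, of N] by blast
    have "measure lborel B \<le> 1 / 4" using BB(3) small by (rule order_trans)
    then have "isB N B" unfolding isB_def using BB(1,2,4) by (intro conjI ballI) simp_all
    then show ?thesis ..
  qed
  then obtain B where isB: "\<And>N. isB N (B N)" by metis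
  have B: "\<And>N. B N \<in> sets borel" "\<And>N. B N \<subseteq> {0..<1}" "\<And>N. measure lborel (B N) \<le> 1 / 4"
    using isB unfolding isB_def by simp_all
  have Bs: "prob {w \<in> space M. \<exists>n\<in>{1..N}.
       (\<Sum>k<n. hbad (K N) \<tau> v ((T ^^ nat \<lfloor>s + real k * \<beta>\<rfloor>) w, frac (s + real k * \<beta>))) > l * real n} \<le> c"
    if "s \<in> {0..<1} - B N" for N s
    using isB[of N] that unfolding isB_def by (elim conjE) (erule bspec)
  note [measurable] = B(1)
  define J where "J a = {lo a..<lo (Suc a)}" for a
  have "\<exists>a<A. measure lborel (B N \<inter> J a) \<le> \<delta> / 2" for N
  proof (rule ccontr)
    assume "\<not> ?thesis"
    then have gt: "\<And>a. a < A \<Longrightarrow> measure lborel (B N \<inter> J a) > \<delta> / 2" by (meson not_le)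
    have U_eq: "measure unitU C = measure lborel C" if "C \<in> sets borel" "C \<subseteq> {0..<1}" for C
      using emeasure_unitU[OF that] by (simp add: measure_def)
    have BU: "B N \<inter> J a \<in> sets unitU" for a
      unfolding unitU_def sets_restrict_space using B(2)[of N] by (auto simp: J_def intro!: image_eqI[of _ _ "B N \<inter> J a"])
    have BU': "B N \<in> sets unitU"
      unfolding unitU_def sets_restrict_space using B(2)[of N] by (auto intro!: image_eqI[of _ _ "B N"])
    have disj: "disjoint_family_on (\<lambda>a. B N \<inter> J a) {..<A}"
      unfolding disjoint_family_on_def
    proof (intro ballI impI)
      fix a b :: nat assume "a \<noteq> b"
      moreover have "J a \<inter> J b = {}" if "a < b" for a b
      proof -
        have "real (Suc a) \<le> real b" using that by simp
        then have "lo (Suc a) \<le> lo b" unfolding lo_def using A by (intro divide_right_mono) auto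
        then show ?thesis unfolding J_def by auto
      qed
      ultimately have "J a \<inter> J b = {}" by (metis Int_commute linorder_neqE_nat)
      then show "(B N \<inter> J a) \<inter> (B N \<inter> J b) = {}" by blast
    qed
    have "1 / 4 = (\<Sum>a<A. \<delta> / 2)" using A by (simp add: \<delta>_def)
    also have "\<dots> < (\<Sum>a<A. measure unitU (B N \<inter> J a))"
    proof (rule sum_strict_mono)
      fix a assume "a \<in> {..<A}"
      then have "measure lborel (B N \<inter> J a) > \<delta> / 2" by (intro gt) simp
      moreover have "measure unitU (B N \<inter> J a) = measure lborel (B N \<inter> J a)"
        by (rule U_eq) (use B(2)[of N] in \<open>auto simp: J_def\<close>)
      ultimately show "\<delta> / 2 < measure unitU (B N \<inter> J a)" by simp
    qed (use A in auto)
    also have "\<dots> = measure unitU (\<Union>a<A. B N \<inter> J a)"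
      by (rule U.finite_measure_finite_Union[symmetric]) (use BU disj in auto)
    also have "\<dots> \<le> measure unitU (B N)" by (rule U.finite_measure_mono) (use BU' in auto)
    also have "\<dots> \<le> 1 / 4" using U_eq B by simp
    finally show False by simp
  qed
  then obtain aN where aN: "\<And>N. aN N < A" "\<And>N. measure lborel (B N \<inter> J (aN N)) \<le> \<delta> / 2" by metis
  define y where "y N = frac (\<sigma> + real (lf (aN N)) * \<beta>)" for N
  have y: "y N \<in> {lo (aN N)..<lo (aN N) + \<delta>}" for N unfolding y_def by (rule lf[OF aN(1)])
  have yJ: "y N + r \<in> J (aN N)" "y N + r < 1" if "0 \<le> r" "r < \<delta>" for N r
  proof -
    have e: "lo (aN N) + \<delta> + \<delta> = lo (Suc (aN N))" using A by (simp add: lo_def \<delta>_def field_simps)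
    show "y N + r \<in> J (aN N)" unfolding J_def using y[of N] that e by auto
    have "lo (Suc (aN N)) \<le> 1" using aN(1)[of N] A by (simp add: lo_def)
    then show "y N + r < 1" using y[of N] that e by auto
  qed
  have ymeas: "emeasure lborel (B N \<inter> J (aN N)) \<le> ennreal (\<delta> / 2)" for N
  proof -
    have "emeasure lborel (B N \<inter> J (aN N)) \<le> emeasure lborel {0..<1::real}"
      by (rule emeasure_mono) (use B(2)[of N] in auto)
    then have "emeasure lborel (B N \<inter> J (aN N)) < \<infinity>" by (rule le_less_trans) simp
    then have "emeasure lborel (B N \<inter> J (aN N)) = ennreal (measure lborel (B N \<inter> J (aN N)))"
      by (intro emeasure_eq_ennreal_measure) simp
    then show ?thesis using aN(2)[of N] by (simp add: ennreal_leI)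
  qed
  \<comment> \<open>The bad phases pulled back to the window at \<open>\<sigma>\<close>; translation
    keeps their measure, at most \<open>\<delta> / 2\<close>.\<close>
  define S where "S N = {s. s + (y N - \<sigma>) \<in> B N \<inter> J (aN N)}" for N
  have Sm [measurable]: "S N \<in> sets borel" for N unfolding S_def J_def by measurable
  have Se: "emeasure lborel (S N) \<le> ennreal (\<delta> / 2)" for N
    unfolding S_def using emeasure_lborel_translate[of "B N \<inter> J (aN N)"] ymeas[of N] by (simp add: J_def)
  define P where "P N s z \<longleftrightarrow> (\<exists>n\<in>{N0..N}. (\<Sum>k<n. pred_size \<beta> v s k z) > (2 * \<tau> + 4 * l) * real n)" for N s z
  have [measurable]: "Measurable.pred M (P N s)" for N s unfolding P_def by measurable
  have good: "prob {z \<in> space M. P N s z} \<le> c" if s: "s \<in> {\<sigma>..<\<sigma> + \<delta>}" and nS: "s \<notin> S N" for N s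
  proof -
    have ys: "y N + (s - \<sigma>) \<in> J (aN N)" "y N + (s - \<sigma>) < 1" using yJ[of "s - \<sigma>" N] s by auto
    then have nB: "y N + (s - \<sigma>) \<notin> B N" using nS unfolding S_def by (auto simp: algebra_simps)
    have y0: "0 \<le> y N + (s - \<sigma>)" using s by (simp add: y_def)
    have "s + real (lf (aN N)) * \<beta> = (y N + (s - \<sigma>)) + of_int \<lfloor>\<sigma> + real (lf (aN N)) * \<beta>\<rfloor>"
      unfolding y_def frac_def by simp
    then have fr: "frac (s + real (lf (aN N)) * \<beta>) = y N + (s - \<sigma>)"
      using y0 ys(2) by (simp only: frac_plus_of_int) (simp add: frac_eq)
    show ?thesis unfolding P_def
    proof (rule pred_size_phase_shift[where K="K N" and ?l0.0="lf (aN N)"])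
      show "real (lf (aN N)) \<le> l * real N0" using lmax[OF aN(1)[of N]] N0(2) by linarith
      show "prob {w \<in> space M. \<exists>n\<in>{1..N}. (\<Sum>k<n. hbad (K N) \<tau> v
       ((T ^^ nat \<lfloor>frac (s + real (lf (aN N)) * \<beta>) + real k * \<beta>\<rfloor>) w,
         frac (frac (s + real (lf (aN N)) * \<beta>) + real k * \<beta>))) > l * real n} \<le> c"
        unfolding fr by (rule Bs) (use nB y0 ys(2) in auto)
    qed (use s \<sigma> \<beta> K N0 l \<tau> in auto)
  qed
  have "\<exists>s\<in>{\<sigma>..<\<sigma> + \<delta>}. \<forall>N. prob {z \<in> space M. P N s z} \<le> c"
  proof (rule ccontr)
    assume "\<not> ?thesis"
    then have bad: "\<exists>N. prob {z \<in> space M. P N s z} > c" if "s \<in> {\<sigma>..<\<sigma> + \<delta>}" for s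
      using that by (meson not_le)
    \<comment> \<open>A phase that fails for some \<open>N\<close> fails for all larger ones, so it
      would lie in \<open>S N\<close> for all large \<open>N\<close>. The increasing sets
      \<open>G n\<close> have measure at most \<open>\<delta> / 2\<close> and cannot cover a window
      of length \<open>\<delta>\<close>.\<close>
    define G where "G n = (\<Inter>N\<in>{n..}. S N)" for n
    have Gm: "G n \<in> sets lborel" for n unfolding G_def by (intro sets.countable_INT'') (auto simp: )
    have inc: "incseq G" unfolding incseq_def G_def by (auto intro: order_trans)
    have "{\<sigma>..<\<sigma> + \<delta>} \<subseteq> (\<Union>n. G n)"
    proof
      fix s assume s: "s \<in> {\<sigma>..<\<sigma> + \<delta>}"
      obtain n where n: "prob {z \<in> space M. P n s z} > c" using bad[OF s] by blast
      have "s \<in> S N" if "n \<le> N" for N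
      proof (rule ccontr)
        assume "s \<notin> S N"
        then have "prob {z \<in> space M. P N s z} \<le> c" by (rule good[OF s])
        moreover have "prob {z \<in> space M. P n s z} \<le> prob {z \<in> space M. P N s z}"
          by (rule finite_measure_mono) (use that in \<open>auto simp: P_def\<close>)
        ultimately show False using n by linarith
      qed
      then show "s \<in> (\<Union>n. G n)" unfolding G_def by auto
    qed
    then have "emeasure lborel {\<sigma>..<\<sigma> + \<delta>} \<le> emeasure lborel (\<Union>n. G n)"
      by (rule emeasure_mono) (use Gm in auto)
    also have "\<dots> = (SUP n. emeasure lborel (G n))"
      by (rule SUP_emeasure_incseq[symmetric]) (use Gm inc in auto)
    also have "\<dots> \<le> ennreal (\<delta> / 2)"
    proof (rule SUP_least)
      fix n
      have "emeasure lborel (G n) \<le> emeasure lborel (S n)" by (rule emeasure_mono) (auto simp: G_def)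
      then show "emeasure lborel (G n) \<le> ennreal (\<delta> / 2)" using Se[of n] by (rule order_trans)
    qed
    finally show False using \<delta> by (simp add: ennreal_le_iff)
  qed
  then show ?thesis using that[of _ N0] unfolding P_def \<delta>_def by blast
qed

end

section \<open>Averages of characters\<close>

lemma sum_half_powers: "(\<Sum>k<N. (1 / 2 :: real) ^ (N - k)) = 1 - (1 / 2) ^ N"
proof (induction N)
  case (Suc N)
  have "(\<Sum>k<N. (1 / 2 :: real) ^ (Suc N - k)) = (\<Sum>k<N. (1 / 2) * (1 / 2) ^ (N - k))"
    by (rule sum.cong) (auto simp: Suc_diff_le less_imp_le)
  then have "(\<Sum>k<N. (1 / 2 :: real) ^ (Suc N - k)) = (1 / 2) * (1 - (1 / 2) ^ N)"
    by (simp only: sum_distrib_left[symmetric] Suc)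
  then show ?case by simp
qed simp

text \<open>When one term is added, its correlations with all earlier terms sum to at most
  \<open>C\<close> by the geometric series and its square has mean at most \<open>4\<close>, so
  second moments grow linearly and \<open>lln_bounded\<close> applies.\<close>

lemma (in prob_space) lln_decorrelated:
  fixes Y :: "nat \<Rightarrow> 'a \<Rightarrow> real"
  assumes [measurable]: "\<And>k. Y k \<in> borel_measurable M" and B: "\<And>k z. \<bar>Y k z\<bar> \<le> 2" and C: "0 \<le> C"
    and cor: "\<And>k l. k < l \<Longrightarrow> \<bar>\<integral>z. Y k z * Y l z \<partial>M\<bar> \<le> C * (1 / 2) ^ (l - k)"
  shows "AE z in M. (\<lambda>N. (\<Sum>k<N. Y k z) / real N) \<longlonglongrightarrow> 0"
proof (rule lln_bounded)
  show "(\<integral>z. (\<Sum>k<N. Y k z)\<^sup>2 \<partial>M) \<le> (4 + 2 * C) * real N" for N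
  proof (induction N)
    case (Suc N)
    have YY: "integrable M (\<lambda>z. Y k z * Y l z)" for k l
    proof (rule integrable_bdd[where B="2 * 2"])
      fix z show "\<bar>Y k z * Y l z\<bar> \<le> 2 * 2" unfolding abs_mult by (intro mult_mono B) auto
    qed measurable
    have SY: "(\<Sum>k<N. Y k z) * Y N z = (\<Sum>k<N. Y k z * Y N z)" for z by (rule sum_distrib_right)
    have iSY: "integrable M (\<lambda>z. (\<Sum>k<N. Y k z) * Y N z)"
      unfolding SY by (intro Bochner_Integration.integrable_sum YY)
    have iSS: "integrable M (\<lambda>z. (\<Sum>k<N. Y k z)\<^sup>2)"
      unfolding power2_eq_square sum_product by (intro Bochner_Integration.integrable_sum YY)
    have iY: "integrable M (\<lambda>z. (Y N z)\<^sup>2)" unfolding power2_eq_square by (rule YY)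
    have "(\<integral>z. (\<Sum>k<N. Y k z) * Y N z \<partial>M) = (\<Sum>k<N. \<integral>z. Y k z * Y N z \<partial>M)"
      unfolding SY by (rule Bochner_Integration.integral_sum) (rule YY)
    also have "\<dots> \<le> (\<Sum>k<N. C * (1 / 2) ^ (N - k))"
      by (rule sum_mono) (use cor abs_le_D1 in blast)
    also have "\<dots> \<le> C" using C by (simp add: sum_distrib_left[symmetric] sum_half_powers mult_left_le)
    finally have 1: "(\<integral>z. (\<Sum>k<N. Y k z) * Y N z \<partial>M) \<le> C" .
    have "(Y N z)\<^sup>2 \<le> 4" for z using abs_sq_le[OF B[of N z]] by simp
    then have "(\<integral>z. (Y N z)\<^sup>2 \<partial>M) \<le> (\<integral>z. 4 \<partial>M)" by (intro integral_mono iY) auto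
    then have 2: "(\<integral>z. (Y N z)\<^sup>2 \<partial>M) \<le> 4" by (simp add: prob_space)
    have "(\<integral>z. (\<Sum>k<Suc N. Y k z)\<^sup>2 \<partial>M)
      = (\<integral>z. (\<Sum>k<N. Y k z)\<^sup>2 + 2 * ((\<Sum>k<N. Y k z) * Y N z) + (Y N z)\<^sup>2 \<partial>M)"
      by (rule Bochner_Integration.integral_cong) (auto simp: power2_eq_square algebra_simps)
    also have "\<dots> = (\<integral>z. (\<Sum>k<N. Y k z)\<^sup>2 \<partial>M) + 2 * (\<integral>z. (\<Sum>k<N. Y k z) * Y N z \<partial>M) + (\<integral>z. (Y N z)\<^sup>2 \<partial>M)"
      using iSS iSY iY by simp
    also have "\<dots> \<le> (4 + 2 * C) * real N + 2 * C + 4" using Suc 1 2 by linarith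
    also have "\<dots> = (4 + 2 * C) * real (Suc N)" by (simp add: algebra_simps)
    finally show ?case .
  qed simp
qed (use B in auto)

section \<open>Characters, their predictions and their innovations\<close>

context digits
begin

lemma xi_close:
  assumes "xi L w = xi L z"
  shows "\<bar>X w - X z\<bar> \<le> 1 / real p ^ L" "\<bar>Y w - Y z\<bar> \<le> 1 / real p ^ L"
proof -
  have pL: "real p ^ L > 0" using p2 by simp
  have *: "\<bar>x - y\<bar> \<le> 1 / real p ^ L" if "\<lfloor>real p ^ L * x\<rfloor> = \<lfloor>real p ^ L * y\<rfloor>" for x y
  proof -
    have "\<bar>real p ^ L * x - real p ^ L * y\<bar> \<le> 1" using that by linarith
    then have "real p ^ L * \<bar>x - y\<bar> \<le> 1" using pL by (simp add: right_diff_distrib[symmetric] abs_mult)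
    then show ?thesis using pL by (simp add: pos_le_divide_eq mult.commute)
  qed
  show "\<bar>X w - X z\<bar> \<le> 1 / real p ^ L" "\<bar>Y w - Y z\<bar> \<le> 1 / real p ^ L"
    using assms unfolding xi_def by (auto intro: *)
qed

definition wave :: "real \<Rightarrow> real \<Rightarrow> real \<Rightarrow> 'a \<Rightarrow> real" where
  "wave a d \<phi> z = cos (2 * pi * (a * X z + d * Y z) + \<phi>)"

lemma wave_measurable [measurable]: "wave a d \<phi> \<in> borel_measurable M"
  unfolding wave_def by measurable

lemma wave_bound: "\<bar>wave a d \<phi> z\<bar> \<le> 1"
  unfolding wave_def by simp

lemma wave_oscillation:
  assumes "xi L w = xi L z"
  shows "\<bar>wave a d \<phi> w - wave a d \<phi> z\<bar> \<le> 2 * pi * (\<bar>a\<bar> + \<bar>d\<bar>) / real p ^ L"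
proof -
  have "\<bar>wave a d \<phi> w - wave a d \<phi> z\<bar> \<le> \<bar>2 * pi * (a * (X w - X z) + d * (Y w - Y z))\<bar>"
    unfolding wave_def by (rule order_trans[OF abs_cos_diff_le]) (simp add: algebra_simps)
  also have "\<dots> = 2 * pi * \<bar>a * (X w - X z) + d * (Y w - Y z)\<bar>" by (simp add: abs_mult)
  also have "\<dots> \<le> 2 * pi * (\<bar>a\<bar> * (1 / real p ^ L) + \<bar>d\<bar> * (1 / real p ^ L))"
  proof (rule mult_left_mono[OF order_trans[OF abs_triangle_ineq]])
    show "\<bar>a * (X w - X z)\<bar> + \<bar>d * (Y w - Y z)\<bar> \<le> \<bar>a\<bar> * (1 / real p ^ L) + \<bar>d\<bar> * (1 / real p ^ L)"
      unfolding abs_mult by (intro add_mono mult_left_mono xi_close[OF assms] abs_ge_zero)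
  qed simp
  finally show ?thesis by (simp add: distrib_left add_divide_distrib)
qed

text \<open>On a cell of level \<open>L\<close> the integer parts of \<open>p ^ L * X\<close> and
  \<open>p ^ L * Y\<close> are constant and contribute a fixed phase \<open>?th\<close>. The rest of
  the \<open>X\<close> part is a character of frequency \<open>a / p ^ L\<close> at time
  \<open>L\<close>; the rest of the \<open>Y\<close> part is at most
  \<open>2 * pi * \<bar>d\<bar> / p ^ L\<close> and is treated as an error.\<close>

lemma wave_prediction:
  "\<bar>ce M (xi L) (wave a d \<phi>) z\<bar> \<le> \<bar>Cc L (a / real p ^ L) z\<bar> + \<bar>Sc L (a / real p ^ L) z\<bar> + 2 * pi * \<bar>d\<bar> / real p ^ L"
proof -
  have pL: "real p ^ L > 0" using p2 by simp
  let ?v = "a / real p ^ L"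
  let ?th = "2 * pi * (?v * real_of_int (col L z) + d / real p ^ L * real_of_int \<lfloor>real p ^ L * Y z\<rfloor>) + \<phi>"
  let ?C = "\<lambda>w. cos (2 * pi * ?v * X ((T ^^ L) w))" and ?S = "\<lambda>w. sin (2 * pi * ?v * X ((T ^^ L) w))"
  have iC: "integrable M ?C" "integrable M ?S" by (rule integrable_bdd[where B=1]; simp)+
  have iw: "integrable M (wave a d \<phi>)" by (rule integrable_bdd[OF wave_measurable wave_bound])
  have "ce M (xi L) (\<lambda>w. cos ?th * ?C w - sin ?th * ?S w) z
      = ce M (xi L) (\<lambda>w. cos ?th * ?C w) z - ce M (xi L) (\<lambda>w. sin ?th * ?S w) z"
    by (rule ce_diff[OF _ _ xi_fpart]) (intro integrable_mult_right iC)+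
  also have "\<dots> = cos ?th * Cc L ?v z - sin ?th * Sc L ?v z"
    unfolding Cc_def Sc_def by (simp only: ce_pull_out[OF depends_on_const])
  finally have eq: "ce M (xi L) (\<lambda>w. cos ?th * ?C w - sin ?th * ?S w) z = cos ?th * Cc L ?v z - sin ?th * Sc L ?v z" .
  have "\<bar>ce M (xi L) (wave a d \<phi>) z - ce M (xi L) (\<lambda>w. cos ?th * ?C w - sin ?th * ?S w) z\<bar> \<le> 2 * pi * \<bar>d\<bar> / real p ^ L"
  proof (rule ce_diff_bound[OF iw _ xi_fpart])
    show "integrable M (\<lambda>w. cos ?th * ?C w - sin ?th * ?S w)"
      by (intro Bochner_Integration.integrable_diff integrable_mult_right iC)
    fix w assume e: "xi L w = xi L z"
    have XL: "a * X w = ?v * real_of_int (col L z) + ?v * X ((T ^^ L) w)"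
    proof -
      have "col L w = col L z" using e unfolding xi_def col_def by simp
      then have "real_of_int (col L z) + X ((T ^^ L) w) = real p ^ L * X w"
        unfolding X_Tn frac_def col_def by linarith
      then have "?v * (real_of_int (col L z) + X ((T ^^ L) w)) = a * X w" using pL p2 by simp
      then show ?thesis by (simp only: distrib_left)
    qed
    have YL: "\<lfloor>real p ^ L * Y w\<rfloor> = \<lfloor>real p ^ L * Y z\<rfloor>" using e unfolding xi_def by simp
    have dY: "d * Y w = d / real p ^ L * real_of_int \<lfloor>real p ^ L * Y z\<rfloor> + d / real p ^ L * frac (real p ^ L * Y w)"
    proof -
      have "real_of_int \<lfloor>real p ^ L * Y z\<rfloor> + frac (real p ^ L * Y w) = real p ^ L * Y w"
        unfolding frac_def YL by linarith
      then have "d / real p ^ L * (real_of_int \<lfloor>real p ^ L * Y z\<rfloor> + frac (real p ^ L * Y w)) = d * Y w" using pL p2 by simp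
      then show ?thesis by (simp only: distrib_left)
    qed
    have "cos ?th * ?C w - sin ?th * ?S w = cos (?th + 2 * pi * ?v * X ((T ^^ L) w))" by (simp only: cos_add)
    then have "\<bar>wave a d \<phi> w - (cos ?th * ?C w - sin ?th * ?S w)\<bar>
        \<le> \<bar>(2 * pi * (a * X w + d * Y w) + \<phi>) - (?th + 2 * pi * ?v * X ((T ^^ L) w))\<bar>"
      unfolding wave_def by (simp only: abs_cos_diff_le)
    also have "\<dots> = \<bar>2 * pi * (d / real p ^ L * frac (real p ^ L * Y w))\<bar>"
      unfolding XL dY by (simp add: algebra_simps)
    also have "\<dots> = 2 * pi * \<bar>d\<bar> / real p ^ L * frac (real p ^ L * Y w)" using pL by (simp add: abs_mult)
    also have "\<dots> \<le> 2 * pi * \<bar>d\<bar> / real p ^ L * 1"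
      using pL frac_lt_1[of "real p ^ L * Y w"] by (intro mult_left_mono) auto
    finally show "\<bar>wave a d \<phi> w - (cos ?th * ?C w - sin ?th * ?S w)\<bar> \<le> 2 * pi * \<bar>d\<bar> / real p ^ L" by simp
  qed (use pL in simp)
  moreover have "\<bar>cos ?th * Cc L ?v z - sin ?th * Sc L ?v z\<bar> \<le> \<bar>Cc L ?v z\<bar> + \<bar>Sc L ?v z\<bar>"
  proof -
    have "\<bar>cos ?th * Cc L ?v z\<bar> \<le> 1 * \<bar>Cc L ?v z\<bar>" "\<bar>sin ?th * Sc L ?v z\<bar> \<le> 1 * \<bar>Sc L ?v z\<bar>"
      unfolding abs_mult by (intro mult_right_mono; simp)+
    then show ?thesis by linarith
  qed
  ultimately show ?thesis unfolding eq by linarith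
qed

text \<open>Subtracting the prediction from the first \<open>L k\<close> digits leaves almost orthogonal terms.\<close>

lemma innovation_lln:
  fixes a d :: "nat \<Rightarrow> real" and L :: "nat \<Rightarrow> nat"
  assumes mono: "\<And>k l. k \<le> l \<Longrightarrow> L k \<le> L l" and C: "0 \<le> C"
    and small: "\<And>k l. k < l \<Longrightarrow> (\<bar>a k\<bar> + \<bar>d k\<bar>) / real p ^ L l \<le> C * (1 / 2) ^ (l - k)"
  shows "AE z in M. (\<lambda>N. (\<Sum>k<N. wave (a k) (d k) \<phi> z - ce M (xi (L k)) (wave (a k) (d k) \<phi>) z) / real N) \<longlonglongrightarrow> 0"
proof -
  let ?X = "\<lambda>k. wave (a k) (d k) \<phi>"
  define E where "E k = ce M (xi (L k)) (?X k)" for k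
  have Em [measurable]: "E k \<in> borel_measurable M" for k unfolding E_def by (rule ce_measurable[OF xi_fpart])
  have Eb: "\<bar>E k z\<bar> \<le> 1" for k z unfolding E_def by (rule ce_bound[OF wave_measurable wave_bound xi_fpart])
  define V where "V k z = ?X k z - E k z" for k z
  have Vm [measurable]: "V k \<in> borel_measurable M" for k unfolding V_def by measurable
  have Vb: "\<bar>V k z\<bar> \<le> 2" for k z using Eb[of k z] wave_bound[of "a k" "d k" \<phi> z] unfolding V_def by linarith
  have iV: "integrable M (V k)" for k by (rule integrable_bdd[OF Vm Vb])
  have cor: "\<bar>\<integral>z. V k z * V l z \<partial>M\<bar> \<le> (4 * pi * C) * (1 / 2) ^ (l - k)" if kl: "k < l" for k l
  proof -
    define e where "e = 2 * pi * (C * (1 / 2) ^ (l - k))"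
    have e0: "0 \<le> e" using C by (simp add: e_def)
    \<comment> \<open>At level \<open>L l\<close> the earlier term \<open>V k\<close> is almost
      known, so it may be replaced by its conditional expectation \<open>h\<close>, and
      \<open>h\<close> is exactly orthogonal to \<open>V l\<close>.\<close>
    define h where "h = ce M (xi (L l)) (V k)"
    have hm [measurable]: "h \<in> borel_measurable M" unfolding h_def by (rule ce_measurable[OF xi_fpart])
    have hb: "\<bar>h z\<bar> \<le> 2" for z unfolding h_def by (rule ce_bound[OF Vm Vb xi_fpart])
    have near: "AE z in M. \<bar>V k z - h z\<bar> \<le> e"
      unfolding h_def
    proof (rule ce_near[OF iV xi_fpart e0])
      fix z w assume x: "xi (L l) w = xi (L l) z"
      have "xi (L k) w = xi (L k) z" by (rule depends_onD[OF xi_mono[OF mono] x]) (use kl in simp)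
      then have "E k w = E k z" unfolding E_def by (rule depends_onD[OF ce_depends])
      then have "\<bar>V k w - V k z\<bar> = \<bar>?X k w - ?X k z\<bar>" unfolding V_def by simp
      also have "\<dots> \<le> 2 * pi * ((\<bar>a k\<bar> + \<bar>d k\<bar>) / real p ^ L l)" using wave_oscillation[OF x] by simp
      also have "\<dots> \<le> e" unfolding e_def using small[OF kl] by (intro mult_left_mono) auto
      finally show "\<bar>V k w - V k z\<bar> \<le> e" .
    qed
    have prod: "integrable M (\<lambda>z. f z * g z)" if [measurable]: "f \<in> borel_measurable M" "g \<in> borel_measurable M"
      and "\<And>z. \<bar>f z\<bar> \<le> B" "\<And>z. \<bar>g z\<bar> \<le> B'" for f g :: "'a \<Rightarrow> real" and B B'
    proof (rule integrable_bdd[where B="B * B'"])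
      fix z show "\<bar>f z * g z\<bar> \<le> B * B'" unfolding abs_mult
        using that order_trans[OF abs_ge_zero that(3)[of z]] by (intro mult_mono) auto
    qed measurable
    have "(\<integral>z. h z * E l z \<partial>M) = (\<integral>z. h z * ?X l z \<partial>M)"
      unfolding E_def h_def by (rule ce_integral[OF wave_measurable wave_bound xi_fpart ce_depends])
    then have hV: "(\<integral>z. h z * V l z \<partial>M) = 0"
      unfolding V_def right_diff_distrib
      using prod[OF hm wave_measurable hb wave_bound] prod[OF hm Em hb Eb] by simp
    have "(\<integral>z. V k z * V l z \<partial>M) = (\<integral>z. (V k z - h z) * V l z \<partial>M)"
      unfolding left_diff_distrib using prod[OF Vm Vm Vb Vb] prod[OF hm Vm hb Vb] hV by simp
    also have "\<bar>\<dots>\<bar> \<le> (\<integral>z. \<bar>(V k z - h z) * V l z\<bar> \<partial>M)" by (rule integral_abs_bound)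
    also have "\<dots> \<le> (\<integral>z. e * 2 \<partial>M)"
    proof (rule integral_mono_AE)
      have "\<bar>V k z - h z\<bar> \<le> 4" for z using Vb[of k z] hb[of z] by linarith
      then show "integrable M (\<lambda>z. \<bar>(V k z - h z) * V l z\<bar>)"
        by (intro integrable_abs prod[OF _ Vm _ Vb]) measurable
      show "AE z in M. \<bar>(V k z - h z) * V l z\<bar> \<le> e * 2"
        using near by eventually_elim (use Vb e0 in \<open>auto simp: abs_mult intro!: mult_mono\<close>)
    qed simp
    finally show ?thesis by (simp add: prob_space e_def mult_ac)
  qed
  have "AE z in M. (\<lambda>N. (\<Sum>k<N. V k z) / real N) \<longlonglongrightarrow> 0"
    by (rule lln_decorrelated[OF Vm Vb _ cor]) (use C in simp)
  then show ?thesis unfolding V_def E_def .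
qed

end

context digits
begin

text \<open>The level of the cell is \<open>\<lfloor>s + k \<beta>\<rfloor>\<close> with \<open>p\<^sup>\<beta> = m\<close>, so the rescaled frequency
  is \<open>v p\<^sup>t\<close> with \<open>t = frac (s + k \<beta>)\<close>, up to the factor \<open>p\<^sup>\<sigma>\<^sup>-\<^sup>s\<close> close to \<open>1\<close>.\<close>

lemma average_small_off_bad_set:
  fixes m b :: nat and u c \<phi> e :: real
  assumes NA: "\<And>e. e > 0 \<Longrightarrow> \<exists>q. \<forall>K. Q K q \<le> e"
    and irr: "ln (real m) / ln (real p) \<notin> \<rat>" and m: "2 \<le> m" and b: "b < m" and u: "0 < u" and e: "0 < e"
  shows "prob {z \<in> space M. \<not> (\<forall>\<^sub>F N in sequentially.
    \<bar>\<Sum>k<N. wave (u * real m ^ k) (c * real b ^ k) \<phi> z\<bar> \<le> 2 * e * real N)} \<le> e"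
proof -
  define \<beta> where "\<beta> = ln (real m) / ln (real p)"
  have lnp: "0 < ln (real p)" and pp: "1 < real p" using p2 by auto
  have \<beta>0: "0 \<le> \<beta>" unfolding \<beta>_def using m lnp by (intro divide_nonneg_nonneg) auto
  have pm: "real p powr (real k * \<beta>) = real m ^ k" for k
  proof -
    have "real p powr (real k * \<beta>) = exp (real k * ln (real m))"
      using pp lnp by (simp add: powr_def \<beta>_def)
    also have "\<dots> = real m ^ k" using m by (simp add: exp_of_nat_mult)
    finally show ?thesis .
  qed
  \<comment> \<open>Chosen so that the threshold \<open>2 * \<tau> + 4 * l\<close> of
    \<open>good_phase\<close> is \<open>e / 4\<close>, one of four equal shares of the
    error.\<close>
  define \<tau> l where "\<tau> = e / 16" and "l = e / 32"
  have \<tau>l: "0 < \<tau>" "0 < l" "2 * \<tau> + 4 * l = e / 4" using e by (auto simp: \<tau>_def l_def)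
  \<comment> \<open>Makes the measure of bad phases in \<open>good_phase\<close> exactly the
    \<open>1 / 4\<close> allowed there.\<close>
  define \<eta> where "\<eta> = \<tau>\<^sup>2 * (l * e) / 4"
  have "0 < \<eta>" using \<tau>l e by (simp add: \<eta>_def)
  then obtain v where v: "0 < v" and en: "\<And>L. integral\<^sup>L unitU (\<lambda>t. energy L (v * real p powr t)) \<le> \<eta>"
    using energy_log_average[OF NA] by blast
  have small: "\<eta> / \<tau>\<^sup>2 / (l * e) \<le> 1 / 4" using \<tau>l e by (simp add: \<eta>_def)
  have "1 < real m" using m by simp
  \<comment> \<open>Finitely many initial terms are dropped so that the starting frequency
    \<open>U\<close> exceeds \<open>v\<close> and its phase \<open>\<sigma>\<close> is
    nonnegative.\<close>
  then obtain k0 where "v / u < real m ^ k0" using real_arch_pow by blast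
  define U where "U = u * real m ^ k0"
  have U: "v \<le> U" "0 < U" using \<open>v / u < real m ^ k0\<close> u v m by (auto simp: U_def pos_divide_less_eq mult.commute)
  define \<sigma> where "\<sigma> = log (real p) (U / v)"
  have \<sigma>: "0 \<le> \<sigma>" "v * real p powr \<sigma> = U"
    unfolding \<sigma>_def using U v pp by (auto simp: powr_log_cancel)
  \<comment> \<open>Lipschitz constant in the phase: two coefficients, each moving by
    \<open>2 * pi\<close> times the change of frequency, and frequencies \<open>v * p powr x\<close>
    below \<open>v * p\<close>. \<open>A\<close> then makes the window so short that it costs at
    most \<open>e / 4\<close>.\<close>
  define D where "D = 4 * pi * v * real p * ln (real p)"
  have D: "0 < D" using v pp lnp by (simp add: D_def)
  obtain A0 :: nat where A0: "2 * D / e < real A0" using reals_Archimedean2 by blast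
  define A where "A = Suc A0"
  have A: "0 < A" "D * (1 / (2 * real A)) \<le> e / 4" using A0 e D by (auto simp: A_def field_simps)
  obtain s N0 where s: "s \<in> {\<sigma>..<\<sigma> + 1 / (2 * real A)}"
    and bad: "\<And>N. prob {z \<in> space M. \<exists>n\<in>{N0..N}. (\<Sum>k<n. pred_size \<beta> v s k z) > (2 * \<tau> + 4 * l) * real n} \<le> e"
    by (rule good_phase[OF en \<tau>l(1,2) e small irr[folded \<beta>_def] \<beta>0 \<sigma>(1) A(1)]) (rule that)
  have s0: "0 \<le> s" using s \<sigma> by simp
  define L where "L k = nat \<lfloor>s + real k * \<beta>\<rfloor>" for k
  define t where "t k = frac (s + real k * \<beta>)" for k
  have t01: "0 \<le> t k" "t k < 1" for k by (auto simp: t_def frac_lt_1)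
  have Lt: "real (L k) + t k = s + real k * \<beta>" for k
    unfolding L_def t_def frac_def using s0 \<beta>0 by simp
  have Lmono: "L k \<le> L k'" if "k \<le> k'" for k k'
    unfolding L_def using that \<beta>0 by (intro nat_mono floor_mono add_left_mono mult_right_mono) auto
  have pL: "real p ^ L k = real p powr real (L k)" "0 < real p ^ L k" for k using pp by (auto simp: powr_realpow)
  \<comment> \<open>From \<open>k * \<beta> = L k + t k - s < L k + 1\<close>, as
    \<open>s \<ge> 0\<close>; so the side of a cell is at most \<open>p\<close> times
    \<open>m\<^sup>-\<^sup>k\<close>.\<close>
  have mL: "real m ^ k / real p ^ L k \<le> real p" for k
  proof -
    have "real m ^ k \<le> real p powr (1 + real (L k))"
      unfolding pm[symmetric] using Lt[of k] t01[of k] s0 pp by (intro powr_mono) auto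
    also have "\<dots> = real p * real p ^ L k" using pp by (simp add: powr_add pL)
    finally show ?thesis using pL(2)[of k] by (simp add: pos_divide_le_eq)
  qed
  define a d where "a k = U * real m ^ k" and "d k = c * real b ^ k0 * real b ^ k" for k
  define c' where "c' = \<bar>c * real b ^ k0\<bar>"
  have dle: "\<bar>d k\<bar> = c' * real b ^ k" for k by (simp add: d_def c'_def abs_mult)
  define C where "C = (U + c') * real p"
  have C0: "0 \<le> C" using U by (simp add: C_def c'_def)
  have dec: "(\<bar>a k\<bar> + \<bar>d k\<bar>) / real p ^ L n \<le> C * (1 / 2) ^ (n - k)" if kn: "k < n" for k n
  proof -
    have "\<bar>a k\<bar> + \<bar>d k\<bar> \<le> (U + c') * real m ^ k"
    proof -
      have "c' * real b ^ k \<le> c' * real m ^ k" using b by (intro mult_left_mono power_mono) (auto simp: c'_def)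
      then show ?thesis unfolding dle using U by (simp add: a_def distrib_right)
    qed
    then have "(\<bar>a k\<bar> + \<bar>d k\<bar>) / real p ^ L n \<le> (U + c') * real m ^ k / real p ^ L n"
      using pL(2)[of n] by (intro divide_right_mono) auto
    also have "\<dots> = (U + c') * (real m ^ n / real p ^ L n) * (real m ^ k / real m ^ n)" using m by simp
    also have "\<dots> \<le> (U + c') * real p * (1 / 2) ^ (n - k)"
    proof (intro mult_mono mult_left_mono mL)
      have "real m ^ k / real m ^ n = (1 / real m) ^ (n - k)"
        using kn m by (simp add: power_diff power_divide)
      also have "\<dots> \<le> (1 / 2) ^ (n - k)" using m by (intro power_mono divide_left_mono) auto
      finally show "real m ^ k / real m ^ n \<le> (1 / 2) ^ (n - k)" .
    qed (use U pp in \<open>auto simp: c'_def\<close>)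
    finally show ?thesis unfolding C_def .
  qed
  let ?X = "\<lambda>k. wave (a k) (d k) \<phi>"
  let ?E = "\<lambda>k. ce M (xi (L k)) (?X k)"
  have lln: "AE z in M. (\<lambda>N. (\<Sum>k<N. ?X k z - ?E k z) / real N) \<longlonglongrightarrow> 0"
    by (rule innovation_lln[of L C a d \<phi>]) (use Lmono C0 dec in auto)
  define r where "r = real b / real m"
  have r: "0 \<le> r" "r < 1" using b by (auto simp: r_def)
  have pred: "\<bar>?E k z\<bar> \<le> pred_size \<beta> v s k z + e / 4 + 2 * pi * c' * real p * r ^ k" for k z
  proof -
    let ?y = "v * real p powr t k"
    have ay: "a k / real p ^ L k = ?y * real p powr (\<sigma> - s)"
    proof -
      have "a k / real p ^ L k = v * real p powr \<sigma> * real p powr (real k * \<beta>) / real p powr real (L k)"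
        unfolding a_def pm pL(1)[symmetric] \<sigma>(2) by (rule refl)
      also have "\<dots> = v * real p powr (\<sigma> + real k * \<beta> - real (L k))" by (simp add: powr_add powr_diff)
      also have "\<sigma> + real k * \<beta> - real (L k) = t k + (\<sigma> - s)" using Lt[of k] by simp
      finally show ?thesis by (simp add: powr_add)
    qed
    have "\<bar>a k / real p ^ L k - ?y\<bar> \<le> v * real p * (ln (real p) * (1 / (2 * real A)))"
    proof -
      have x: "0 \<le> s - \<sigma>" "s - \<sigma> \<le> 1 / (2 * real A)" using s by auto
      have "real p powr (\<sigma> - s) = exp (- ((s - \<sigma>) * ln (real p)))" using pp by (simp add: powr_def algebra_simps)
      then have "1 - (s - \<sigma>) * ln (real p) \<le> real p powr (\<sigma> - s)"
        using exp_ge_add_one_self[of "- ((s - \<sigma>) * ln (real p))"] by simp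
      moreover have "real p powr (\<sigma> - s) \<le> real p powr 0" using x pp by (intro powr_mono) auto
      ultimately have 1: "\<bar>real p powr (\<sigma> - s) - 1\<bar> \<le> (s - \<sigma>) * ln (real p)" using pp by simp
      have 2: "(s - \<sigma>) * ln (real p) \<le> ln (real p) * (1 / (2 * real A))"
        using mult_right_mono[OF x(2), of "ln (real p)"] lnp by (simp add: mult.commute)
      have "real p powr t k \<le> real p powr 1" using t01[of k] pp by (intro powr_mono) auto
      then have 3: "?y \<le> v * real p" using v pp by simp
      have "a k / real p ^ L k - ?y = ?y * (real p powr (\<sigma> - s) - 1)" unfolding ay by (simp add: algebra_simps)
      then have "\<bar>a k / real p ^ L k - ?y\<bar> = ?y * \<bar>real p powr (\<sigma> - s) - 1\<bar>" using v by (simp add: abs_mult)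
      also have "\<dots> \<le> v * real p * (ln (real p) * (1 / (2 * real A)))"
        using 1 2 3 v pp by (intro mult_mono) auto
      finally show ?thesis .
    qed
    then have "4 * pi * \<bar>a k / real p ^ L k - ?y\<bar> \<le> 4 * pi * (v * real p * (ln (real p) * (1 / (2 * real A))))"
      by (intro mult_left_mono) auto
    also have "\<dots> = D * (1 / (2 * real A))" by (simp add: D_def)
    finally have q: "4 * pi * \<bar>a k / real p ^ L k - ?y\<bar> \<le> e / 4" using A(2) by linarith
    have "2 * pi * \<bar>d k\<bar> / real p ^ L k \<le> 2 * pi * c' * real p * r ^ k"
    proof -
      have "2 * pi * \<bar>d k\<bar> / real p ^ L k = 2 * pi * c' * r ^ k * (real m ^ k / real p ^ L k)"
        using m unfolding dle r_def by (simp add: power_divide)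
      also have "\<dots> \<le> 2 * pi * c' * r ^ k * real p"
        using r by (intro mult_left_mono mL) (auto simp: c'_def)
      finally show ?thesis by (simp add: mult_ac)
    qed
    moreover have "\<bar>Cc (L k) (a k / real p ^ L k) z\<bar> \<le> \<bar>Cc (L k) ?y z\<bar> + 2 * pi * \<bar>a k / real p ^ L k - ?y\<bar>"
      using CS_Lipschitz(1)[of "L k" "a k / real p ^ L k" z ?y] by linarith
    moreover have "\<bar>Sc (L k) (a k / real p ^ L k) z\<bar> \<le> \<bar>Sc (L k) ?y z\<bar> + 2 * pi * \<bar>a k / real p ^ L k - ?y\<bar>"
      using CS_Lipschitz(2)[of "L k" "a k / real p ^ L k" z ?y] by linarith
    moreover have "pred_size \<beta> v s k z = \<bar>Cc (L k) ?y z\<bar> + \<bar>Sc (L k) ?y z\<bar>"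
      unfolding pred_size_def L_def t_def by (rule refl)
    ultimately show ?thesis using wave_prediction[of "L k" "a k" "d k" \<phi> z] q by linarith
  qed
  \<comment> \<open>The \<open>Y\<close> errors form a geometric series with ratio
    \<open>b / m < 1\<close>; their total is at most \<open>G\<close>, eventually below
    \<open>e / 4 * N\<close>.\<close>
  define G where "G = 2 * pi * c' * real p / (1 - r)"
  have geo: "(\<Sum>k<N. 2 * pi * c' * real p * r ^ k) \<le> G" for N
  proof -
    have "(\<Sum>k<N. r ^ k) \<le> 1 / (1 - r)"
      using r by (simp add: sum_gp_strict divide_right_mono)
    then have "2 * pi * c' * real p * (\<Sum>k<N. r ^ k) \<le> 2 * pi * c' * real p * (1 / (1 - r))"
      by (intro mult_left_mono) (auto simp: c'_def)
    then show ?thesis unfolding G_def by (simp add: sum_distrib_left)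
  qed
  define B where "B N = {z \<in> space M. \<exists>n\<in>{N0..N}. (\<Sum>k<n. pred_size \<beta> v s k z) > (2 * \<tau> + 4 * l) * real n}" for N
  have Bm [measurable]: "B N \<in> sets M" for N unfolding B_def by measurable
  have "incseq B" unfolding incseq_def B_def by fastforce
  then have "(\<lambda>N. prob (B N)) \<longlonglongrightarrow> prob (\<Union>N. B N)" by (intro finite_Lim_measure_incseq) auto
  then have Bp: "prob (\<Union>N. B N) \<le> e" by (rule LIMSEQ_le_const2) (use bad in \<open>auto simp: B_def\<close>)
  let ?W = "\<lambda>k. wave (u * real m ^ k) (c * real b ^ k) \<phi>"
  have WX: "?W (k0 + k) = ?X k" for k by (simp add: a_def d_def U_def power_add mult.assoc)
  have ev: "AE z in M. z \<notin> (\<Union>N. B N) \<longrightarrow> (\<forall>\<^sub>F N in sequentially. \<bar>\<Sum>k<N. ?W k z\<bar> \<le> 2 * e * real N)"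
    using lln AE_space
  proof eventually_elim
    case (elim z)
    show ?case
    proof
      assume nB: "z \<notin> (\<Union>N. B N)"
      have ps: "(\<Sum>k<n. pred_size \<beta> v s k z) \<le> e / 4 * real n" if "N0 \<le> n" for n
      proof -
        have "z \<notin> B n" using nB by blast
        then have "\<not> (\<Sum>k<n. pred_size \<beta> v s k z) > (2 * \<tau> + 4 * l) * real n"
          using elim(2) that unfolding B_def by auto
        then show ?thesis unfolding \<tau>l(3) by simp
      qed
      have ev1: "\<forall>\<^sub>F N in sequentially. \<bar>(\<Sum>k<N. ?X k z - ?E k z) / real N\<bar> < e / 4"
        using tendstoD[OF elim(1), of "e / 4"] e by (simp add: dist_real_def)
      obtain N2 :: nat where N2: "4 * G / e < real N2" using reals_Archimedean2 by blast
      have "\<forall>\<^sub>F N in sequentially. \<bar>\<Sum>k<N. ?X k z\<bar> \<le> e * real N"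
        using ev1 eventually_ge_at_top[of N0] eventually_ge_at_top[of N2] eventually_gt_at_top[of 0]
      proof eventually_elim
        case (elim N)
        have 1: "\<bar>\<Sum>k<N. ?X k z - ?E k z\<bar> \<le> e / 4 * real N"
          using elim(1,4) by (simp add: abs_divide pos_divide_less_eq)
        have "\<bar>\<Sum>k<N. ?E k z\<bar> \<le> (\<Sum>k<N. pred_size \<beta> v s k z + e / 4 + 2 * pi * c' * real p * r ^ k)"
          by (rule order_trans[OF sum_abs sum_mono]) (rule pred)
        also have "\<dots> = (\<Sum>k<N. pred_size \<beta> v s k z) + e / 4 * real N + (\<Sum>k<N. 2 * pi * c' * real p * r ^ k)"
          by (simp add: sum.distrib)
        finally have 2: "\<bar>\<Sum>k<N. ?E k z\<bar> \<le> e / 4 * real N + e / 4 * real N + G"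
          using ps[OF elim(2)] geo[of N] by linarith
        have "4 * G / e \<le> real N" using N2 elim(3) by linarith
        then have 3: "G \<le> e / 4 * real N" using e by (simp add: pos_divide_le_eq mult.commute)
        have "(\<Sum>k<N. ?X k z) = (\<Sum>k<N. ?X k z - ?E k z) + (\<Sum>k<N. ?E k z)" by (simp add: sum_subtractf)
        then show ?case using 1 2 3 by linarith
      qed
      then obtain N3 where N3: "\<And>N. N3 \<le> N \<Longrightarrow> \<bar>\<Sum>k<N. ?X k z\<bar> \<le> e * real N"
        unfolding eventually_sequentially by blast
      \<comment> \<open>From \<open>N4\<close> on the \<open>k0\<close> dropped terms, each at most
        \<open>1\<close>, are worth at most \<open>e * N\<close>; this is the second
        \<open>e\<close> in \<open>2 * e\<close>.\<close>
      obtain N4 :: nat where N4: "real k0 / e < real N4" using reals_Archimedean2 by blast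
      have "\<bar>\<Sum>k<N. ?W k z\<bar> \<le> 2 * e * real N" if N: "N \<ge> k0 + N3 + N4" for N
      proof -
        obtain n where n: "N = k0 + n" "N3 \<le> n" using N by (metis add.assoc le_Suc_ex le_add1 trans_le_add1)
        have split: "(\<Sum>k<k0 + n. ?W k z) = (\<Sum>k<k0. ?W k z) + (\<Sum>k<n. ?W (k0 + k) z)" for n
          by (induction n) simp_all
        have "\<bar>\<Sum>k<k0. ?W k z\<bar> \<le> (\<Sum>k<k0. 1)"
          by (rule order_trans[OF sum_abs sum_mono]) (rule wave_bound)
        then have 1: "\<bar>\<Sum>k<k0. ?W k z\<bar> \<le> real k0" by simp
        have 2: "\<bar>\<Sum>k<n. ?W (k0 + k) z\<bar> \<le> e * real n" unfolding WX by (rule N3[OF n(2)])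
        have "real k0 / e \<le> real N" using N4 N by linarith
        then have 3: "real k0 \<le> e * real N" using e by (simp add: pos_divide_le_eq mult.commute)
        have 4: "e * real n \<le> e * real N" using n e by (intro mult_left_mono) auto
        have 5: "(\<Sum>k<N. ?W k z) = (\<Sum>k<k0. ?W k z) + (\<Sum>k<n. ?W (k0 + k) z)"
          unfolding n(1) by (rule split)
        have 6: "2 * e * real N = e * real N + e * real N" by simp
        show ?thesis unfolding 5 6 using 1 2 3 4 by linarith
      qed
      then show "\<forall>\<^sub>F N in sequentially. \<bar>\<Sum>k<N. ?W k z\<bar> \<le> 2 * e * real N"
        unfolding eventually_sequentially by blast
    qed
  qed
  have "prob {z \<in> space M. \<not> (\<forall>\<^sub>F N in sequentially. \<bar>\<Sum>k<N. ?W k z\<bar> \<le> 2 * e * real N)} \<le> prob (\<Union>N. B N)"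
  proof (rule finite_measure_mono_AE)
    show "AE z in M. z \<in> {z \<in> space M. \<not> (\<forall>\<^sub>F N in sequentially. \<bar>\<Sum>k<N. ?W k z\<bar> \<le> 2 * e * real N)} \<longrightarrow> z \<in> (\<Union>N. B N)"
      using ev by eventually_elim blast
  qed measurable
  then show ?thesis using Bp by linarith
qed

text \<open>For tolerance \<open>e\<close> the exceptional set has probability at most
  \<open>e\<close>, and it only grows when the tolerance shrinks. Hence for a fixed tolerance it
  lies inside exceptional sets of arbitrarily small probability and is null.\<close>

theorem wave_average_tendsto_0:
  fixes m b :: nat and u c \<phi> :: real
  assumes NA: "\<And>e. e > 0 \<Longrightarrow> \<exists>q. \<forall>K. Q K q \<le> e"
    and irr: "ln (real m) / ln (real p) \<notin> \<rat>" and m: "2 \<le> m" and b: "b < m" and u: "0 < u"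
  shows "AE z in M. (\<lambda>N. (\<Sum>k<N. wave (u * real m ^ k) (c * real b ^ k) \<phi> z) / real N) \<longlonglongrightarrow> 0"
proof -
  let ?S = "\<lambda>N z. \<Sum>k<N. wave (u * real m ^ k) (c * real b ^ k) \<phi> z"
  define R where "R e z \<longleftrightarrow> (\<forall>\<^sub>F N in sequentially. \<bar>?S N z\<bar> \<le> 2 * e * real N)" for e z
  have [measurable]: "Measurable.pred M (R e)" for e unfolding R_def eventually_sequentially by measurable
  have Rp: "prob {z \<in> space M. \<not> R e z} \<le> e" if "0 < e" for e
    unfolding R_def by (rule average_small_off_bad_set[OF NA irr m b u that])
  have Rmono: "R e z" if "R e' z" "e' \<le> e" for e e' z
    using that(1) unfolding R_def
  proof eventually_elim
    case (elim N)
    have "2 * e' * real N \<le> 2 * e * real N" using that(2) by (intro mult_right_mono) auto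
    then show ?case using elim by linarith
  qed
  have R: "AE z in M. R e z" if e: "0 < e" for e
  proof -
    have "prob {z \<in> space M. \<not> R e z} \<le> 0"
    proof (rule field_le_epsilon)
      fix x :: real assume x: "0 < x"
      have "prob {z \<in> space M. \<not> R e z} \<le> prob {z \<in> space M. \<not> R (min x e) z}"
        by (rule finite_measure_mono) (use Rmono[of "min x e" _ e] in auto)
      also have "\<dots> \<le> min x e" using x e by (intro Rp) simp
      finally show "prob {z \<in> space M. \<not> R e z} \<le> 0 + x" by simp
    qed
    then have "prob {z \<in> space M. \<not> R e z} = 0" using measure_nonneg[of M] by (intro antisym) auto
    then show ?thesis by (subst (asm) prob_eq_0) auto
  qed
  have "AE z in M. \<forall>j. R (1 / real (Suc j)) z" unfolding AE_all_countable by (intro allI R) simp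
  then show ?thesis
  proof eventually_elim
    case (elim z)
    show ?case
    proof (rule LIMSEQ_I)
      fix x :: real assume "0 < x"
      then obtain j :: nat where j: "1 / real (Suc j) < x / 2" using nat_approx_posE[of "x/2"] by force
      have "\<forall>\<^sub>F N in sequentially. \<bar>?S N z\<bar> \<le> 2 * (1 / real (Suc j)) * real N" using elim unfolding R_def by blast
      then have "\<forall>\<^sub>F N in sequentially. \<bar>?S N z / real N\<bar> < x"
        using eventually_gt_at_top[of 0]
      proof eventually_elim
        case (elim N)
        have "2 * (1 / real (Suc j)) * real N < x * real N" using j elim(2) by (intro mult_strict_right_mono) auto
        then have "\<bar>?S N z\<bar> < x * real N" using elim(1) by linarith
        then show ?case using elim(2) by (simp add: abs_divide pos_divide_less_eq)
      qed
      then show "\<exists>N0. \<forall>N\<ge>N0. norm (?S N z / real N - 0) < x" by (auto simp: eventually_sequentially)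
    qed
  qed
qed

end

section \<open>Hausdorff dimension of projections\<close>

text \<open>Doubly indexed covers suit the lifting argument, where each set of a cover is replaced
  by a whole family of cells; the pairing function turns them into the sequences of
  \<open>hausdorff_content\<close>.\<close>

lemma hausdorff_measure_zeroI:
  fixes A :: "'a::metric_space set"
  assumes "\<And>\<delta> \<eta> :: real. 0 < \<delta> \<Longrightarrow> 0 < \<eta> \<Longrightarrow> \<exists>W :: nat \<Rightarrow> nat \<Rightarrow> 'a set. A \<subseteq> (\<Union>i j. W i j)
      \<and> (\<forall>i j. bounded (W i j) \<and> diameter (W i j) \<le> \<delta>)
      \<and> (\<Sum>i. \<Sum>j. ennreal (diameter (W i j) powr s)) \<le> ennreal \<eta>"
  shows "hausdorff_measure s A = 0"
proof -
  have le: "hausdorff_content s \<delta> A \<le> 0 + ennreal \<eta>" if pos: "0 < \<delta>" "0 < \<eta>" for \<delta> \<eta>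
  proof -
    obtain W :: "nat \<Rightarrow> nat \<Rightarrow> 'a set" where W: "A \<subseteq> (\<Union>i j. W i j)"
      "\<And>i j. bounded (W i j)" "\<And>i j. diameter (W i j) \<le> \<delta>"
      "(\<Sum>i. \<Sum>j. ennreal (diameter (W i j) powr s)) \<le> ennreal \<eta>"
      using assms[OF pos] by blast
    define U where "U k = case_prod W (prod_decode k)" for k
    have "A \<subseteq> (\<Union>k. U k)"
    proof
      fix x assume "x \<in> A"
      then obtain i j where "x \<in> W i j" using W(1) by blast
      then have "x \<in> U (prod_encode (i, j))" by (simp add: U_def)
      then show "x \<in> (\<Union>k. U k)" by blast
    qed
    moreover have "bounded (U k) \<and> diameter (U k) \<le> \<delta>" for k
      unfolding U_def using W(2,3) by (simp add: case_prod_beta)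
    ultimately have "hausdorff_content s \<delta> A \<le> (\<Sum>k. ennreal (diameter (U k) powr s))"
      unfolding hausdorff_content_def by (intro INF_lower) auto
    also have "\<dots> = (\<Sum>i. \<Sum>j. ennreal (diameter (W i j) powr s))"
    proof -
      let ?f = "\<lambda>x. ennreal (diameter (case_prod W x) powr s)"
      have "(\<Sum>k. ?f (prod_decode k)) = (\<Sum>i. \<Sum>j. ?f (i, j))"
        by (rule suminf_ennreal_2dimen) (rule refl)
      then show ?thesis unfolding U_def by (simp only: prod.case)
    qed
    finally show ?thesis using W(4) by simp
  qed
  have "hausdorff_content s \<delta> A \<le> 0" if "0 < \<delta>" for \<delta>
    by (rule ennreal_le_epsilon) (rule le[OF that])
  then have "hausdorff_measure s A \<le> 0" unfolding hausdorff_measure_def by (intro SUP_least) simp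
  then show ?thesis by simp
qed

lemma finite_fibre_sum_le:
  fixes Z :: "'a::metric_space set" and lab :: "'a \<Rightarrow> nat"
  assumes fin: "finite (lab ` Z)" and card: "real (card (lab ` Z)) \<le> N" and r: "0 \<le> r" "0 < s"
    and bdd: "\<And>j. bounded {z \<in> Z. lab z = j}" and diam: "\<And>j. diameter {z \<in> Z. lab z = j} \<le> r"
  shows "(\<Sum>j. ennreal (diameter {z \<in> Z. lab z = j} powr s)) \<le> ennreal (N * r powr s)"
proof -
  \<comment> \<open>Empty fibres have diameter \<open>0\<close>, and \<open>0 powr s = 0\<close>, so
    the series is a finite sum.\<close>
  have out: "ennreal (diameter {z \<in> Z. lab z = j} powr s) = 0" if "j \<notin> lab ` Z" for j
  proof -
    have "{z \<in> Z. lab z = j} = {}" using that by auto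
    then show ?thesis by (simp only: diameter_def) simp
  qed
  have "(\<Sum>j. ennreal (diameter {z \<in> Z. lab z = j} powr s)) = (\<Sum>j\<in>lab ` Z. ennreal (diameter {z \<in> Z. lab z = j} powr s))"
    by (rule suminf_finite[OF fin out])
  also have "\<dots> \<le> (\<Sum>j\<in>lab ` Z. ennreal (r powr s))"
    by (intro sum_mono ennreal_leI powr_mono2 diameter_ge_0 bdd diam) (use r in simp)
  also have "\<dots> = ennreal (real (card (lab ` Z)) * r powr s)"
    by (simp add: ennreal_of_nat_eq_real_of_nat ennreal_mult')
  also have "\<dots> \<le> ennreal (N * r powr s)" by (intro ennreal_leI mult_right_mono card) simp
  finally show ?thesis .
qed

text \<open>Ensures that the infimum defining \<open>hausdorff_dim\<close> of a set of reals runs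
  over a nonempty set. A unit interval cut into \<open>m\<close> pieces contributes
  \<open>m * (1 / m)\<^sup>2 = 1 / m\<close>, which is as small as desired.\<close>

lemma hausdorff_measure_real_2: "hausdorff_measure 2 (A :: real set) = 0"
proof (rule hausdorff_measure_zeroI)
  fix \<delta> \<eta> :: real assume pos: "0 < \<delta>" "0 < \<eta>"
  \<comment> \<open>The first summand keeps the contribution of unit interval number
    \<open>k\<close> below \<open>\<eta> * (1 / 2) ^ Suc k\<close>, the second keeps the mesh below
    \<open>\<delta>\<close>.\<close>
  define m where "m k = nat \<lceil>2 ^ (k + 1) / \<eta> + 1 / \<delta>\<rceil> + 1" for k :: nat
  have m: "2 ^ (k + 1) / \<eta> \<le> real (m k)" "1 / \<delta> \<le> real (m k)" "0 < m k" for k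
  proof -
    have "2 ^ (k + 1) / \<eta> + 1 / \<delta> \<le> real (m k)" unfolding m_def by linarith
    moreover have "0 \<le> 2 ^ (k + 1) / \<eta>" "0 \<le> 1 / \<delta>" using pos by auto
    ultimately show "2 ^ (k + 1) / \<eta> \<le> real (m k)" "1 / \<delta> \<le> real (m k)" by linarith+
  qed (simp add: m_def)
  define W where "W k j = {x. \<lfloor>x\<rfloor> = int_decode k \<and> nat \<lfloor>real (m k) * frac x\<rfloor> = j}" for k j
  have close: "dist x y \<le> 1 / real (m k)" if "x \<in> W k j" "y \<in> W k j" for x y k j
  proof -
    have fl: "\<lfloor>x\<rfloor> = \<lfloor>y\<rfloor>" "nat \<lfloor>real (m k) * frac x\<rfloor> = nat \<lfloor>real (m k) * frac y\<rfloor>" using that by (auto simp: W_def)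
    moreover have "0 \<le> \<lfloor>real (m k) * frac x\<rfloor>" "0 \<le> \<lfloor>real (m k) * frac y\<rfloor>" by auto
    ultimately have "\<lfloor>real (m k) * frac x\<rfloor> = \<lfloor>real (m k) * frac y\<rfloor>" by linarith
    then have "\<bar>real (m k) * frac x - real (m k) * frac y\<bar> \<le> 1" by linarith
    moreover have "real (m k) * frac x - real (m k) * frac y = real (m k) * (x - y)"
      using fl(1) by (simp add: frac_def algebra_simps)
    ultimately have "real (m k) * \<bar>x - y\<bar> \<le> 1" by (simp add: abs_mult)
    then show ?thesis using m(3)[of k] by (simp add: dist_real_def pos_le_divide_eq mult.commute)
  qed
  have bdd: "bounded (W k j)" for k j
    unfolding bounded_def using close[of _ k j] by (metis)
  have dia: "diameter (W k j) \<le> 1 / real (m k)" for k j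
    by (rule diameter_le) (use close in \<open>auto simp: dist_norm\<close>)
  have d\<delta>: "1 / real (m k) \<le> \<delta>" for k
    using m(2,3)[of k] pos by (simp add: field_simps)
  have row: "(\<Sum>j. ennreal (diameter (W k j) powr 2)) \<le> ennreal (\<eta> * (1 / 2) ^ Suc k)" for k
  proof -
    have emp: "W k j = {}" if "j \<notin> {..<m k}" for j
    proof -
      have "nat \<lfloor>real (m k) * frac x\<rfloor> < m k" for x
      proof -
        have "real (m k) * frac x < real (m k) * 1" using m(3)[of k] frac_lt_1[of x] by (intro mult_strict_left_mono) auto
        then have "\<lfloor>real (m k) * frac x\<rfloor> < int (m k)" by (simp add: floor_less_iff)
        then show ?thesis using m(3)[of k] by linarith
      qed
      then show ?thesis unfolding W_def using that by auto
    qed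
    have "(\<Sum>j. ennreal (diameter (W k j) powr 2)) = (\<Sum>j<m k. ennreal (diameter (W k j) powr 2))"
      by (rule suminf_finite) (auto simp: emp diameter_def)
    also have "\<dots> \<le> (\<Sum>j<m k. ennreal ((1 / real (m k)) powr 2))"
      by (intro sum_mono ennreal_leI powr_mono2 dia diameter_ge_0 bdd) simp
    also have "\<dots> = ennreal (1 / real (m k))"
      using m(3)[of k] by (simp add: ennreal_of_nat_eq_real_of_nat ennreal_mult'[symmetric] powr_numeral power2_eq_square)
    also have "\<dots> \<le> ennreal (\<eta> * (1 / 2) ^ Suc k)"
    proof (rule ennreal_leI)
      have "2 ^ (k + 1) \<le> real (m k) * \<eta>" using m(1)[of k] pos by (simp add: pos_divide_le_eq)
      then show "1 / real (m k) \<le> \<eta> * (1 / 2) ^ Suc k" using m(3)[of k] by (simp add: field_simps)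
    qed
    finally show ?thesis .
  qed
  have "(\<Sum>k. \<Sum>j. ennreal (diameter (W k j) powr 2)) \<le> (\<Sum>k. ennreal (\<eta> * (1 / 2) ^ Suc k))"
    by (intro suminf_le row) auto
  also have "\<dots> = ennreal (\<Sum>k. \<eta> * (1 / 2) ^ Suc k)"
    by (rule suminf_ennreal2) (use pos power_half_series in \<open>auto intro!: summable_mult sums_summable\<close>)
  also have "(\<Sum>k. \<eta> * (1 / 2) ^ Suc k) = \<eta>"
    using sums_mult[OF power_half_series, of \<eta>] by (simp add: sums_unique[symmetric])
  finally have "(\<Sum>k. \<Sum>j. ennreal (diameter (W k j) powr 2)) \<le> ennreal \<eta>" .
  moreover have "A \<subseteq> (\<Union>k j. W k j)"
  proof
    fix x
    have "x \<in> W (int_encode \<lfloor>x\<rfloor>) (nat \<lfloor>real (m (int_encode \<lfloor>x\<rfloor>)) * frac x\<rfloor>)" by (simp add: W_def)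
    then show "x \<in> (\<Union>k j. W k j)" by blast
  qed
  ultimately show "\<exists>W :: nat \<Rightarrow> nat \<Rightarrow> real set. A \<subseteq> (\<Union>i j. W i j)
      \<and> (\<forall>i j. bounded (W i j) \<and> diameter (W i j) \<le> \<delta>)
      \<and> (\<Sum>i. \<Sum>j. ennreal (diameter (W i j) powr 2)) \<le> ennreal \<eta>"
    using bdd order_trans[OF dia d\<delta>] by blast
qed

lemma (in mpt) mpt_power: "mpt M (T ^^ q)"
  by unfold_locales (rule Tn_meas, rule Tn_inv)

section \<open>Bad blocks and the number of cells in a strip\<close>

context digits
begin

text \<open>Two different columns of one cell cannot both have conditional probability above
  \<open>1 / 2\<close>; with this threshold a block that is not bad is determined by its
  cell.\<close>

definition bad :: "nat \<Rightarrow> nat \<Rightarrow> 'a \<Rightarrow> bool" where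
  "bad K q z \<longleftrightarrow> g K q z \<le> 1 / 2"

lemma bad_pred [measurable]: "Measurable.pred M (bad K q)"
  unfolding bad_def by measurable

lemma good_column_unique:
  assumes e: "xi K y = xi K w" and "\<not> bad K q y" "\<not> bad K q w"
  shows "col q ((T ^^ K) y) = col q ((T ^^ K) w)"
proof (rule ccontr)
  let ?c = "col q ((T ^^ K) y)" and ?d = "col q ((T ^^ K) w)"
  assume ne: "?c \<noteq> ?d"
  note [measurable] = xi_fpart
  have "colprob K q ?d y = colprob K q ?d w" by (rule depends_onD[OF colprob_depends e])
  then have gt: "1 < colprob K q ?c y + colprob K q ?d y" using assms(2,3) unfolding bad_def g_def by linarith
  let ?f = "\<lambda>x u. of_bool (col q ((T ^^ K) u) = x) :: real"
  have i: "integrable M (?f x)" for x by (rule integrable_bdd[where B=1]) auto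
  have "colprob K q ?c y - colprob K q ?d y + 2 * colprob K q ?d y \<le> 1"
  proof -
    have "ce M (xi K) (\<lambda>u. \<Sum>x\<in>{?c, ?d}. ?f x u) y = (\<Sum>x\<in>{?c, ?d}. ce M (xi K) (?f x) y)"
      by (rule ce_sum[OF i xi_fpart])
    also have "\<dots> = colprob K q ?c y + colprob K q ?d y" unfolding colprob_def using ne by simp
    finally have "ce M (xi K) (\<lambda>u. \<Sum>x\<in>{?c, ?d}. ?f x u) y = colprob K q ?c y + colprob K q ?d y" .
    moreover have "\<bar>ce M (xi K) (\<lambda>u. \<Sum>x\<in>{?c, ?d}. ?f x u) y\<bar> \<le> 1"
    proof (rule ce_bound[OF _ _ xi_fpart])
      fix u
      have "(\<Sum>x\<in>{?c, ?d}. ?f x u) = ?f ?c u + ?f ?d u" using ne by (subst sum.insert) auto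
      also have "\<bar>\<dots>\<bar> \<le> 1" using ne by (auto simp: of_bool_def)
      finally show "\<bar>\<Sum>x\<in>{?c, ?d}. ?f x u\<bar> \<le> 1" .
    qed measurable
    ultimately show ?thesis by simp
  qed
  then show False using gt by simp
qed

text \<open>Blocks are consecutive: block \<open>r\<close> consists of the \<open>q\<close> digits
  after position \<open>K + r * q\<close>, and \<open>bad\<close> at time \<open>r * q\<close>
  concerns its prediction from the \<open>K\<close> digits just before.\<close>

definition nbad :: "nat \<Rightarrow> nat \<Rightarrow> nat \<Rightarrow> 'a \<Rightarrow> nat" where
  "nbad K q n z = (\<Sum>r<n. of_bool (bad K q ((T ^^ (r * q)) z)))"

lemma xi_children:
  "card (xi (l + q) ` {z. xi l z = lam}) \<le> p ^ (2 * q)" "finite (xi (l + q) ` {z. xi l z = lam})"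
proof -
  obtain i j where lam: "lam = (i, j)" by (cases lam)
  let ?I = "\<lambda>i. {int p ^ q * i..<int p ^ q * i + int p ^ q}"
  have pq: "0 < int p ^ q" using p2 by simp
  have fl: "\<lfloor>real p ^ (l + q) * x\<rfloor> \<in> ?I \<lfloor>real p ^ l * x\<rfloor>" for x
  proof -
    have e: "\<lfloor>real p ^ l * x\<rfloor> = \<lfloor>real p ^ (l + q) * x\<rfloor> div int p ^ q" using floor_pow_div[of p l x q] p2 by simp
    have "\<lfloor>real p ^ (l + q) * x\<rfloor> = int p ^ q * (\<lfloor>real p ^ (l + q) * x\<rfloor> div int p ^ q) + \<lfloor>real p ^ (l + q) * x\<rfloor> mod int p ^ q"
      by simp
    moreover have "0 \<le> \<lfloor>real p ^ (l + q) * x\<rfloor> mod int p ^ q" "\<lfloor>real p ^ (l + q) * x\<rfloor> mod int p ^ q < int p ^ q"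
      using pq by auto
    ultimately show ?thesis unfolding e atLeastLessThan_iff by linarith
  qed
  have sub: "xi (l + q) ` {z. xi l z = lam} \<subseteq> ?I i \<times> ?I j"
    using fl unfolding xi_def lam by auto
  have "card (?I i \<times> ?I j) = p ^ q * p ^ q" by (simp add: card_cartesian_product nat_power_eq)
  then show "card (xi (l + q) ` {z. xi l z = lam}) \<le> p ^ (2 * q)"
    using card_mono[OF _ sub] by (simp add: power_add[symmetric] mult_2)
  show "finite (xi (l + q) ` {z. xi l z = lam})" by (rule finite_subset[OF sub]) simp
qed

lemma floor_close:
  fixes u v :: real
  shows "\<bar>u - v\<bar> \<le> of_int k \<Longrightarrow> \<lfloor>u\<rfloor> \<in> {\<lfloor>v\<rfloor> - k - 1..\<lfloor>v\<rfloor> + k + 1}"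
  unfolding atLeastAtMost_iff by linarith

lemma card_column_interval: "0 \<le> k \<Longrightarrow> card ({i} \<times> {j - k - 1..j + k + 1}) = 2 * nat k + 3" for i j k :: int
  by (simp add: card_cartesian_product)

text \<open>Inside a strip transversal to the vertical direction, a good block determines the column and
  hence the cell up to boundedly many choices.\<close>

lemma strip_good_children:
  fixes \<alpha> \<beta> :: real
  assumes \<beta>: "\<beta> \<noteq> 0" and l: "l = K + r * q"
    and strip: "\<And>z w. z \<in> Z \<Longrightarrow> w \<in> Z \<Longrightarrow> \<bar>\<alpha> * (X z - X w) + \<beta> * (Y z - Y w)\<bar> \<le> 1 / real p ^ (l + q)"
  shows "card (xi (l + q) ` {z \<in> Z. xi l z = lam \<and> \<not> bad K q ((T ^^ (r * q)) z)}) \<le> 2 * nat \<lceil>(1 + \<bar>\<alpha>\<bar>) / \<bar>\<beta>\<bar>\<rceil> + 3"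
    (is "card (xi (l + q) ` ?G) \<le> ?C")
proof (cases "?G = {}")
  case False
  then obtain w where w: "w \<in> ?G" by blast
  \<comment> \<open>With a common column, \<open>X\<close> varies by at most the cell side and the
    strip bounds the \<open>\<beta>\<close> part by \<open>1 + \<bar>\<alpha>\<bar>\<close> sides.
    So the rescaled \<open>Y\<close> values differ by at most \<open>?k\<close>; rounding adds one
    on each side, whence \<open>2 * ?k + 3\<close>.\<close>
  let ?k = "\<lceil>(1 + \<bar>\<alpha>\<bar>) / \<bar>\<beta>\<bar>\<rceil>"
  let ?J = "{\<lfloor>real p ^ (l + q) * X w\<rfloor>} \<times> {\<lfloor>real p ^ (l + q) * Y w\<rfloor> - ?k - 1..\<lfloor>real p ^ (l + q) * Y w\<rfloor> + ?k + 1}"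
  have pl: "0 < real p ^ (l + q)" using p2 by simp
  have "0 \<le> (1 + \<bar>\<alpha>\<bar>) / \<bar>\<beta>\<bar>" by simp
  then have k0: "0 \<le> ?k" by (meson le_of_int_ceiling of_int_0_le_iff order_trans)
  have sub: "xi (l + q) ` ?G \<subseteq> ?J"
  proof
    fix x assume "x \<in> xi (l + q) ` ?G"
    then obtain z where z: "z \<in> ?G" "x = xi (l + q) z" by blast
    have e: "xi l z = xi l w" using z w by simp
    have "xi K ((T ^^ (r * q)) z) = xi K ((T ^^ (r * q)) w)" by (rule depends_onD[OF xi_shift e]) (simp add: l)
    then have "col q ((T ^^ K) ((T ^^ (r * q)) z)) = col q ((T ^^ K) ((T ^^ (r * q)) w))"
      by (rule good_column_unique) (use z w in auto)
    then have "col q ((T ^^ l) z) = col q ((T ^^ l) w)" by (simp add: l funpow_add)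
    then have cx: "col (l + q) z = col (l + q) w" using col_event[OF order_refl e] by simp
    then have cX: "\<bar>real p ^ (l + q) * X z - real p ^ (l + q) * X w\<bar> \<le> 1" unfolding col_def by linarith
    have sc: "\<bar>u - v\<bar> = \<bar>real p ^ (l + q) * u - real p ^ (l + q) * v\<bar> / real p ^ (l + q)" for u v
      using pl by (simp add: right_diff_distrib[symmetric] abs_mult)
    have dX: "\<bar>X z - X w\<bar> \<le> 1 / real p ^ (l + q)"
      unfolding sc[of "X z"] using pl by (intro divide_right_mono cX) simp
    have "\<bar>\<beta>\<bar> * \<bar>Y z - Y w\<bar> = \<bar>\<beta> * (Y z - Y w)\<bar>" by (simp add: abs_mult)
    also have "\<dots> \<le> \<bar>\<alpha> * (X z - X w) + \<beta> * (Y z - Y w)\<bar> + \<bar>\<alpha> * (X z - X w)\<bar>" by linarith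
    also have "\<dots> \<le> 1 / real p ^ (l + q) + \<bar>\<alpha>\<bar> * (1 / real p ^ (l + q))"
      unfolding abs_mult[of \<alpha>] using strip[of z w] z w dX by (intro add_mono mult_left_mono) auto
    finally have "\<bar>\<beta>\<bar> * \<bar>Y z - Y w\<bar> \<le> (1 + \<bar>\<alpha>\<bar>) / real p ^ (l + q)" by (simp add: add_divide_distrib)
    then have "\<bar>\<beta>\<bar> * \<bar>real p ^ (l + q) * Y z - real p ^ (l + q) * Y w\<bar> \<le> 1 + \<bar>\<alpha>\<bar>"
      unfolding sc[of "Y z"] times_divide_eq_right divide_le_cancel using pl by linarith
    then have "\<bar>real p ^ (l + q) * Y z - real p ^ (l + q) * Y w\<bar> \<le> (1 + \<bar>\<alpha>\<bar>) / \<bar>\<beta>\<bar>"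
      by (subst pos_le_divide_eq) (use \<beta> in \<open>simp_all add: mult.commute\<close>)
    also have "\<dots> \<le> of_int ?k" by (rule le_of_int_ceiling)
    finally have "\<lfloor>real p ^ (l + q) * Y z\<rfloor> \<in> {\<lfloor>real p ^ (l + q) * Y w\<rfloor> - ?k - 1..\<lfloor>real p ^ (l + q) * Y w\<rfloor> + ?k + 1}"
      by (rule floor_close)
    then show "x \<in> ?J" unfolding z(2) xi_def using cx unfolding col_def by blast
  qed
  have fin_J: "finite ?J" by (intro finite_cartesian_product finite.intros finite_atLeastAtMost_int)
  have "card (xi (l + q) ` ?G) \<le> card ?J" by (rule card_mono[OF fin_J sub])
  also have "\<dots> = ?C" by (rule card_column_interval[OF k0])
  finally show ?thesis .
next
  case True
  have "card (xi (l + q) ` ?G) = 0"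
    by (rule trans[OF arg_cong[OF image_is_empty[THEN iffD2, OF True], of card] card.empty])
  then show ?thesis by (rule order_trans[OF eq_refl le0])
qed

text \<open>Cells are refined block by block, with a budget \<open>j\<close> for bad blocks. A good
  block multiplies the number of cells by at most \<open>C0\<close>, a bad one by at most
  \<open>p ^ (2 * q)\<close> while using up one unit of the budget; in the product the second
  possibility amounts to the \<open>+ 1\<close> in \<open>C0 + 1\<close>.\<close>

lemma strip_count:
  fixes \<alpha> \<beta> :: real
  assumes \<beta>: "\<beta> \<noteq> 0"
    and strip: "\<And>z w. z \<in> Z \<Longrightarrow> w \<in> Z \<Longrightarrow> \<bar>\<alpha> * (X z - X w) + \<beta> * (Y z - Y w)\<bar> \<le> 1 / real p ^ (K + n * q)"
    and rn: "r \<le> n"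
  defines "C0 \<equiv> 2 * nat \<lceil>(1 + \<bar>\<alpha>\<bar>) / \<bar>\<beta>\<bar>\<rceil> + 3"
  shows "card (xi (K + r * q) ` {z \<in> Z. nbad K q r z \<le> j}) \<le> p ^ (2 * K) * (C0 + 1) ^ r * p ^ (2 * q * j)"
  using rn
proof (induction r arbitrary: j)
  case 0
  have sub: "xi K ` {z \<in> Z. nbad K q 0 z \<le> j} \<subseteq> xi (0 + K) ` {z. xi 0 z = (0, 0)}"
  proof -
    have "xi 0 z = (0, 0)" for z unfolding xi_def using X_range[of z] Y_range[of z] by (simp add: floor_eq_iff)
    then show ?thesis by auto
  qed
  have "card (xi K ` {z \<in> Z. nbad K q 0 z \<le> j}) \<le> p ^ (2 * K)"
    using order_trans[OF card_mono[OF xi_children(2) sub] xi_children(1)] .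
  also have "\<dots> \<le> p ^ (2 * K) * p ^ (2 * q * j)" using p2 by simp
  finally show ?case by simp
next
  case (Suc r)
  let ?l = "K + r * q"
  have l': "K + Suc r * q = ?l + q" by simp
  let ?V = "\<lambda>j. xi ?l ` {z \<in> Z. nbad K q r z \<le> j}"
  let ?Gd = "\<lambda>lam. xi (?l + q) ` {z \<in> Z. xi ?l z = lam \<and> \<not> bad K q ((T ^^ (r * q)) z)}"
  let ?H = "\<lambda>lam. xi (?l + q) ` {z. xi ?l z = lam}"
  have strip': "\<bar>\<alpha> * (X z - X w) + \<beta> * (Y z - Y w)\<bar> \<le> 1 / real p ^ (?l + q)" if "z \<in> Z" "w \<in> Z" for z w
  proof -
    have "?l + q \<le> K + n * q" using Suc.prems mult_le_mono1[of "Suc r" n q] by simp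
    then have "1 / real p ^ (K + n * q) \<le> 1 / real p ^ (?l + q)" using p2 by (intro divide_left_mono power_increasing) auto
    then show ?thesis using strip[OF that] by linarith
  qed
  have finV: "finite (?V j)" for j
    using xi_fpart[of ?l] unfolding fpart_def by (auto intro: finite_subset[of _ "range (xi ?l)"])
  have cG: "card (?Gd lam) \<le> C0" for lam
    unfolding C0_def by (rule strip_good_children[OF \<beta> refl strip'])
  have finG: "finite (?Gd lam)" for lam by (rule finite_subset[OF _ xi_children(2)[of ?l q lam]]) auto
  have cUG: "card (\<Union>lam\<in>?V j. ?Gd lam) \<le> C0 * card (?V j)" for j
    using card_UN_le[OF finV[of j], of ?Gd] sum_bounded_above[of "?V j" "\<lambda>lam. card (?Gd lam)" C0] cG
    by (simp add: mult.commute)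
  have cUH: "card (\<Union>lam\<in>?V j. ?H lam) \<le> p ^ (2 * q) * card (?V j)" for j
    using card_UN_le[OF finV[of j], of ?H] sum_bounded_above[of "?V j" "\<lambda>lam. card (?H lam)" "p ^ (2 * q)"] xi_children(1)
    by (simp add: mult.commute)
  have nb: "nbad K q (Suc r) z = nbad K q r z + of_bool (bad K q ((T ^^ (r * q)) z))" for z
    unfolding nbad_def by simp
  have IH: "card (?V i) \<le> p ^ (2 * K) * (C0 + 1) ^ r * p ^ (2 * q * i)" for i using Suc by simp
  show ?case
  proof (cases j)
    case 0
    have "xi (K + Suc r * q) ` {z \<in> Z. nbad K q (Suc r) z \<le> j} \<subseteq> (\<Union>lam\<in>?V j. ?Gd lam)"
      unfolding l' nb using 0 by auto
    then have "card (xi (K + Suc r * q) ` {z \<in> Z. nbad K q (Suc r) z \<le> j}) \<le> C0 * card (?V j)"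
      using order_trans[OF card_mono cUG] finV finG by (meson finite_UN_I)
    also have "\<dots> \<le> C0 * (p ^ (2 * K) * (C0 + 1) ^ r * p ^ (2 * q * j))" by (intro mult_left_mono IH) simp
    also have "\<dots> \<le> (C0 + 1) * (p ^ (2 * K) * (C0 + 1) ^ r * p ^ (2 * q * j))" by (intro mult_right_mono) auto
    also have "\<dots> = p ^ (2 * K) * (C0 + 1) ^ Suc r * p ^ (2 * q * j)" by (simp only: power_Suc mult_ac)
    finally show ?thesis .
  next
    case (Suc i)
    have sub: "xi (K + Suc r * q) ` {z \<in> Z. nbad K q (Suc r) z \<le> j} \<subseteq> (\<Union>lam\<in>?V j. ?Gd lam) \<union> (\<Union>lam\<in>?V i. ?H lam)"
    proof
      fix x assume "x \<in> xi (K + Suc r * q) ` {z \<in> Z. nbad K q (Suc r) z \<le> j}"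
      then obtain z where z: "z \<in> Z" "nbad K q (Suc r) z \<le> j" "x = xi (?l + q) z" unfolding l' by blast
      show "x \<in> (\<Union>lam\<in>?V j. ?Gd lam) \<union> (\<Union>lam\<in>?V i. ?H lam)"
      proof (cases "bad K q ((T ^^ (r * q)) z)")
        case True
        then have "nbad K q r z \<le> i" using z(2) nb[of z] Suc by simp
        then show ?thesis using z by blast
      next
        case False
        then have "nbad K q r z \<le> j" using z(2) nb[of z] by simp
        then show ?thesis using z False by blast
      qed
    qed
    have "finite ((\<Union>lam\<in>?V j. ?Gd lam) \<union> (\<Union>lam\<in>?V i. ?H lam))"
      by (intro finite_UnI finite_UN_I finV finG xi_children(2))
    then have "card (xi (K + Suc r * q) ` {z \<in> Z. nbad K q (Suc r) z \<le> j})
        \<le> card (\<Union>lam\<in>?V j. ?Gd lam) + card (\<Union>lam\<in>?V i. ?H lam)"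
      using sub by (rule order_trans[OF card_mono card_Un_le])
    also have "\<dots> \<le> C0 * card (?V j) + p ^ (2 * q) * card (?V i)" by (intro add_mono cUG cUH)
    also have "\<dots> \<le> C0 * (p ^ (2 * K) * (C0 + 1) ^ r * p ^ (2 * q * j)) + p ^ (2 * q) * (p ^ (2 * K) * (C0 + 1) ^ r * p ^ (2 * q * i))"
      by (intro add_mono mult_left_mono IH) auto
    also have "p ^ (2 * q) * (p ^ (2 * K) * (C0 + 1) ^ r * p ^ (2 * q * i)) = p ^ (2 * K) * (C0 + 1) ^ r * p ^ (2 * q * j)"
      unfolding Suc by (simp add: power_add mult_ac)
    also have "C0 * (p ^ (2 * K) * (C0 + 1) ^ r * p ^ (2 * q * j)) + p ^ (2 * K) * (C0 + 1) ^ r * p ^ (2 * q * j)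
        = (C0 + 1) * (p ^ (2 * K) * (C0 + 1) ^ r * p ^ (2 * q * j))" by (simp only: distrib_right mult_1)
    also have "\<dots> = p ^ (2 * K) * (C0 + 1) ^ Suc r * p ^ (2 * q * j)" by (simp only: power_Suc mult_ac)
    finally show ?thesis .
  qed
qed

text \<open>A block is bad with probability at most \<open>2 * (1 - Q K q)\<close>. Although
  \<open>T ^^ q\<close> may fail to be ergodic, the maximal inequality bounds the proportion of bad
  blocks for all \<open>n\<close> simultaneously, as strips of all widths require.\<close>

lemma few_bad_blocks:
  assumes e: "1 - e \<le> Q K q" and l: "0 < l"
  shows "1 - 2 * e / l \<le> prob {z \<in> space M. \<forall>n. real (nbad K q n z) \<le> l * real n}"
proof -
  interpret Tq: mpt M "T ^^ q" by (rule mpt_power)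
  let ?f = "\<lambda>z. of_bool (bad K q z) :: real"
  have fi: "integrable M ?f" by (rule integrable_bdd[where B=1]) auto
  have "(\<integral>z. ?f z \<partial>M) \<le> (\<integral>z. 2 * (1 - g K q z) \<partial>M)"
    by (rule integral_mono[OF fi]) (auto simp: g_integrable bad_def of_bool_def g_bounds)
  also have "\<dots> = 2 * (1 - Q K q)" unfolding Q_def by (simp add: g_integrable prob_space)
  also have "\<dots> \<le> 2 * e" using e by simp
  finally have fe: "(\<integral>z. ?f z \<partial>M) \<le> 2 * e" .
  have it: "(\<Sum>r<n. ?f (((T ^^ q) ^^ r) z)) = real (nbad K q n z)" for n z
    unfolding nbad_def by (simp add: funpow_mult mult.commute)
  define B where "B N = {z \<in> space M. \<exists>n\<in>{1..N}. real (nbad K q n z) > l * real n}" for N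
  have nbm [measurable]: "(\<lambda>z. real (nbad K q n z)) \<in> borel_measurable M" for n
    unfolding nbad_def by simp
  have Bm [measurable]: "B N \<in> sets M" for N unfolding B_def by measurable
  have "l * prob (B N) \<le> 2 * e" for N
    using Tq.maximal_weak_type[OF fi, of l N] fe unfolding it B_def by simp
  then have "prob (B N) \<le> 2 * e / l" for N using l by (simp add: pos_le_divide_eq mult.commute)
  moreover have "incseq B" unfolding incseq_def B_def by fastforce
  then have "(\<lambda>N. prob (B N)) \<longlonglongrightarrow> prob (\<Union>N. B N)" by (intro finite_Lim_measure_incseq) auto
  ultimately have "prob (\<Union>N. B N) \<le> 2 * e / l" by (intro LIMSEQ_le_const2) auto
  moreover have "{z \<in> space M. \<forall>n. real (nbad K q n z) \<le> l * real n} = space M - (\<Union>N. B N)"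
  proof -
    have "real (nbad K q 0 z) \<le> l * real 0" for z unfolding nbad_def by simp
    then have "(\<forall>n. real (nbad K q n z) \<le> l * real n) \<longleftrightarrow> (\<forall>N. \<not> (\<exists>n\<in>{1..N}. real (nbad K q n z) > l * real n))" for z
      by (metis atLeastAtMost_iff le_refl less_one not_le)
    then show ?thesis unfolding B_def by blast
  qed
  moreover have "prob (space M - (\<Union>N. B N)) = 1 - prob (\<Union>N. B N)" by (rule prob_compl) measurable
  ultimately show ?thesis by simp
qed

end

text \<open>Distances are compared with the coordinates on a set \<open>S\<close> of full measure
  only: in the application \<open>X\<close> and \<open>Y\<close> are fractional parts, which are
  discontinuous, and \<open>S\<close> is the half-open square, where they are the coordinates
  themselves.\<close>

locale metric_digits = digits M T p X Y
  for M :: "'a::metric_space measure" and T :: "'a \<Rightarrow> 'a" and p :: nat and X Y :: "'a \<Rightarrow> real" +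
  fixes S :: "'a set"
  assumes S_sets [measurable]: "S \<in> sets M" and S_full: "prob S = 1"
    and S_dist: "\<And>z w. z \<in> S \<Longrightarrow> w \<in> S \<Longrightarrow> dist z w \<le> \<bar>X z - X w\<bar> + \<bar>Y z - Y w\<bar>"
begin

text \<open>A cover of \<open>A\<close> by small sets lifts to a cover of the part of \<open>f\<^sup>-\<^sup>1 A\<close> with few bad blocks:
  each strip over a set of diameter \<open>r\<close> meets at most \<open>r\<^sup>-\<^sup>\<theta>\<close> cells of size \<open>r\<close>, up to a constant.\<close>

lemma lifted_null_set:
  fixes \<alpha> \<beta> \<theta> s' :: real and f :: "'a \<Rightarrow> real" and A :: "real set"
  assumes \<beta>: "\<beta> \<noteq> 0" and f: "\<And>z w. z \<in> S \<Longrightarrow> w \<in> S \<Longrightarrow> f z - f w = \<alpha> * (X z - X w) + \<beta> * (Y z - Y w)"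
    and s': "0 \<le> s'" "hausdorff_measure s' A = 0" and \<theta>: "0 < \<theta>" and q: "0 < q"
    and C0: "real (2 * nat \<lceil>(1 + \<bar>\<alpha>\<bar>) / \<bar>\<beta>\<bar>\<rceil> + 3 + 1) \<le> real p powr (\<theta> * real q / 2)"
  shows "hausdorff_measure (s' + 2 * \<theta>) {z \<in> S. f z \<in> A \<and> (\<forall>n. real (nbad K q n z) \<le> \<theta> / 4 * real n)} = 0"
    (is "hausdorff_measure ?s ?B = 0")
proof (rule hausdorff_measure_zeroI)
  fix \<delta> \<eta> :: real assume pos: "0 < \<delta>" "0 < \<eta>"
  have pp: "1 < real p" using p2 by simp
  have s0: "0 < ?s" using s' \<theta> by simp
  define C where "C = real p ^ (2 * K) * (2 * real p ^ q) powr ?s"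
  have C: "0 < C" using pp by (simp add: C_def)
  define \<eta>' where "\<eta>' = \<eta> / (2 * C)"
  have \<eta>': "0 < \<eta>'" using pos C by (simp add: \<eta>'_def)
  \<comment> \<open>The first bound lets the scales start at level \<open>K\<close>; the second
    compensates the factor \<open>2 * p ^ q\<close> lost when sets of size \<open>r i\<close> are
    replaced by cells of a block level.\<close>
  define \<delta>1 where "\<delta>1 = min (1 / real p ^ K) (\<delta> / (2 * real p ^ q))"
  have \<delta>1: "0 < \<delta>1" "\<delta>1 \<le> 1 / real p ^ K" "\<delta>1 \<le> \<delta> / (2 * real p ^ q)" using pos pp by (auto simp: \<delta>1_def)
  have "1 / real p ^ K \<le> 1" using pp by (simp add: one_le_power)
  then have \<delta>1_le1: "\<delta>1 \<le> 1" using \<delta>1(2) by linarith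
  have "hausdorff_content s' \<delta>1 A \<le> hausdorff_measure s' A"
    unfolding hausdorff_measure_def using \<delta>1 by (intro SUP_upper) simp
  then have "hausdorff_content s' \<delta>1 A < ennreal \<eta>'" using s' \<eta>' by simp
  then obtain U :: "nat \<Rightarrow> real set" where U: "A \<subseteq> (\<Union>i. U i)" "\<And>i. bounded (U i)" "\<And>i. diameter (U i) \<le> \<delta>1"
    "(\<Sum>i. ennreal (diameter (U i) powr s')) < ennreal \<eta>'"
    unfolding hausdorff_content_def INF_less_iff by auto
  define h where "h i = \<eta>' * (1 / 2) ^ Suc i" for i :: nat
  have h: "0 < h i" for i using \<eta>' by (simp add: h_def)
  \<comment> \<open>Sets of the cover may have diameter \<open>0\<close>, so they are given a
    positive size. The floor \<open>h i powr (1 / \<theta>)\<close> costs at most \<open>h i\<close>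
    in the sum, at the price of one \<open>\<theta>\<close> in the exponent; the other
    \<open>\<theta>\<close> pays for the number of cells.\<close>
  define r where "r i = max (diameter (U i)) (min \<delta>1 (h i powr (1 / \<theta>)))" for i
  have r: "0 < r i" "r i \<le> \<delta>1" "diameter (U i) \<le> r i" for i
    using U(3)[of i] \<delta>1 h[of i] by (auto simp: r_def less_max_iff_disj)
  have rpow: "r i powr (s' + \<theta>) \<le> diameter (U i) powr s' + h i" for i
  proof (cases "r i = diameter (U i)")
    case True
    have "r i powr (s' + \<theta>) \<le> r i powr s'"
      using r[of i] \<delta>1_le1 \<theta> by (intro powr_mono') auto
    then show ?thesis using True h[of i] by simp
  next
    case False
    then have ri: "r i = min \<delta>1 (h i powr (1 / \<theta>))" by (auto simp: r_def max_def)
    have "r i powr (s' + \<theta>) \<le> r i powr \<theta>"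
      using r[of i] \<delta>1_le1 s' by (intro powr_mono') auto
    also have "\<dots> \<le> (h i powr (1 / \<theta>)) powr \<theta>" using ri r[of i] \<theta> by (intro powr_mono2) auto
    also have "\<dots> = h i" using \<theta> h[of i] by (simp add: powr_powr)
    finally show ?thesis by (simp add: add_increasing)
  qed
  \<comment> \<open>The finest block level whose cells are not smaller than \<open>r i\<close>:
    since levels increase by \<open>q\<close>, the cell side exceeds \<open>r i\<close> by a factor
    below \<open>p ^ q\<close>.\<close>
  have "\<exists>n. r i \<le> 1 / real p ^ (K + n * q) \<and> \<not> r i \<le> 1 / real p ^ (K + Suc n * q)" for i
  proof (rule ccontr)
    assume "\<not> ?thesis"
    then have step: "\<And>n. r i \<le> 1 / real p ^ (K + n * q) \<Longrightarrow> r i \<le> 1 / real p ^ (K + Suc n * q)" by blast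
    have all: "r i \<le> 1 / real p ^ (K + n * q)" for n
    proof (induction n)
      case 0
      show ?case using r(2)[of i] \<delta>1(2) by simp
    qed (rule step)
    obtain n where n: "1 / r i < real p ^ n" using real_arch_pow[OF pp] by blast
    have "real p ^ n \<le> real p ^ (K + n * q)" using pp q by (intro power_increasing) (auto simp: trans_le_add2)
    then have "1 / r i < real p ^ (K + n * q)" using n by linarith
    then have "1 / real p ^ (K + n * q) < r i" using r(1)[of i] pp by (simp add: divide_less_eq mult.commute less_divide_eq)
    then show False using all[of n] by linarith
  qed
  then obtain n where n: "\<And>i. r i \<le> 1 / real p ^ (K + n i * q)" "\<And>i. \<not> r i \<le> 1 / real p ^ (K + Suc (n i) * q)" by metis
  define Z where "Z i = {z \<in> ?B. f z \<in> U i}" for i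
  define lab where "lab i z = to_nat (xi (K + n i * q) z)" for i z
  define W where "W i j = {z \<in> Z i. lab i z = j}" for i j
  have ZS: "z \<in> S" if "z \<in> Z i" for z i using that by (simp add: Z_def)
  have cl: "dist z w \<le> 2 / real p ^ (K + n i * q)" if "z \<in> W i j" "w \<in> W i j" for z w i j
  proof -
    have "to_nat (xi (K + n i * q) z) = to_nat (xi (K + n i * q) w)" using that by (simp add: W_def lab_def)
    then have e: "xi (K + n i * q) z = xi (K + n i * q) w" by (rule injD[OF inj_to_nat])
    have "dist z w \<le> \<bar>X z - X w\<bar> + \<bar>Y z - Y w\<bar>" using that ZS by (intro S_dist) (auto simp: W_def)
    then show ?thesis using xi_close[OF e] by simp
  qed
  have bddW: "bounded (W i j)" for i j
  proof (cases "W i j = {}")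
    case False
    then obtain w where "w \<in> W i j" by blast
    then show ?thesis using cl unfolding bounded_def by blast
  qed simp
  have Rr: "2 / real p ^ (K + n i * q) \<le> 2 * real p ^ q * r i" for i
  proof -
    have "1 / real p ^ (K + Suc (n i) * q) \<le> r i" using n(2)[of i] by linarith
    moreover have "1 / real p ^ (K + Suc (n i) * q) = 1 / real p ^ (K + n i * q) / real p ^ q"
      by (simp add: power_add mult_ac)
    ultimately show ?thesis using pp by (simp add: pos_divide_le_eq mult_ac)
  qed
  have diaW: "diameter (W i j) \<le> 2 * real p ^ q * r i" for i j
  proof -
    have "diameter (W i j) \<le> 2 / real p ^ (K + n i * q)"
    proof (cases "W i j = {}")
      case False
      then have "diameter (W i j) = (SUP (x, y)\<in>W i j \<times> W i j. dist x y)" by (simp add: diameter_def)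
      also have "\<dots> \<le> 2 / real p ^ (K + n i * q)" by (rule cSUP_least) (use False cl in auto)
      finally show ?thesis .
    qed (simp add: diameter_def)
    then show ?thesis using Rr[of i] by linarith
  qed
  \<comment> \<open>Good blocks contribute \<open>(?C0 + 1) ^ n i\<close>, at most
    \<open>p powr (\<theta> * q * n i / 2)\<close> by the assumption \<open>C0\<close>, and the at
    most \<open>\<theta> * n i / 4\<close> bad ones contribute at most the same again. Together this
    is at most \<open>r i powr (- \<theta>)\<close>, up to the initial
    \<open>p ^ (2 * K)\<close>.\<close>
  have cnt: "real (card (lab i ` Z i)) \<le> real p ^ (2 * K) * r i powr (- \<theta>)" and fin: "finite (lab i ` Z i)" for i
  proof -
    let ?j = "nat \<lfloor>\<theta> / 4 * real (n i)\<rfloor>"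
    let ?C0 = "2 * nat \<lceil>(1 + \<bar>\<alpha>\<bar>) / \<bar>\<beta>\<bar>\<rceil> + 3"
    have finx: "finite (xi (K + n i * q) ` Z i)"
      using xi_fpart[of "K + n i * q"] unfolding fpart_def by (auto intro: finite_subset[of _ "range (xi (K + n i * q))"])
    have li: "lab i ` Z i = to_nat ` (xi (K + n i * q) ` Z i)" unfolding lab_def by (simp add: image_image)
    show "finite (lab i ` Z i)" unfolding li using finx by simp
    have "nbad K q (n i) z \<le> ?j" if "z \<in> Z i" for z
    proof -
      have "real (nbad K q (n i) z) \<le> \<theta> / 4 * real (n i)" using that by (simp add: Z_def)
      then show ?thesis by (rule le_nat_floor)
    qed
    then have Zj: "{z \<in> Z i. nbad K q (n i) z \<le> ?j} = Z i" by blast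
    have "card (lab i ` Z i) \<le> card (xi (K + n i * q) ` Z i)" unfolding li by (rule card_image_le[OF finx])
    also have "\<dots> \<le> p ^ (2 * K) * (?C0 + 1) ^ n i * p ^ (2 * q * ?j)"
    proof -
      have "card (xi (K + n i * q) ` {z \<in> Z i. nbad K q (n i) z \<le> ?j}) \<le> p ^ (2 * K) * (?C0 + 1) ^ n i * p ^ (2 * q * ?j)"
      proof (rule strip_count[OF \<beta> _ order_refl])
        fix z w assume zw: "z \<in> Z i" "w \<in> Z i"
        have "\<bar>\<alpha> * (X z - X w) + \<beta> * (Y z - Y w)\<bar> = dist (f z) (f w)"
          using f[OF ZS[OF zw(1)] ZS[OF zw(2)]] by (simp add: dist_real_def)
        also have "\<dots> \<le> diameter (U i)" by (rule diameter_bounded_bound[OF U(2)]) (use zw in \<open>auto simp: Z_def\<close>)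
        also have "\<dots> \<le> 1 / real p ^ (K + n i * q)" using r(3)[of i] n(1)[of i] by linarith
        finally show "\<bar>\<alpha> * (X z - X w) + \<beta> * (Y z - Y w)\<bar> \<le> 1 / real p ^ (K + n i * q)" .
      qed
      then show ?thesis unfolding Zj .
    qed
    finally have "real (card (lab i ` Z i)) \<le> real (p ^ (2 * K) * (?C0 + 1) ^ n i * p ^ (2 * q * ?j))" by (simp only: of_nat_le_iff)
    also have "\<dots> = real p ^ (2 * K) * real (?C0 + 1) ^ n i * real p ^ (2 * q * ?j)" by (simp only: of_nat_mult of_nat_power)
    also have "\<dots> \<le> real p ^ (2 * K) * (real p powr (\<theta> * real q / 2)) ^ n i * real p powr (\<theta> * real q * real (n i) / 2)"
    proof (intro mult_mono mult_left_mono power_mono)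
      show "real (?C0 + 1) \<le> real p powr (\<theta> * real q / 2)" using C0 by (simp only: add.assoc)
      have "real ?j \<le> \<theta> / 4 * real (n i)" using \<theta> by (intro of_nat_floor) simp
      then have "real (2 * q) * real ?j \<le> real (2 * q) * (\<theta> / 4 * real (n i))" by (intro mult_left_mono) auto
      then have "real (2 * q * ?j) \<le> \<theta> * real q * real (n i) / 2" by (simp add: mult_ac)
      moreover have "real p ^ (2 * q * ?j) = real p powr real (2 * q * ?j)" using pp by (subst powr_realpow) auto
      ultimately show "real p ^ (2 * q * ?j) \<le> real p powr (\<theta> * real q * real (n i) / 2)"
        using pp by (simp only:) (intro powr_mono, auto)
    qed (rule order_refl of_nat_0_le_iff zero_le_power[OF of_nat_0_le_iff] powr_ge_zero zero_le_power mult_nonneg_nonneg)+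
    also have "(real p powr (\<theta> * real q / 2)) ^ n i = real p powr (\<theta> * real q * real (n i) / 2)"
      using pp by (simp add: powr_power mult_ac)
    also have "real p ^ (2 * K) * real p powr (\<theta> * real q * real (n i) / 2) * real p powr (\<theta> * real q * real (n i) / 2)
        = real p ^ (2 * K) * real p powr (\<theta> * real q * real (n i))"
      by (simp add: mult.assoc powr_add[symmetric])
    also have "\<dots> \<le> real p ^ (2 * K) * r i powr (- \<theta>)"
    proof (rule mult_left_mono)
      have "r i \<le> 1 / real p ^ (n i * q)"
      proof -
        have "1 / real p ^ (K + n i * q) \<le> 1 / real p ^ (n i * q)" using pp by (intro divide_left_mono power_increasing) auto
        then show ?thesis using n(1)[of i] by linarith
      qed
      also have "1 / real p ^ (n i * q) = real p powr (- real (n i * q))" using pp by (subst powr_minus, subst powr_realpow) (simp_all add: divide_inverse)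
      finally have "(real p powr (- real (n i * q))) powr (- \<theta>) \<le> r i powr (- \<theta>)"
        using r(1)[of i] \<theta> by (intro powr_mono2') auto
      then show "real p powr (\<theta> * real q * real (n i)) \<le> r i powr (- \<theta>)" by (simp add: powr_powr mult_ac)
    qed simp
    finally show "real (card (lab i ` Z i)) \<le> real p ^ (2 * K) * r i powr (- \<theta>)" .
  qed
  have row: "(\<Sum>j. ennreal (diameter (W i j) powr ?s)) \<le> ennreal C * (ennreal (diameter (U i) powr s') + ennreal (h i))" for i
  proof -
    have R0: "0 \<le> 2 * real p ^ q * r i" using r(1)[of i] by simp
    have "(\<Sum>j. ennreal (diameter (W i j) powr ?s)) \<le> ennreal ((real p ^ (2 * K) * r i powr (- \<theta>)) * (2 * real p ^ q * r i) powr ?s)"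
      unfolding W_def by (rule finite_fibre_sum_le[OF fin cnt R0 s0 bddW[unfolded W_def] diaW[unfolded W_def]])
    also have "(real p ^ (2 * K) * r i powr (- \<theta>)) * (2 * real p ^ q * r i) powr ?s = C * r i powr (s' + \<theta>)"
    proof -
      have "(2 * real p ^ q * r i) powr ?s = (2 * real p ^ q) powr ?s * r i powr ?s" using r(1)[of i] by (simp add: powr_mult)
      moreover have "r i powr (- \<theta>) * r i powr ?s = r i powr (s' + \<theta>)" using r(1)[of i] by (simp add: powr_add[symmetric] add.commute)
      ultimately show ?thesis unfolding C_def by (simp add: mult_ac)
    qed
    also have "ennreal (C * r i powr (s' + \<theta>)) \<le> ennreal (C * (diameter (U i) powr s' + h i))"
      using C rpow[of i] by (intro ennreal_leI mult_left_mono) auto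
    also have "\<dots> = ennreal C * (ennreal (diameter (U i) powr s') + ennreal (h i))"
      using C h[of i] by (simp add: ennreal_mult ennreal_plus[symmetric] del: ennreal_plus)
    finally show ?thesis .
  qed
  have "(\<Sum>i. \<Sum>j. ennreal (diameter (W i j) powr ?s)) \<le> (\<Sum>i. ennreal C * (ennreal (diameter (U i) powr s') + ennreal (h i)))"
    by (intro suminf_le row) auto
  also have "\<dots> = ennreal C * ((\<Sum>i. ennreal (diameter (U i) powr s')) + (\<Sum>i. ennreal (h i)))"
    by (simp add: suminf_add[symmetric])
  also have "(\<Sum>i. ennreal (h i)) = ennreal \<eta>'"
  proof -
    have "(\<Sum>i. ennreal (h i)) = ennreal (\<Sum>i. h i)"
      unfolding h_def by (rule suminf_ennreal2) (use \<eta>' power_half_series in \<open>auto intro!: summable_mult sums_summable\<close>)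
    also have "(\<Sum>i. h i) = \<eta>'" unfolding h_def using sums_mult[OF power_half_series, of \<eta>'] by (simp add: sums_unique[symmetric])
    finally show ?thesis .
  qed
  also have "ennreal C * ((\<Sum>i. ennreal (diameter (U i) powr s')) + ennreal \<eta>') \<le> ennreal C * (ennreal \<eta>' + ennreal \<eta>')"
    using U(4) by (intro mult_left_mono add_right_mono) auto
  also have "\<dots> = ennreal (C * (\<eta>' + \<eta>'))" using C \<eta>' by (simp add: ennreal_mult ennreal_plus[symmetric] del: ennreal_plus)
  also have "C * (\<eta>' + \<eta>') = \<eta>" using C by (simp add: \<eta>'_def)
  finally have sumW: "(\<Sum>i. \<Sum>j. ennreal (diameter (W i j) powr ?s)) \<le> ennreal \<eta>" .
  have "?B \<subseteq> (\<Union>i j. W i j)"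
  proof
    fix z assume z: "z \<in> ?B"
    then obtain i where "f z \<in> U i" using U(1) by auto
    then have "z \<in> W i (lab i z)" using z by (simp add: W_def Z_def)
    then show "z \<in> (\<Union>i j. W i j)" by blast
  qed
  moreover have "diameter (W i j) \<le> \<delta>" for i j
  proof -
    have "2 * real p ^ q * r i \<le> 2 * real p ^ q * (\<delta> / (2 * real p ^ q))" using r(2)[of i] \<delta>1(3) by (intro mult_left_mono) auto
    also have "\<dots> = \<delta>" using pp by simp
    finally show ?thesis using diaW[of i j] by linarith
  qed
  ultimately show "\<exists>W :: nat \<Rightarrow> nat \<Rightarrow> 'a set. ?B \<subseteq> (\<Union>i j. W i j)
      \<and> (\<forall>i j. bounded (W i j) \<and> diameter (W i j) \<le> \<delta>)
      \<and> (\<Sum>i. \<Sum>j. ennreal (diameter (W i j) powr ?s)) \<le> ennreal \<eta>"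
    using bddW sumW by blast
qed

text \<open>Inside the preimage of a set \<open>A\<close> of positive mass, the points with few bad
  blocks still have positive measure, and \<open>lifted_null_set\<close> bounds their dimension by
  that of \<open>A\<close> up to \<open>\<epsilon>\<close>. The order of choices is
  \<open>\<theta>\<close>, then \<open>q\<close>, then \<open>K\<close>.\<close>

lemma measure_dim_le_projection:
  fixes \<alpha> \<beta> :: real and f :: "'a \<Rightarrow> real"
  assumes \<beta>: "\<beta> \<noteq> 0" and f: "\<And>z w. z \<in> S \<Longrightarrow> w \<in> S \<Longrightarrow> f z - f w = \<alpha> * (X z - X w) + \<beta> * (Y z - Y w)"
    and fm [measurable]: "f \<in> borel_measurable M"
    and det: "\<And>q e. 0 < e \<Longrightarrow> \<exists>K. 1 - e \<le> Q K q"
  shows "measure_dim M \<le> measure_dim (distr M borel f)"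
proof -
  have pp: "1 < real p" using p2 by simp
  have main: "measure_dim M \<le> hausdorff_dim A"
    if A [measurable]: "A \<in> sets borel" and Apos: "0 < emeasure (distr M borel f) A" for A
  proof (rule field_le_epsilon)
    fix \<epsilon> :: real assume \<epsilon>: "0 < \<epsilon>"
    have ne: "{s. 0 \<le> s \<and> hausdorff_measure s A = 0} \<noteq> {}"
      using hausdorff_measure_real_2[of A] by (auto intro!: exI[of _ 2])
    have "Inf {s. 0 \<le> s \<and> hausdorff_measure s A = 0} < hausdorff_dim A + \<epsilon> / 2"
      using \<epsilon> by (simp add: hausdorff_dim_def)
    then obtain s' where s': "0 \<le> s'" "hausdorff_measure s' A = 0" "s' < hausdorff_dim A + \<epsilon> / 2"
      using cInf_lessD[OF ne] by blast
    define \<theta> where "\<theta> = \<epsilon> / 4"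
    have \<theta>: "0 < \<theta>" using \<epsilon> by (simp add: \<theta>_def)
    let ?C = "real (2 * nat \<lceil>(1 + \<bar>\<alpha>\<bar>) / \<bar>\<beta>\<bar>\<rceil> + 3 + 1)"
    \<comment> \<open>Long blocks make the bounded number of choices per good block negligible on
      the exponential scale.\<close>
    obtain q0 :: nat where q0: "2 * log (real p) ?C / \<theta> < real q0" using reals_Archimedean2 by blast
    define q where "q = Suc q0"
    have q: "0 < q" by (simp add: q_def)
    have "2 * log (real p) ?C / \<theta> \<le> real q" using q0 by (simp add: q_def)
    moreover have Cpos: "0 < ?C" by (simp only: of_nat_0_less_iff zero_less_Suc add_gr_0 zero_less_one simp_thms)
    ultimately have "log (real p) ?C \<le> \<theta> * real q / 2" using \<theta> by (simp add: pos_divide_le_eq mult.commute)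
    then have C: "?C \<le> real p powr (\<theta> * real q / 2)" unfolding log_le_iff[OF pp Cpos] .
    define a0 where "a0 = prob {z \<in> space M. f z \<in> A}"
    have a0: "0 < a0"
    proof -
      have "f -` A \<inter> space M = {z \<in> space M. f z \<in> A}" by auto
      then have "emeasure (distr M borel f) A = emeasure M {z \<in> space M. f z \<in> A}" using emeasure_distr[OF fm A] by simp
      then show ?thesis using Apos unfolding a0_def by (simp add: emeasure_eq_measure)
    qed
    \<comment> \<open>With this \<open>e\<close> the loss \<open>2 * e / (\<theta> / 4)\<close> in
      \<open>few_bad_blocks\<close> is \<open>a0 / 2\<close>, half of the mass of the preimage of
      \<open>A\<close>.\<close>
    define e where "e = a0 * (\<theta> / 4) / 4"
    have e: "0 < e" using a0 \<theta> by (simp add: e_def)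
    obtain K where K: "1 - e \<le> Q K q" using det[OF e] by blast
    let ?E = "{z \<in> space M. \<forall>n. real (nbad K q n z) \<le> \<theta> / 4 * real n}"
    have nbm [measurable]: "(\<lambda>z. real (nbad K q n z)) \<in> borel_measurable M" for n
      unfolding nbad_def by simp
    have "1 - 2 * e / (\<theta> / 4) \<le> prob ?E" using K by (rule few_bad_blocks) (use \<theta> in simp)
    then have E: "1 - a0 / 2 \<le> prob ?E" using \<theta> by (simp add: e_def)
    define B where "B = {z \<in> S. f z \<in> A \<and> (\<forall>n. real (nbad K q n z) \<le> \<theta> / 4 * real n)}"
    have SM: "S \<subseteq> space M" using sets.sets_into_space[OF S_sets] .
    have Beq: "B = S \<inter> ({z \<in> space M. f z \<in> A} \<inter> ?E)" unfolding B_def using SM by auto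
    have Bm [measurable]: "B \<in> sets M" unfolding Beq by measurable
    have "AE z in M. z \<in> S" using S_full prob_eq_1[OF S_sets] by simp
    then have "prob B = prob ({z \<in> space M. f z \<in> A} \<inter> ?E)"
      unfolding Beq by (intro finite_measure_eq_AE) (auto; measurable)+
    also have "\<dots> \<ge> prob {z \<in> space M. f z \<in> A} - prob (space M - ?E)"
    proof -
      have "prob {z \<in> space M. f z \<in> A} \<le> prob (({z \<in> space M. f z \<in> A} \<inter> ?E) \<union> (space M - ?E))"
        by (rule finite_measure_mono) auto
      also have "\<dots> \<le> prob ({z \<in> space M. f z \<in> A} \<inter> ?E) + prob (space M - ?E)" by (rule measure_Un_le) auto
      finally show ?thesis by simp
    qed
    finally have "a0 - (1 - prob ?E) \<le> prob B" unfolding a0_def by (subst (asm) prob_compl) auto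
    then have "0 < prob B" using E a0 by linarith
    then have "hausdorff_dim B \<in> {hausdorff_dim A |A. A \<in> sets M \<and> 0 < emeasure M A}"
      using Bm by (auto simp: emeasure_eq_measure)
    moreover have "bdd_below {hausdorff_dim A |A. A \<in> sets M \<and> 0 < emeasure M A}"
    \<comment> \<open>If no exponent gives measure \<open>0\<close>, \<open>hausdorff_dim\<close> is
      the unspecified real \<open>Inf {}\<close>; the lower bound has to allow for this
      value.\<close>
    proof (rule bdd_belowI[of _ "min 0 (Inf {})"])
      fix x assume "x \<in> {hausdorff_dim A |A. A \<in> sets M \<and> 0 < emeasure M A}"
      then obtain A :: "'a set" where x: "x = hausdorff_dim A" by blast
      show "min 0 (Inf {}) \<le> x"
      proof (cases "{s. 0 \<le> s \<and> hausdorff_measure s A = 0} = {}")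
        case True
        then show ?thesis unfolding x hausdorff_dim_def by (simp only: min.cobounded2)
      next
        case False
        then have "0 \<le> x" unfolding x hausdorff_dim_def by (rule cInf_greatest) simp
        then show ?thesis by simp
      qed
    qed
    ultimately have "measure_dim M \<le> hausdorff_dim B" unfolding measure_dim_def by (rule cInf_lower)
    also have "\<dots> \<le> s' + 2 * \<theta>"
      unfolding hausdorff_dim_def
    proof (rule cInf_lower)
      show "s' + 2 * \<theta> \<in> {s. 0 \<le> s \<and> hausdorff_measure s B = 0}"
        unfolding B_def using lifted_null_set[OF \<beta> f s'(1,2) \<theta> q C, of K] s' \<theta> by simp
      show "bdd_below {s. 0 \<le> s \<and> hausdorff_measure s B = 0}" by (rule bdd_belowI[of _ 0]) simp
    qed
    also have "\<dots> \<le> hausdorff_dim A + \<epsilon>" using s'(3) by (simp add: \<theta>_def)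
    finally show "measure_dim M \<le> hausdorff_dim A + \<epsilon>" .
  qed
  show ?thesis unfolding measure_dim_def[of "distr M borel f"]
  proof (rule cInf_greatest)
    interpret D: prob_space "distr M borel f" by (rule prob_space_distr) (rule fm)
    have "emeasure (distr M borel f) UNIV = 1" using D.emeasure_space_1 by simp
    then have "hausdorff_dim (UNIV :: real set) \<in> {hausdorff_dim A |A. A \<in> sets (distr M borel f) \<and> 0 < emeasure (distr M borel f) A}"
      by (auto intro!: exI[of _ UNIV])
    then show "{hausdorff_dim A |A. A \<in> sets (distr M borel f) \<and> 0 < emeasure (distr M borel f) A} \<noteq> {}" by blast
  next
    fix x assume "x \<in> {hausdorff_dim A |A. A \<in> sets (distr M borel f) \<and> 0 < emeasure (distr M borel f) A}"
    then show "measure_dim M \<le> x" using main by auto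
  qed
qed

end

section \<open>Trigonometric polynomials on the torus\<close>

text \<open>The phase \<open>\<phi>\<close> puts sines and cosines into one family, and the product
  formula for cosines makes the span closed under multiplication.\<close>

inductive trig_poly :: "(real \<times> real \<Rightarrow> real) \<Rightarrow> bool" where
  harmonic: "trig_poly (\<lambda>z. cos (2 * pi * (of_int i * fst z + of_int j * snd z) + \<phi>))"
| add: "trig_poly f \<Longrightarrow> trig_poly g \<Longrightarrow> trig_poly (\<lambda>z. f z + g z)"
| scale: "trig_poly f \<Longrightarrow> trig_poly (\<lambda>z. c * f z)"

lemma trig_poly_const: "trig_poly (\<lambda>_. c)"
  using trig_poly.scale[OF trig_poly.harmonic[of 0 0 0], of c] by simp

lemma trig_poly_continuous: "trig_poly f \<Longrightarrow> continuous_on UNIV f"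
  by (induction rule: trig_poly.induct) (auto intro!: continuous_intros)

lemma trig_poly_bounded: "trig_poly f \<Longrightarrow> \<exists>B. \<forall>z. \<bar>f z\<bar> \<le> B"
proof (induction rule: trig_poly.induct)
  case (harmonic i j \<phi>)
  show ?case by (rule exI[of _ 1]) simp
next
  case (add f g)
  then obtain B C where "\<forall>z. \<bar>f z\<bar> \<le> B" "\<forall>z. \<bar>g z\<bar> \<le> C" by blast
  then have "\<forall>z. \<bar>f z + g z\<bar> \<le> B + C" by (meson abs_triangle_ineq add_mono order_trans)
  then show ?case by blast
next
  case (scale f c)
  then obtain B where "\<forall>z. \<bar>f z\<bar> \<le> B" by blast
  then have "\<forall>z. \<bar>c * f z\<bar> \<le> \<bar>c\<bar> * B" by (simp add: abs_mult mult_left_mono)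
  then show ?case by blast
qed

lemma trig_poly_mult:
  assumes "trig_poly f" "trig_poly g"
  shows "trig_poly (\<lambda>z. f z * g z)"
  using assms(1)
proof (induction f rule: trig_poly.induct)
  case (harmonic i j \<phi>)
  show ?case
    using assms(2)
  proof (induction g rule: trig_poly.induct)
    case (harmonic i' j' \<psi>)
    let ?h = "\<lambda>i j \<phi> z. cos (2 * pi * (of_int i * fst z + of_int j * snd z) + \<phi>) :: real"
    have "?h i j \<phi> z * ?h i' j' \<psi> z = 1/2 * ?h (i - i') (j - j') (\<phi> - \<psi>) z + 1/2 * ?h (i + i') (j + j') (\<phi> + \<psi>) z" for z :: "real \<times> real"
    proof -
      let ?A = "2 * pi * (of_int i * fst z + of_int j * snd z) + \<phi>"
      let ?B = "2 * pi * (of_int i' * fst z + of_int j' * snd z) + \<psi>"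
      have "2 * pi * (of_int (i - i') * fst z + of_int (j - j') * snd z) + (\<phi> - \<psi>) = ?A - ?B"
        "2 * pi * (of_int (i + i') * fst z + of_int (j + j') * snd z) + (\<phi> + \<psi>) = ?A + ?B"
        by (simp_all add: algebra_simps)
      then show ?thesis using cos_times_cos[of ?A ?B] by (simp only:) simp
    qed
    then show ?case by (simp only:) (intro trig_poly.add trig_poly.scale trig_poly.harmonic)
  next
    case (add f g)
    then show ?case by (simp only: distrib_left) (rule trig_poly.add)
  next
    case (scale f c)
    then show ?case by (simp only: mult.left_commute[of _ c]) (rule trig_poly.scale)
  qed
next
  case (add f f')
  then show ?case by (simp only: distrib_right) (intro trig_poly.add)
next
  case (scale f c)
  then show ?case by (simp only: mult.assoc) (intro trig_poly.scale)
qed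

text \<open>Embeds the torus as a compact set of pairs of complex numbers, where periodic functions
  become ordinary functions and real and imaginary parts separate points.\<close>

definition torus_map :: "real \<times> real \<Rightarrow> complex \<times> complex" where
  "torus_map z = (cis (2 * pi * fst z), cis (2 * pi * snd z))"

lemma torus_map_continuous: "continuous_on A torus_map"
  unfolding torus_map_def cis_conv_exp by (intro continuous_intros)

lemma cis_2pi_eqD:
  assumes "cis (2 * pi * x) = cis (2 * pi * y)"
  shows "x - y \<in> \<int>"
proof -
  have "sin (2 * pi * x) = sin (2 * pi * y) \<and> cos (2 * pi * x) = cos (2 * pi * y)"
    using assms by (simp add: complex_eq_iff)
  then obtain n :: int where "2 * pi * x = 2 * pi * y + 2 * pi * of_int n"
    unfolding sin_cos_eq_iff by auto
  then have "2 * pi * (x - y) = 2 * pi * of_int n" by (simp add: right_diff_distrib)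
  then have "x - y = of_int n" by simp
  then show ?thesis by simp
qed

lemma torus_cont_of_int:
  assumes "torus_cont f"
  shows "f (x + of_int i, y + of_int j) = f (x, y)"
proof -
  have x: "f (x + 1, y) = f (x, y)" and y: "f (x, y + 1) = f (x, y)" for x y
    using assms unfolding torus_cont_def by auto
  have xn: "f (x + of_nat n, y) = f (x, y)" for x y n
    by (induction n) (use x in \<open>auto simp: add.commute[of 1] add.assoc[symmetric]\<close>)
  have yn: "f (x, y + of_nat n) = f (x, y)" for x y n
    by (induction n) (use y in \<open>auto simp: add.commute[of 1] add.assoc[symmetric]\<close>)
  have xi: "f (x + of_int i, y) = f (x, y)" for x y i
  proof (cases i rule: int_cases2)
    case (nonneg n)
    then show ?thesis using xn by simp
  next
    case (nonpos n)
    then show ?thesis using xn[of "x - of_nat n" n y] by simp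
  qed
  have yi: "f (x, y + of_int j) = f (x, y)" for x y j
  proof (cases j rule: int_cases2)
    case (nonneg n)
    then show ?thesis using yn by simp
  next
    case (nonpos n)
    then show ?thesis using yn[of x "y - of_nat n" n] by simp
  qed
  show ?thesis by (simp add: xi yi)
qed

lemma torus_cont_factors:
  assumes f: "torus_cont f" and e: "torus_map z = torus_map w"
  shows "f z = f w"
proof -
  have "fst z - fst w \<in> \<int>" "snd z - snd w \<in> \<int>"
    using e unfolding torus_map_def by (auto intro: cis_2pi_eqD)
  then obtain i j where "fst z - fst w = of_int i" "snd z - snd w = of_int j" by (auto elim!: Ints_cases)
  then have "z = (fst w + of_int i, snd w + of_int j)" by (simp add: prod_eq_iff)
  then show ?thesis using torus_cont_of_int[OF f, of "fst w" i "snd w" j] by simp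
qed

lemma torus_map_in_square: "\<exists>w \<in> {0..1} \<times> {0..1}. torus_map w = torus_map z"
proof -
  have c: "cis (2 * pi * frac x) = cis (2 * pi * x)" for x :: real
  proof -
    have "cis (2 * pi * x) = cis (2 * pi * frac x + 2 * pi * of_int \<lfloor>x\<rfloor>)" by (simp add: frac_def algebra_simps)
    also have "\<dots> = cis (2 * pi * frac x) * cis (2 * pi * of_int \<lfloor>x\<rfloor>)" by (simp only: cis_mult)
    also have "cis (2 * pi * of_int \<lfloor>x\<rfloor>) = 1" by (rule cis_multiple_2pi) simp
    finally show ?thesis by simp
  qed
  show ?thesis
    by (rule bexI[of _ "(frac (fst z), frac (snd z))"]) (auto simp: torus_map_def c less_imp_le[OF frac_lt_1])
qed

lemma trig_poly_dense:
  assumes f: "torus_cont f" and e: "0 < e"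
  obtains g where "trig_poly g" "\<And>z. \<bar>f z - g z\<bar> < e"
proof -
  let ?I = "{0..1::real} \<times> {0..1::real}"
  define S where "S = torus_map ` ?I"
  define F where "F u = f (SOME z. torus_map z = u)" for u
  have F: "F (torus_map z) = f z" for z
  proof -
    have "torus_map (SOME w. torus_map w = torus_map z) = torus_map z"
      by (rule someI[of "\<lambda>w. torus_map w = torus_map z"]) (rule refl)
    then show ?thesis unfolding F_def by (rule torus_cont_factors[OF f])
  qed
  have cI: "compact ?I" by (intro compact_Times compact_Icc)
  have cS: "compact S" unfolding S_def by (intro compact_continuous_image torus_map_continuous cI)
  \<comment> \<open>The square is compact, so \<open>torus_map\<close> restricted to it is a
    quotient map onto \<open>S\<close>; \<open>F\<close> is continuous because its pull-back
    \<open>f\<close> is.\<close>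
  have contF: "continuous_on S F"
    unfolding continuous_openin_preimage_eq
  proof (intro allI impI)
    fix U :: "real set" assume U: "open U"
    have im: "torus_map z \<in> S" if "z \<in> ?I" for z unfolding S_def using that by (rule imageI)
    have "openin (top_of_set ?I) (?I \<inter> f -` U)"
      using f U unfolding torus_cont_def by (meson continuous_on_subset continuous_openin_preimage_gen subset_UNIV)
    moreover have "?I \<inter> torus_map -` (S \<inter> F -` U) = ?I \<inter> f -` U"
      by (rule set_eqI) (use im in \<open>auto simp only: Int_iff vimage_eq F\<close>)
    ultimately have "openin (top_of_set ?I) (?I \<inter> torus_map -` (S \<inter> F -` U))" by simp
    then show "openin (top_of_set S) (S \<inter> F -` U)"
      using Abstract_Topology_2.continuous_imp_quotient_map[OF torus_map_continuous S_def[symmetric] cI, of "S \<inter> F -` U"] by blast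
  qed
  define P where "P h \<longleftrightarrow> continuous_on S h \<and> trig_poly (\<lambda>z. h (torus_map z))" for h :: "complex \<times> complex \<Rightarrow> real"
  have shift: "sin x = cos (x + - (pi / 2))" for x :: real by (simp only: cos_add) simp
  have P1: "P (\<lambda>u. Re (fst u))" unfolding P_def torus_map_def
    using trig_poly.harmonic[of 1 0 0] by (auto intro!: continuous_intros)
  have P2: "P (\<lambda>u. Im (fst u))" unfolding P_def torus_map_def
    using trig_poly.harmonic[of 1 0 "- (pi / 2)"] by (auto intro!: continuous_intros simp: shift)
  have P3: "P (\<lambda>u. Re (snd u))" unfolding P_def torus_map_def
    using trig_poly.harmonic[of 0 1 0] by (auto intro!: continuous_intros)
  have P4: "P (\<lambda>u. Im (snd u))" unfolding P_def torus_map_def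
    using trig_poly.harmonic[of 0 1 "- (pi / 2)"] by (auto intro!: continuous_intros simp: shift)
  have "\<exists>h. P h \<and> (\<forall>u\<in>S. \<bar>F u - h u\<bar> < e)"
  proof (rule Stone_Weierstrass_HOL[OF cS, where P=P])
    show "\<exists>h. P h \<and> h u \<noteq> h v" if "u \<in> S \<and> v \<in> S \<and> u \<noteq> v" for u v
    proof -
      have "Re (fst u) \<noteq> Re (fst v) \<or> Im (fst u) \<noteq> Im (fst v) \<or> Re (snd u) \<noteq> Re (snd v) \<or> Im (snd u) \<noteq> Im (snd v)"
        using that by (auto simp: prod_eq_iff complex_eq_iff)
      then show ?thesis using P1 P2 P3 P4 by blast
    qed
  qed (auto simp: P_def trig_poly_const contF e intro!: continuous_intros trig_poly.add trig_poly_mult)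
  then obtain h where h: "P h" "\<And>u. u \<in> S \<Longrightarrow> \<bar>F u - h u\<bar> < e" by blast
  show ?thesis
  proof (rule that[of "\<lambda>z. h (torus_map z)"])
    show "trig_poly (\<lambda>z. h (torus_map z))" using h(1) by (simp add: P_def)
    fix z
    have "torus_map z \<in> S" unfolding S_def using torus_map_in_square[of z] by (metis imageI)
    then show "\<bar>f z - h (torus_map z)\<bar> < e" using h(2)[of "torus_map z"] F[of z] by simp
  qed
qed

lemma average_approx:
  fixes F G :: "nat \<Rightarrow> real"
  assumes "\<And>k. \<bar>F k - G k\<bar> \<le> e" "0 \<le> e"
  shows "\<bar>(\<Sum>k<N. F k) / real N - (\<Sum>k<N. G k) / real N\<bar> \<le> e"
proof (cases "N = 0")
  case False
  have "\<bar>\<Sum>k<N. F k - G k\<bar> \<le> (\<Sum>k<N. \<bar>F k - G k\<bar>)" by (rule sum_abs)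
  also have "\<dots> \<le> real N * e" using sum_bounded_above[of "{..<N}" "\<lambda>k. \<bar>F k - G k\<bar>" e] assms by simp
  finally have "\<bar>\<Sum>k<N. F k - G k\<bar> / real N \<le> e" using False by (simp add: pos_divide_le_eq mult.commute)
  moreover have "\<bar>\<Sum>k<N. F k - G k\<bar> / real N = \<bar>(\<Sum>k<N. F k - G k) / real N\<bar>" by simp
  ultimately show ?thesis by (simp add: sum_subtractf diff_divide_distrib)
qed (use assms in simp)

text \<open>The exceptional null set must not depend on \<open>f\<close>. Countably many harmonics
  suffice: integers \<open>i\<close>, \<open>j\<close> and the phases \<open>0\<close> and
  \<open>pi / 2\<close>, which generate all others linearly; uniform approximation by trigonometric
  polynomials does the rest.\<close>

lemma pointwise_generic_harmonics:
  assumes "prob_space \<rho>" and meas: "\<And>f :: real \<times> real \<Rightarrow> real. continuous_on UNIV f \<Longrightarrow> f \<in> borel_measurable \<rho>"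
    and conv: "\<And>i j \<phi>. AE z in \<mu>.
      (\<lambda>N. (\<Sum>k<N. (\<lambda>z. cos (2 * pi * (of_int i * fst z + of_int j * snd z) + \<phi>)) ((T ^^ k) z)) / real N)
        \<longlonglongrightarrow> (\<integral>z. cos (2 * pi * (of_int i * fst z + of_int j * snd z) + \<phi>) \<partial>\<rho>)"
  shows "pointwise_generic \<mu> T \<rho>"
proof -
  interpret R: prob_space \<rho> by fact
  let ?h = "\<lambda>i j \<phi> z. cos (2 * pi * (of_int i * fst z + of_int j * snd z) + \<phi>) :: real"
  define av where "av f z N = (\<Sum>k<N. f ((T ^^ k) z)) / real N" for f :: "real \<times> real \<Rightarrow> real" and z N
  have int: "integrable \<rho> f" if "continuous_on UNIV f" "\<And>z. \<bar>f z\<bar> \<le> B" for f and B :: real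
    by (rule R.integrable_const_bound[of _ B]) (use that meas in auto)
  have trig_int: "integrable \<rho> g" if "trig_poly g" for g
    using trig_poly_bounded[OF that] int[OF trig_poly_continuous[OF that]] by blast
  have "AE z in \<mu>. \<forall>i j. av (?h i j 0) z \<longlonglongrightarrow> integral\<^sup>L \<rho> (?h i j 0)"
    "AE z in \<mu>. \<forall>i j. av (?h i j (pi / 2)) z \<longlonglongrightarrow> integral\<^sup>L \<rho> (?h i j (pi / 2))"
    using conv unfolding AE_all_countable av_def by blast+
  then show ?thesis
    unfolding pointwise_generic_def
  proof eventually_elim
    case (elim z)
    have trig: "av g z \<longlonglongrightarrow> integral\<^sup>L \<rho> g" if "trig_poly g" for g
      using that
    proof (induction rule: trig_poly.induct)
      case (harmonic i j \<phi>)
      have e: "?h i j \<phi> = (\<lambda>z. cos \<phi> * ?h i j 0 z + sin \<phi> * ?h i j (pi / 2) z)"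
        by (rule ext) (simp add: cos_add)
      have "av (?h i j \<phi>) z = (\<lambda>N. cos \<phi> * av (?h i j 0) z N + sin \<phi> * av (?h i j (pi / 2)) z N)"
        unfolding e av_def by (rule ext) (simp add: sum.distrib sum_distrib_left[symmetric] add_divide_distrib)
      moreover have "integral\<^sup>L \<rho> (?h i j \<phi>) = cos \<phi> * integral\<^sup>L \<rho> (?h i j 0) + sin \<phi> * integral\<^sup>L \<rho> (?h i j (pi / 2))"
      proof -
        have "integrable \<rho> (?h i j 0)" "integrable \<rho> (?h i j (pi / 2))" by (intro trig_int trig_poly.harmonic)+
        then show ?thesis unfolding e
          by (subst Bochner_Integration.integral_add) (simp_all only: integrable_mult_right integral_mult_right_zero)
      qed
      ultimately show ?case using elim by (simp only:) (intro tendsto_intros, auto)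
    next
      case (add f g)
      have "av (\<lambda>z. f z + g z) z = (\<lambda>N. av f z N + av g z N)"
        unfolding av_def by (rule ext) (simp add: sum.distrib add_divide_distrib)
      then show ?case using add by (simp add: trig_int tendsto_add)
    next
      case (scale f c)
      have "av (\<lambda>z. c * f z) z = (\<lambda>N. c * av f z N)"
        unfolding av_def by (rule ext) (simp add: sum_distrib_left[symmetric])
      then show ?case using scale by (simp add: tendsto_mult_left)
    qed
    have "av f z \<longlonglongrightarrow> integral\<^sup>L \<rho> f" if f: "torus_cont f" for f
    proof (rule LIMSEQ_I)
      fix e :: real assume e: "0 < e"
      obtain g where g: "trig_poly g" "\<And>z. \<bar>f z - g z\<bar> < e / 3" by (rule trig_poly_dense[OF f, of "e / 3"]) (use e in auto)
      obtain B where B: "\<forall>z. \<bar>g z\<bar> \<le> B" using trig_poly_bounded[OF g(1)] by blast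
      have fi: "integrable \<rho> f"
      proof (rule int[of f "B + e / 3"])
        show "continuous_on UNIV f" using f by (simp add: torus_cont_def)
        show "\<bar>f z\<bar> \<le> B + e / 3" for z using g(2)[of z] B[rule_format, of z] by linarith
      qed
      obtain n0 where n0: "\<And>n. n0 \<le> n \<Longrightarrow> norm (av g z n - integral\<^sup>L \<rho> g) < e / 3"
        using LIMSEQ_D[OF trig[OF g(1)], of "e / 3"] e by auto
      have "\<bar>integral\<^sup>L \<rho> f - integral\<^sup>L \<rho> g\<bar> \<le> e / 3"
      proof -
        have "\<bar>integral\<^sup>L \<rho> f - integral\<^sup>L \<rho> g\<bar> = \<bar>\<integral>z. f z - g z \<partial>\<rho>\<bar>" using fi trig_int[OF g(1)] by simp
        also have "\<dots> \<le> (\<integral>z. \<bar>f z - g z\<bar> \<partial>\<rho>)" by (rule integral_abs_bound)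
        also have "\<dots> \<le> (\<integral>z. e / 3 \<partial>\<rho>)"
          using fi trig_int[OF g(1)] g(2) by (intro integral_mono) (auto intro: less_imp_le)
        finally show ?thesis by (simp add: R.prob_space)
      qed
      moreover have "\<bar>av f z n - av g z n\<bar> \<le> e / 3" for n
        unfolding av_def by (rule average_approx[OF less_imp_le[OF g(2)]]) (use e in simp)
      moreover have "\<bar>w - x\<bar> < e" if "\<bar>x - y\<bar> \<le> e / 3" "\<bar>w - v\<bar> \<le> e / 3" "norm (v - y) < e / 3" for v w x y :: real
        using that unfolding real_norm_def by linarith
      ultimately have "norm (av f z n - integral\<^sup>L \<rho> f) < e" if "n0 \<le> n" for n
        using n0[OF that] unfolding real_norm_def by blast
      then show "\<exists>n0. \<forall>n\<ge>n0. norm (av f z n - integral\<^sup>L \<rho> f) < e" by blast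
    qed
    then show ?case unfolding av_def by blast
  qed
qed

section \<open>Harmonics against product measures\<close>

lemma leb01_prob_space: "prob_space leb01"
  unfolding leb01_def by (rule prob_space_restrict_space) auto

lemma ident_measurable_leb01: "(\<lambda>x. x) \<in> borel_measurable leb01"
  unfolding leb01_def by (intro measurable_restrict_space1) simp

lemma integral_leb01_cos:
  assumes "i \<noteq> 0"
  shows "(\<integral>x. cos (2 * pi * (of_int i * x) + c) \<partial>leb01) = 0"
proof -
  let ?w = "2 * pi * of_int i"
  let ?F = "\<lambda>x. sin (?w * x + c) / ?w"
  have w: "?w \<noteq> 0" using assms by simp
  have d: "DERIV ?F x :> cos (?w * x + c)" for x
    using w by (auto intro!: derivative_eq_intros)
  have "(\<integral>x. cos (?w * x + c) * indicator {0..1} x \<partial>lborel) = ?F 1 - ?F 0"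
    by (rule integral_FTC_Icc_real) (auto intro!: d continuous_intros)
  also have "\<dots> = 0" using sin.plus_of_int[of c i] by (simp add: add.commute mult_ac)
  finally show ?thesis unfolding leb01_def by (subst integral_restrict_space) (simp_all add: mult_ac)
qed

text \<open>The factors have different measurable structures: \<open>leb01\<close> lives on the unit
  interval, a push-forward on all reals. Measurability of the identity into \<open>borel\<close> is
  the common property that makes continuous functions measurable on the product.\<close>

context
  fixes M N :: "real measure"
  assumes M: "prob_space M" "(\<lambda>x. x) \<in> borel_measurable M"
    and N: "prob_space N" "(\<lambda>x. x) \<in> borel_measurable N"
begin

lemma pair_prob_space: "prob_space (M \<Otimes>\<^sub>M N)"
proof -
  interpret M: prob_space M by (rule M)
  interpret N: prob_space N by (rule N)
  interpret pair_prob_space M N ..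
  show ?thesis by (rule prob_space_axioms)
qed

lemma continuous_measurable_pair:
  fixes f :: "real \<times> real \<Rightarrow> real"
  assumes "continuous_on UNIV f"
  shows "f \<in> borel_measurable (M \<Otimes>\<^sub>M N)"
proof -
  have "(\<lambda>z. (fst z, snd z)) \<in> M \<Otimes>\<^sub>M N \<rightarrow>\<^sub>M borel"
    by (intro borel_measurable_Pair measurable_compose[OF measurable_fst M(2)] measurable_compose[OF measurable_snd N(2)])
  then have "(\<lambda>z. f (fst z, snd z)) \<in> borel_measurable (M \<Otimes>\<^sub>M N)"
    by (rule measurable_compose[OF _ borel_measurable_continuous_onI[OF assms]])
  then show ?thesis by simp
qed

lemma pair_harmonic_fst:
  "(\<integral>z. cos (2 * pi * (a * fst z + b * snd z) + \<phi>) \<partial>(M \<Otimes>\<^sub>M N))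
    = (\<integral>x. \<integral>y. cos (2 * pi * (a * x + b * y) + \<phi>) \<partial>N \<partial>M)" (is ?fst)
  and pair_harmonic_snd:
  "(\<integral>z. cos (2 * pi * (a * fst z + b * snd z) + \<phi>) \<partial>(M \<Otimes>\<^sub>M N))
    = (\<integral>y. \<integral>x. cos (2 * pi * (a * x + b * y) + \<phi>) \<partial>M \<partial>N)" (is ?snd)
proof -
  interpret M: prob_space M by (rule M)
  interpret N: prob_space N by (rule N)
  interpret P: pair_prob_space M N ..
  let ?f = "\<lambda>z :: real \<times> real. cos (2 * pi * (a * fst z + b * snd z) + \<phi>)"
  have i: "integrable (M \<Otimes>\<^sub>M N) ?f"
    by (rule P.integrable_const_bound[of _ 1])
      (auto intro!: continuous_measurable_pair continuous_intros)
  show ?fst using P.integral_fst'[OF i] by simp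
  show ?snd using P.integral_snd[of "\<lambda>x y. ?f (x, y)"] i by (simp add: case_prod_beta')
qed

end

lemmas leb01 = leb01_prob_space ident_measurable_leb01

section \<open>Genericity\<close>

lemma (in digits) harmonic_average_tendsto_0:
  fixes i :: int
  assumes NA: "\<And>e. e > 0 \<Longrightarrow> \<exists>q. \<forall>K. Q K q \<le> e"
    and irr: "ln (real m) / ln (real p) \<notin> \<rat>" and m: "2 \<le> m" and b: "b < m" and i: "i \<noteq> 0"
  shows "AE z in M. (\<lambda>N. (\<Sum>k<N. cos (2 * pi * (of_int i * (real m ^ k * X z) + c * (real b ^ k * Y z)) + \<phi>)) / real N) \<longlonglongrightarrow> 0"
proof (cases "0 < i")
  case True
  then show ?thesis
    using wave_average_tendsto_0[OF NA irr m b, of "of_int i" c \<phi>] unfolding wave_def by (simp add: mult.assoc)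
next
  case False
  \<comment> \<open>Cosine is even, so negating frequencies and phase reduces to a positive
    \<open>i\<close>.\<close>
  have e: "cos (2 * pi * (of_int i * x + c * y) + \<phi>) = cos (2 * pi * (- of_int i * x + - c * y) + - \<phi>)" for x y :: real
    by (subst cos_minus[symmetric]) (simp add: algebra_simps)
  show ?thesis
    using wave_average_tendsto_0[OF NA irr m b, of "- of_int i" "- c" "- \<phi>"] False i
    unfolding wave_def e by (simp add: mult.assoc)
qed

text \<open>Characters ignore integers, so iterates may be computed without reduction modulo
  \<open>1\<close>. Starting from \<open>frac x\<close> also covers \<open>k = 0\<close> at points
  outside \<open>[0, 1)\<close>, where \<open>Tq\<close> has not acted yet.\<close>

lemma Tq_iterate: "\<exists>i :: int. (Tq a ^^ k) x = real a ^ k * frac x + of_int i"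
proof (induction k)
  case 0
  show ?case by (rule exI[of _ "\<lfloor>x\<rfloor>"]) (simp add: frac_def)
next
  case (Suc k)
  then obtain i :: int where i: "(Tq a ^^ k) x = real a ^ k * frac x + of_int i" by blast
  have "(Tq a ^^ Suc k) x = real a * (Tq a ^^ k) x - of_int \<lfloor>real a * (Tq a ^^ k) x\<rfloor>"
    by (simp add: Tq_def frac_def)
  also have "real a * (Tq a ^^ k) x = real a ^ Suc k * frac x + of_int (int a * i)" unfolding i by (simp add: distrib_left)
  finally have "(Tq a ^^ Suc k) x = real a ^ Suc k * frac x + of_int (int a * i - \<lfloor>real a ^ Suc k * frac x + of_int (int a * i)\<rfloor>)"
    by (simp only: of_int_diff add_diff_eq)
  then show ?case by blast
qed

lemma Tprod_iterate: "(Tprod a b ^^ k) z = ((Tq a ^^ k) (fst z), (Tq b ^^ k) (snd z))"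
  by (induction k) (auto simp: Tprod_def)

lemma harmonic_Tprod:
  fixes i j :: int
  shows "cos (2 * pi * (of_int i * fst ((Tprod a b ^^ k) z) + of_int j * snd ((Tprod a b ^^ k) z)) + \<phi>)
    = cos (2 * pi * (of_int i * (real a ^ k * frac (fst z)) + of_int j * (real b ^ k * frac (snd z))) + \<phi>)"
proof -
  obtain r s :: int where rs: "(Tq a ^^ k) (fst z) = real a ^ k * frac (fst z) + of_int r"
    "(Tq b ^^ k) (snd z) = real b ^ k * frac (snd z) + of_int s"
    using Tq_iterate by blast
  have "2 * pi * (of_int i * fst ((Tprod a b ^^ k) z) + of_int j * snd ((Tprod a b ^^ k) z)) + \<phi>
    = 2 * pi * (of_int i * (real a ^ k * frac (fst z)) + of_int j * (real b ^ k * frac (snd z))) + \<phi> + (2 * pi) * of_int (i * r + j * s)"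
    unfolding Tprod_iterate rs fst_conv snd_conv by (simp add: algebra_simps)
  then show ?thesis by (simp only: cos_add[of _ "(2 * pi) * of_int _"] cos_int_2pin sin_int_2pin mult_1_right mult_zero_right diff_zero)
qed

lemma ergodic_digits_Tprod:
  assumes p: "2 \<le> p" and sets: "sets \<mu> = sets borel" and prob: "prob_space \<mu>" and erg: "ergodic_meas (Tprod p p) \<mu>"
  shows "ergodic_digits \<mu> (Tprod p p) p (\<lambda>z. frac (fst z)) (\<lambda>z. frac (snd z))"
    and "ergodic_digits \<mu> (Tprod p p) p (\<lambda>z. frac (snd z)) (\<lambda>z. frac (fst z))"
proof -
  interpret prob_space \<mu> by (rule prob)
  have T: "Tprod p p \<in> \<mu> \<rightarrow>\<^sub>M \<mu>" "distr \<mu> \<mu> (Tprod p p) = \<mu>"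
    using erg unfolding ergodic_meas_def invariant_meas_def by auto
  have frac: "(frac :: real \<Rightarrow> real) \<in> borel_measurable borel" unfolding frac_def by measurable
  have m: "(\<lambda>z. frac (fst z)) \<in> borel_measurable \<mu>" "(\<lambda>z. frac (snd z)) \<in> borel_measurable \<mu>"
    unfolding measurable_cong_sets[OF sets refl]
    by (intro measurable_compose[OF _ frac] borel_measurable_continuous_onI continuous_intros)+
  have erg': "prob A = 0 \<or> prob A = 1" if "A \<in> sets \<mu>" "Tprod p p -` A \<inter> space \<mu> = A" for A
    using erg that unfolding ergodic_meas_def by (auto simp: measure_def)
  show "ergodic_digits \<mu> (Tprod p p) p (\<lambda>z. frac (fst z)) (\<lambda>z. frac (snd z))"
    by unfold_locales (use T m p erg' in \<open>auto simp: Tprod_def Tq_def frac_of_nat_mult_frac frac_lt_1\<close>)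
  show "ergodic_digits \<mu> (Tprod p p) p (\<lambda>z. frac (snd z)) (\<lambda>z. frac (fst z))"
    by unfold_locales (use T m p erg' in \<open>auto simp: Tprod_def Tq_def frac_of_nat_mult_frac frac_lt_1\<close>)
qed

text \<open>\<open>Tprod p p\<close> maps the whole plane into the half-open square, so invariance
  gives this square full measure; in particular the sides where a coordinate is \<open>1\<close> are
  null.\<close>

lemma invariant_half_open_square:
  assumes sets: "sets \<mu> = sets borel" and "prob_space \<mu>" and inv: "invariant_meas (Tprod p p) \<mu>"
  shows "measure \<mu> ({0..<1} \<times> {0..<1}) = 1"
proof -
  interpret prob_space \<mu> by fact
  let ?S = "{0..<1::real} \<times> {0..<1::real}"
  have T: "Tprod p p \<in> \<mu> \<rightarrow>\<^sub>M \<mu>" "distr \<mu> \<mu> (Tprod p p) = \<mu>" using inv unfolding invariant_meas_def by auto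
  have S: "?S \<in> sets \<mu>" unfolding sets borel_prod[symmetric] by (intro pair_measureI) auto
  have "Tprod p p -` ?S \<inter> space \<mu> = space \<mu>" by (auto simp: Tprod_def Tq_def frac_lt_1)
  then have "measure (distr \<mu> \<mu> (Tprod p p)) ?S = prob (space \<mu>)" using measure_distr[OF T(1) S] by simp
  then show ?thesis using T(2) prob_space by simp
qed

theorem theorem1p1:
  fixes m p :: nat and \<mu> :: "(real \<times> real) measure" and a b :: real
  assumes "2 \<le> p" and "p < m"
    and "ln (real p) / ln (real m) \<notin> \<rat>"
    and "sets \<mu> = sets borel" and "prob_space \<mu>"
    and "emeasure \<mu> ({0..1} \<times> {0..1}) = 1"
    and "ergodic_meas (Tprod p p) \<mu>"
    and "a \<noteq> 0" and "b \<noteq> 0"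
    and "measure_dim (distr \<mu> borel (\<lambda>z. a * fst z + b * snd z)) < measure_dim \<mu>"
  shows "pointwise_generic \<mu> (Tprod m p) (leb01 \<Otimes>\<^sub>M distr \<mu> borel snd)
     \<and> (\<forall>n::nat. p < n \<and> n < m \<and> ln (real p) / ln (real n) \<notin> \<rat> \<longrightarrow>
            pointwise_generic \<mu> (Tprod m n) (leb01 \<Otimes>\<^sub>M leb01))"
proof -
  let ?X = "\<lambda>z :: real \<times> real. frac (fst z)" and ?Y = "\<lambda>z :: real \<times> real. frac (snd z)"
  let ?S = "{0..<1::real} \<times> {0..<1::real}"
  note erg = ergodic_digits_Tprod[OF assms(1,4,5,7)]
  interpret XY: ergodic_digits \<mu> "Tprod p p" p ?X ?Y by (rule erg(1))
  interpret YX: ergodic_digits \<mu> "Tprod p p" p ?Y ?X by (rule erg(2))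
  have S: "?S \<in> sets \<mu>" unfolding assms(4) borel_prod[symmetric] by (intro pair_measureI) auto
  have S1: "XY.prob ?S = 1"
    by (rule invariant_half_open_square[OF assms(4,5), of p]) (use assms(7) in \<open>simp add: ergodic_meas_def\<close>)
  have dist: "dist z w \<le> \<bar>fst z - fst w\<bar> + \<bar>snd z - snd w\<bar>" for z w :: "real \<times> real"
    using sqrt_sum_squares_le_sum_abs[of "fst z - fst w" "snd z - snd w"] by (simp add: dist_prod_def dist_real_def)
  have fr: "?X z = fst z" "?Y z = snd z" if "z \<in> ?S" for z using that by (auto simp: frac_eq)
  interpret MXY: metric_digits \<mu> "Tprod p p" p ?X ?Y ?S
    by unfold_locales (use S S1 dist fr in \<open>simp_all only:\<close>)
  interpret MYX: metric_digits \<mu> "Tprod p p" p ?Y ?X ?S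
    by unfold_locales (use S S1 dist fr in \<open>simp_all only: add.commute\<close>)
  let ?f = "\<lambda>z :: real \<times> real. a * fst z + b * snd z"
  have fm: "?f \<in> borel_measurable \<mu>"
    unfolding measurable_cong_sets[OF assms(4) refl] by (intro borel_measurable_continuous_onI continuous_intros)
  have fX: "?f z - ?f w = a * (?X z - ?X w) + b * (?Y z - ?Y w)" and fY: "?f z - ?f w = b * (?Y z - ?Y w) + a * (?X z - ?X w)"
    if "z \<in> ?S" "w \<in> ?S" for z w
    using fr[OF that(1)] fr[OF that(2)] by (simp_all only:) (simp_all add: algebra_simps)
  \<comment> \<open>Were the digits of the first coordinate predictable, strips would determine the
    second one because \<open>b \<noteq> 0\<close>, and the projection could not lower the
    dimension.\<close>
  have NA_X: "\<exists>q. \<forall>K. XY.Q K q \<le> e" if "0 < e" for e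
  proof (rule ccontr)
    assume "\<not> ?thesis"
    then have det: "\<And>q e. 0 < e \<Longrightarrow> \<exists>K. 1 - e \<le> XY.Q K q" using XY.Q_zero_one that by blast
    show False using MXY.measure_dim_le_projection[OF \<open>b \<noteq> 0\<close> fX fm det] assms(10) by linarith
  qed
  \<comment> \<open>The same with the coordinates exchanged; here \<open>a \<noteq> 0\<close> makes
    the strips transversal.\<close>
  have NA_Y: "\<exists>q. \<forall>K. YX.Q K q \<le> e" if "0 < e" for e
  proof (rule ccontr)
    assume "\<not> ?thesis"
    then have det: "\<And>q e. 0 < e \<Longrightarrow> \<exists>K. 1 - e \<le> YX.Q K q" using YX.Q_zero_one that by blast
    show False using MYX.measure_dim_le_projection[OF \<open>a \<noteq> 0\<close> fY fm det] assms(10) by linarith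
  qed
  have irr: "ln (real m') / ln (real p) \<notin> \<rat>" if "ln (real p) / ln (real m') \<notin> \<rat>" for m'
    using that Rats_inverse[of "ln (real m') / ln (real p)"] by (auto simp: inverse_divide)
  have m: "2 \<le> m" using assms(1,2) by simp
  let ?\<nu> = "distr \<mu> borel snd"
  have snd: "snd \<in> borel_measurable \<mu>"
    unfolding measurable_cong_sets[OF assms(4) refl] by (intro borel_measurable_continuous_onI continuous_intros)
  have \<nu>: "prob_space ?\<nu>" "(\<lambda>x. x) \<in> borel_measurable ?\<nu>"
    by (rule XY.prob_space_distr[OF snd]) simp
  let ?h = "\<lambda>i j \<phi> z. cos (2 * pi * (of_int i * fst z + of_int j * snd z) + \<phi>) :: real"
  have int0: "integral\<^sup>L (leb01 \<Otimes>\<^sub>M N) (?h i j \<phi>) = 0"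
    if N: "prob_space N" "(\<lambda>x. x) \<in> borel_measurable N" and "i \<noteq> 0" for N i j \<phi>
  proof -
    have e: "cos (2 * pi * (of_int i * x + of_int j * y) + \<phi>) = cos (2 * pi * (of_int i * x) + (2 * pi * (of_int j * y) + \<phi>))"
      for x y :: real by (simp add: distrib_left add.assoc)
    show ?thesis unfolding pair_harmonic_snd[OF leb01 N] unfolding e integral_leb01_cos[OF \<open>i \<noteq> 0\<close>] by simp
  qed
  have gen1: "AE z in \<mu>. (\<lambda>N. (\<Sum>k<N. ?h i j \<phi> ((Tprod m b' ^^ k) z)) / real N) \<longlonglongrightarrow> 0" if "i \<noteq> 0" "b' < m" for i j \<phi> b'
    unfolding harmonic_Tprod by (rule XY.harmonic_average_tendsto_0[OF NA_X irr[OF assms(3)] m that(2,1)])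
  have "pointwise_generic \<mu> (Tprod m p) (leb01 \<Otimes>\<^sub>M ?\<nu>)"
  proof (rule pointwise_generic_harmonics)
    show "prob_space (leb01 \<Otimes>\<^sub>M ?\<nu>)" by (rule pair_prob_space[OF leb01 \<nu>])
    show "f \<in> borel_measurable (leb01 \<Otimes>\<^sub>M ?\<nu>)" if "continuous_on UNIV f" for f :: "real \<times> real \<Rightarrow> real"
      by (rule continuous_measurable_pair[OF leb01 \<nu> that])
    fix i j :: int and \<phi> :: real
    show "AE z in \<mu>. (\<lambda>N. (\<Sum>k<N. ?h i j \<phi> ((Tprod m p ^^ k) z)) / real N) \<longlonglongrightarrow> integral\<^sup>L (leb01 \<Otimes>\<^sub>M ?\<nu>) (?h i j \<phi>)"
    proof (cases "i = 0")
      case True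
      interpret L: prob_space leb01 by (rule leb01)
      have hm: "?h 0 j \<phi> \<in> borel_measurable \<mu>"
        unfolding measurable_cong_sets[OF assms(4) refl] by (intro borel_measurable_continuous_onI continuous_intros)
      have "integral\<^sup>L (leb01 \<Otimes>\<^sub>M ?\<nu>) (?h 0 j \<phi>) = (\<integral>y. cos (2 * pi * (of_int j * y) + \<phi>) \<partial>?\<nu>)"
        unfolding pair_harmonic_snd[OF leb01 \<nu>] by (simp add: L.prob_space)
      also have "\<dots> = integral\<^sup>L \<mu> (?h 0 j \<phi>)"
        by (subst integral_distr[OF snd]) (auto intro!: borel_measurable_continuous_onI continuous_intros)
      finally have e: "integral\<^sup>L (leb01 \<Otimes>\<^sub>M ?\<nu>) (?h 0 j \<phi>) = integral\<^sup>L \<mu> (?h 0 j \<phi>)" .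
      \<comment> \<open>Without a first coordinate the base \<open>m\<close> may be replaced by
        \<open>p\<close>, which turns the orbit into one of the ergodic map.\<close>
      have "?h 0 j \<phi> ((Tprod m p ^^ k) z) = ?h 0 j \<phi> ((Tprod p p ^^ k) z)" for k z
        unfolding harmonic_Tprod by simp
      then show ?thesis unfolding True e using XY.birkhoff[OF hm, of 1] by simp
    next
      case False
      then show ?thesis using gen1[OF False assms(2)] int0[OF \<nu> False] by simp
    qed
  qed
  moreover have "pointwise_generic \<mu> (Tprod m n) (leb01 \<Otimes>\<^sub>M leb01)"
    if n: "p < n" "n < m" "ln (real p) / ln (real n) \<notin> \<rat>" for n
  proof (rule pointwise_generic_harmonics)
    show "prob_space (leb01 \<Otimes>\<^sub>M leb01)" by (rule pair_prob_space[OF leb01 leb01])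
    show "f \<in> borel_measurable (leb01 \<Otimes>\<^sub>M leb01)" if "continuous_on UNIV f" for f :: "real \<times> real \<Rightarrow> real"
      by (rule continuous_measurable_pair[OF leb01 leb01 that])
    fix i j :: int and \<phi> :: real
    interpret L: prob_space leb01 by (rule leb01)
    consider "i \<noteq> 0" | "i = 0" "j \<noteq> 0" | "i = 0" "j = 0" by blast
    then show "AE z in \<mu>. (\<lambda>N. (\<Sum>k<N. ?h i j \<phi> ((Tprod m n ^^ k) z)) / real N) \<longlonglongrightarrow> integral\<^sup>L (leb01 \<Otimes>\<^sub>M leb01) (?h i j \<phi>)"
    proof cases
      case 1
      then show ?thesis using gen1[OF 1 n(2)] int0[OF leb01 1] by simp
    next
      case 2
      have "2 \<le> n" "0 < n" using n(1) assms(1) by auto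
      have "integral\<^sup>L (leb01 \<Otimes>\<^sub>M leb01) (?h 0 j \<phi>) = 0"
        unfolding pair_harmonic_fst[OF leb01 leb01] using integral_leb01_cos[OF 2(2)] by simp
      \<comment> \<open>The second coordinate now leads, with base \<open>n\<close>; the coefficient
        \<open>0\<close> removes the other one, and its base \<open>0\<close> meets the requirement
        \<open>b < n\<close>.\<close>
      moreover have "AE z in \<mu>. (\<lambda>N. (\<Sum>k<N. ?h 0 j \<phi> ((Tprod m n ^^ k) z)) / real N) \<longlonglongrightarrow> 0"
        unfolding harmonic_Tprod
        using YX.harmonic_average_tendsto_0[OF NA_Y irr[OF n(3)] \<open>2 \<le> n\<close> \<open>0 < n\<close> 2(2), of 0 \<phi>] by simp
      ultimately show ?thesis unfolding 2(1) by simp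
    next
      case 3
      have lim: "(\<lambda>N. (\<Sum>k<N. ?h 0 0 \<phi> ((Tprod m n ^^ k) z)) / real N) \<longlonglongrightarrow> cos \<phi>" for z
        by (rule tendsto_eventually, rule eventually_mono[OF eventually_gt_at_top[of 0]]) simp
      have int: "integral\<^sup>L (leb01 \<Otimes>\<^sub>M leb01) (?h 0 0 \<phi>) = cos \<phi>"
        unfolding pair_harmonic_fst[OF leb01 leb01] by (simp add: L.prob_space)
      show ?thesis unfolding 3 int by (intro AE_I2 lim)
    qed
  qed
  ultimately show ?thesis by blast
qed

end
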